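(* Let $\Gamma$ be a nonlinear connection on $E=J^1(\mathbb{R},M)$ and let $\nabla$ be a $\Gamma$-linear connection on $E$. If $X$ is an arbitrary d-vector field on $E$, locally expressed by $$X=X^1\frac{\delta}{\delta t}+X^i\frac{\delta}{\delta x^i}+X_{(1)}^{(i)}\frac{\partial}{\partial y_1^i},$$ then the following Ricci identities of $\nabla$ are true. $(h_{\mathbb{R}})$: $$X_{/1|k}^1-X_{|k/1}^1=X^1\bar R_{11k}^1-X_{/1}^1\bar T_{1k}^1-X_{|r}^1T_{1k}^r-X^1|_{(r)}^{(1)}R_{(1)1k}^{(r)},$$ $$X_{|j|k}^1-X_{|k|j}^1=X^1\bar R_{1jk}^1-X_{|r}^1T_{jk}^r-X^1|_{(r)}^{(1)}R_{(1)jk}^{(r)},$$ $$X_{/1}^1|_{(k)}^{(1)}-X^1|_{(k)/1}^{(1)}=X^1\bar P_{11(k)}^{1\;\;(1)}-X_{/1}^1\bar C_{1(k)}^{1(1)}-X^1|_{(r)}^{(1)}P_{(1)1(k)}^{(r)\;\;(1)},$$ $$X_{|j}^1|_{(k)}^{(1)}-X^1|_{(k)|j}^{(1)}=X^1\bar P_{1j(k)}^{1\;\;(1)}-X_{|r}^1C_{j(k)}^{r(1)}-X^1|_{(r)}^{(1)}P_{(1)j(k)}^{(r)\;\;(1)},$$ $$X^1|_{(j)}^{(1)}|_{(k)}^{(1)}-X^1|_{(k)}^{(1)}|_{(j)}^{(1)}=X^1\bar S_{1(j)(k)}^{1(1)(1)}-X^1|_{(r)}^{(1)}S_{(1)(j)(k)}^{(r)(1)(1)};$$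 $(h_M)$: $$X_{/1|k}^i-X_{|k/1}^i=X^rR_{r1k}^i-X_{/1}^i\bar T_{1k}^1-X_{|r}^iT_{1k}^r-X^i|_{(r)}^{(1)}R_{(1)1k}^{(r)},$$ $$X_{|j|k}^i-X_{|k|j}^i=X^rR_{rjk}^i-X_{|r}^iT_{jk}^r-X^i|_{(r)}^{(1)}R_{(1)jk}^{(r)},$$ $$X_{/1}^i|_{(k)}^{(1)}-X^i|_{(k)/1}^{(1)}=X^rP_{r1(k)}^{i\;\;(1)}-X_{/1}^i\bar C_{1(k)}^{1(1)}-X^i|_{(r)}^{(1)}P_{(1)1(k)}^{(r)\;\;(1)},$$ $$X_{|j}^i|_{(k)}^{(1)}-X^i|_{(k)|j}^{(1)}=X^rP_{rj(k)}^{i\;\;(1)}-X_{|r}^iC_{j(k)}^{r(1)}-X^i|_{(r)}^{(1)}P_{(1)j(k)}^{(r)\;\;(1)},$$ $$X^i|_{(j)}^{(1)}|_{(k)}^{(1)}-X^i|_{(k)}^{(1)}|_{(j)}^{(1)}=X^rS_{r(j)(k)}^{i(1)(1)}-X^i|_{(r)}^{(1)}S_{(1)(j)(k)}^{(r)(1)(1)};$$ $(v)$: $$X_{(1)/1|k}^{(i)}-X_{(1)|k/1}^{(i)}=X_{(1)}^{(r)}R_{(1)(r)1k}^{(i)(1)}-X_{(1)/1}^{(i)}\bar T_{1k}^1-X_{(1)|r}^{(i)}T_{1k}^r-X_{(1)}^{(i)}|_{(r)}^{(1)}R_{(1)1k}^{(r)},$$ $$X_{(1)|j|k}^{(i)}-X_{(1)|k|j}^{(i)}=X_{(1)}^{(r)}R_{(1)(r)jk}^{(i)(1)}-X_{(1)|r}^{(i)}T_{jk}^r-X_{(1)}^{(i)}|_{(r)}^{(1)}R_{(1)jk}^{(r)},$$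 $$X_{(1)/1}^{(i)}|_{(k)}^{(1)}-X_{(1)}^{(i)}|_{(k)/1}^{(1)}=X_{(1)}^{(r)}P_{(1)(r)1(k)}^{(i)(1)\;\;(1)}-X_{(1)/1}^{(i)}\bar C_{1(k)}^{1(1)}-X_{(1)}^{(i)}|_{(r)}^{(1)}P_{(1)1(k)}^{(r)\;\;(1)},$$ $$X_{(1)|j}^{(i)}|_{(k)}^{(1)}-X_{(1)}^{(i)}|_{(k)|j}^{(1)}=X_{(1)}^{(r)}P_{(1)(r)j(k)}^{(i)(1)\;\;(1)}-X_{(1)|r}^{(i)}C_{j(k)}^{r(1)}-X_{(1)}^{(i)}|_{(r)}^{(1)}P_{(1)j(k)}^{(r)\;\;(1)},$$ $$X_{(1)}^{(i)}|_{(j)}^{(1)}|_{(k)}^{(1)}-X_{(1)}^{(i)}|_{(k)}^{(1)}|_{(j)}^{(1)}=X_{(1)}^{(r)}S_{(1)(r)(j)(k)}^{(i)(1)(1)(1)}-X_{(1)}^{(i)}|_{(r)}^{(1)}S_{(1)(j)(k)}^{(r)(1)(1)}.$$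
   Context: $M$ is a smooth $n$-dimensional manifold with local coordinates $(x^i)_{i=\overline{1,n}}$, $\mathbb{R}$ is the time manifold with coordinate $t$, and $E=J^1(\mathbb{R},M)\to\mathbb{R}\times M$ is the 1-jet vector bundle, with local coordinates $(t,x^i,y_1^i)$ transforming by $$\tilde t=\tilde t(t),\quad \tilde x^i=\tilde x^i(x^j),\quad \tilde y_1^i=\frac{\partial\tilde x^i}{\partial x^j}\frac{dt}{d\tilde t}\,y_1^j .$$ Latin indices run over $1,\dots,n$ and repeated Latin indices are summed; the index $1$ refers to the single time direction. A nonlinear connection $\Gamma=\left(M_{(1)1}^{(i)},N_{(1)j}^{(i)}\right)$ on $E$ is a family of local functions on the charts of $E$ transforming by $$\tilde M_{(1)1}^{(k)}=M_{(1)1}^{(j)}\left(\frac{dt}{d\tilde t}\right)^2\frac{\partial\tilde x^k}{\partial x^j}-\frac{dt}{d\tilde t}\frac{\partial\tilde y_1^k}{\partial t},\qquad \tilde N_{(1)l}^{(k)}=N_{(1)i}^{(j)}\frac{dt}{d\tilde t}\frac{\partial x^i}{\partial\tilde x^l}\frac{\partial\tilde x^k}{\partial x^j}-\frac{\partial x^i}{\partial\tilde x^l}\frac{\partial\tilde y_1^k}{\partial x^i}.$$ The adapted basis of vector fields is $$\frac{\delta}{\delta t}=\frac{\partial}{\partial t}-M_{(1)1}^{(j)}\frac{\partial}{\partial y_1^j},\quad \frac{\delta}{\delta x^i}=\frac{\partial}{\partial x^i}-N_{(1)i}^{(j)}\frac{\partial}{\partial y_1^j},\quad \frac{\partial}{\partial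 y_1^i}.$$ $h_{\mathbb{R}}$, $h_M$, $v$ denote the projections of $\mathcal{X}(E)$ onto the summands locally spanned respectively by $\frac{\delta}{\delta t}$, by the $\frac{\delta}{\delta x^i}$, by the $\frac{\partial}{\partial y_1^i}$. A $\Gamma$-linear connection on $E$ is a linear connection $\nabla$ on $E$ with $\nabla h_{\mathbb{R}}=0$, $\nabla h_M=0$, $\nabla v=0$, i.e. $\nabla_X(hY)=h(\nabla_XY)$ for $h\in\{h_{\mathbb{R}},h_M,v\}$. Its adapted coefficients in a chart are defined by $$\nabla_{\frac{\delta}{\delta t}}\frac{\delta}{\delta t}=\bar G_{11}^1\frac{\delta}{\delta t},\quad \nabla_{\frac{\delta}{\delta t}}\frac{\delta}{\delta x^i}=G_{i1}^k\frac{\delta}{\delta x^k},\quad \nabla_{\frac{\delta}{\delta t}}\frac{\partial}{\partial y_1^i}=G_{(1)(i)1}^{(k)(1)}\frac{\partial}{\partial y_1^k},$$ $$\nabla_{\frac{\delta}{\delta x^j}}\frac{\delta}{\delta t}=\bar L_{1j}^1\frac{\delta}{\delta t},\quad \nabla_{\frac{\delta}{\delta x^j}}\frac{\delta}{\delta x^i}=L_{ij}^k\frac{\delta}{\delta x^k},\quad \nabla_{\frac{\delta}{\delta x^j}}\frac{\partial}{\partial y_1^i}=L_{(1)(i)j}^{(k)(1)}\frac{\partial}{\partial y_1^k},$$ $$\nabla_{\frac{\partial}{\partial y_1^j}}\frac{\delta}{\delta t}=\bar C_{1(j)}^{1(1)}\frac{\delta}{\delta t},\quad \nabla_{\frac{\partial}{\partial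 y_1^j}}\frac{\delta}{\delta x^i}=C_{i(j)}^{k(1)}\frac{\delta}{\delta x^k},\quad \nabla_{\frac{\partial}{\partial y_1^j}}\frac{\partial}{\partial y_1^i}=C_{(1)(i)(j)}^{(k)(1)(1)}\frac{\partial}{\partial y_1^k}.$$ Torsion d-tensors: $$\bar T_{1j}^1=\bar L_{1j}^1,\quad T_{1j}^r=-G_{j1}^r,\quad T_{ij}^r=L_{ij}^r-L_{ji}^r,\quad S_{(1)(i)(j)}^{(r)(1)(1)}=C_{(1)(i)(j)}^{(r)(1)(1)}-C_{(1)(j)(i)}^{(r)(1)(1)},$$ $$P_{(1)1(j)}^{(r)\;(1)}=\frac{\partial M_{(1)1}^{(r)}}{\partial y_1^j}-G_{(1)(j)1}^{(r)(1)},\quad P_{(1)i(j)}^{(r)\;(1)}=\frac{\partial N_{(1)i}^{(r)}}{\partial y_1^j}-L_{(1)(j)i}^{(r)(1)},$$ $$R_{(1)1j}^{(r)}=\frac{\delta M_{(1)1}^{(r)}}{\delta x^j}-\frac{\delta N_{(1)j}^{(r)}}{\delta t},\quad R_{(1)ij}^{(r)}=\frac{\delta N_{(1)i}^{(r)}}{\delta x^j}-\frac{\delta N_{(1)j}^{(r)}}{\delta x^i}.$$ Curvature d-tensors. With $\mathbf{R}(X,Y)Z=\nabla_X\nabla_YZ-\nabla_Y\nabla_XZ-\nabla_{[X,Y]}Z$, they are defined by $$\mathbf{R}\left(\tfrac{\delta}{\delta x^k},\tfrac{\delta}{\delta t}\right)\tfrac{\delta}{\delta t}=\bar R_{11k}^1\tfrac{\delta}{\delta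 t},\quad \mathbf{R}\left(\tfrac{\delta}{\delta x^k},\tfrac{\delta}{\delta t}\right)\tfrac{\delta}{\delta x^i}=R_{i1k}^l\tfrac{\delta}{\delta x^l},\quad \mathbf{R}\left(\tfrac{\delta}{\delta x^k},\tfrac{\delta}{\delta t}\right)\tfrac{\partial}{\partial y_1^i}=R_{(1)(i)1k}^{(l)(1)}\tfrac{\partial}{\partial y_1^l},$$ $$\mathbf{R}\left(\tfrac{\delta}{\delta x^k},\tfrac{\delta}{\delta x^j}\right)\tfrac{\delta}{\delta t}=\bar R_{1jk}^1\tfrac{\delta}{\delta t},\quad \mathbf{R}\left(\tfrac{\delta}{\delta x^k},\tfrac{\delta}{\delta x^j}\right)\tfrac{\delta}{\delta x^i}=R_{ijk}^l\tfrac{\delta}{\delta x^l},\quad \mathbf{R}\left(\tfrac{\delta}{\delta x^k},\tfrac{\delta}{\delta x^j}\right)\tfrac{\partial}{\partial y_1^i}=R_{(1)(i)jk}^{(l)(1)}\tfrac{\partial}{\partial y_1^l},$$ $$\mathbf{R}\left(\tfrac{\partial}{\partial y_1^k},\tfrac{\delta}{\delta t}\right)\tfrac{\delta}{\delta t}=\bar P_{11(k)}^{1\;\;(1)}\tfrac{\delta}{\delta t},\quad \mathbf{R}\left(\tfrac{\partial}{\partial y_1^k},\tfrac{\delta}{\delta t}\right)\tfrac{\delta}{\delta x^i}=P_{i1(k)}^{l\;\;(1)}\tfrac{\delta}{\delta x^l},\quad \mathbf{R}\left(\tfrac{\partial}{\partial y_1^k},\tfrac{\delta}{\delta t}\right)\tfrac{\partial}{\partial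 y_1^i}=P_{(1)(i)1(k)}^{(l)(1)\;(1)}\tfrac{\partial}{\partial y_1^l},$$ $$\mathbf{R}\left(\tfrac{\partial}{\partial y_1^k},\tfrac{\delta}{\delta x^j}\right)\tfrac{\delta}{\delta t}=\bar P_{1j(k)}^{1\;\;(1)}\tfrac{\delta}{\delta t},\quad \mathbf{R}\left(\tfrac{\partial}{\partial y_1^k},\tfrac{\delta}{\delta x^j}\right)\tfrac{\delta}{\delta x^i}=P_{ij(k)}^{l\;\;(1)}\tfrac{\delta}{\delta x^l},\quad \mathbf{R}\left(\tfrac{\partial}{\partial y_1^k},\tfrac{\delta}{\delta x^j}\right)\tfrac{\partial}{\partial y_1^i}=P_{(1)(i)j(k)}^{(l)(1)\;(1)}\tfrac{\partial}{\partial y_1^l},$$ $$\mathbf{R}\left(\tfrac{\partial}{\partial y_1^k},\tfrac{\partial}{\partial y_1^j}\right)\tfrac{\delta}{\delta t}=\bar S_{1(j)(k)}^{1(1)(1)}\tfrac{\delta}{\delta t},\quad \mathbf{R}\left(\tfrac{\partial}{\partial y_1^k},\tfrac{\partial}{\partial y_1^j}\right)\tfrac{\delta}{\delta x^i}=S_{i(j)(k)}^{l(1)(1)}\tfrac{\delta}{\delta x^l},\quad \mathbf{R}\left(\tfrac{\partial}{\partial y_1^k},\tfrac{\partial}{\partial y_1^j}\right)\tfrac{\partial}{\partial y_1^i}=S_{(1)(i)(j)(k)}^{(l)(1)(1)(1)}\tfrac{\partial}{\partial y_1^l}.$$ Covariant derivatives. For a d-tensor with components $D_{1k(1)(l)\ldots}^{1i(j)(1)\ldots}$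 (an upper $(j)$ paired with a lower $(1)$ is a vertical contravariant index, a lower $(l)$ paired with an upper $(1)$ is a vertical covariant index), $$D_{1k(1)(l)\ldots/1}^{1i(j)(1)\ldots}=\frac{\delta D_{1k(1)(l)\ldots}^{1i(j)(1)\ldots}}{\delta t}+D_{1k(1)(l)\ldots}^{1i(j)(1)\ldots}\bar G_{11}^1+D_{1k(1)(l)\ldots}^{1r(j)(1)\ldots}G_{r1}^i+D_{1k(1)(l)\ldots}^{1i(r)(1)\ldots}G_{(1)(r)1}^{(j)(1)}+\ldots$$ $$\qquad-D_{1k(1)(l)\ldots}^{1i(j)(1)\ldots}\bar G_{11}^1-D_{1r(1)(l)\ldots}^{1i(j)(1)\ldots}G_{k1}^r-D_{1k(1)(r)\ldots}^{1i(j)(1)\ldots}G_{(1)(l)1}^{(r)(1)}-\ldots,$$ with one plus-term for each contravariant index and one minus-term for each covariant index. $D_{\ldots|p}^{\ldots}$ is given by the same formula with $\frac{\delta}{\delta t},\bar G_{11}^1,G_{r1}^i,G_{(1)(r)1}^{(j)(1)}$ replaced by $\frac{\delta}{\delta x^p},\bar L_{1p}^1,L_{rp}^i,L_{(1)(r)p}^{(j)(1)}$, and $D_{\ldots}^{\ldots}|_{(p)}^{(1)}$ by the same formula with them replaced by $\frac{\partial}{\partial y_1^p},\bar C_{1(p)}^{1(1)},C_{r(p)}^{i(1)},C_{(1)(r)(p)}^{(j)(1)(1)}$ (and correspondingly for the other index letters). The derivatives $/1$, $|p$, $|_{(p)}^{(1)}$ add, respectively, a covariant time index $1$, a covariant spatial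 index $p$, a vertical covariant index pair $(p),(1)$; iterated derivatives are read left to right, the second derivative being applied to the d-tensor produced by the first. *)

theory Defs
  imports "HOL-Analysis.Analysis"
begin

section \<open>Smooth maps and smooth manifolds\<close>

text \<open>Only meant for open \<open>S\<close>; \<open>C_on k S f\<close> says that \<open>f\<close> is of class \<open>C\<^sup>k\<close> on \<open>S\<close>.\<close>

primrec C_on :: "nat \<Rightarrow> 'a::real_normed_vector set \<Rightarrow> ('a \<Rightarrow> 'b::real_normed_vector) \<Rightarrow> bool" where
  "C_on 0 S f \<longleftrightarrow> continuous_on S f"
| "C_on (Suc k) S f \<longleftrightarrow>
     (\<forall>x\<in>S. f differentiable (at x)) \<and> (\<forall>v. C_on k S (\<lambda>x. frechet_derivative f (at x) v))"

definition smooth_on :: "'a::real_normed_vector set \<Rightarrow> ('a \<Rightarrow> 'b::real_normed_vector) \<Rightarrow> bool" where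
  "smooth_on S f \<longleftrightarrow> (\<forall>k. C_on k S f)"

text \<open>A chart is a pair of its domain and its coordinate map; the values of the coordinate map
  off the domain are irrelevant.\<close>

type_synonym ('a, 'b) chart = "'a set \<times> ('a \<Rightarrow> 'b)"

definition is_chart :: "('a::topological_space, 'b::euclidean_space) chart \<Rightarrow> bool" where
  "is_chart c \<longleftrightarrow> open (fst c) \<and> open (snd c ` fst c) \<and>
     homeomorphism (fst c) (snd c ` fst c) (snd c) (inv_into (fst c) (snd c))"

definition smooth_transition ::
    "('a, 'b::euclidean_space) chart \<Rightarrow> ('a, 'b) chart \<Rightarrow> bool" where
  "smooth_transition c d \<longleftrightarrow>
     smooth_on (snd c ` (fst c \<inter> fst d)) (snd d \<circ> inv_into (fst c) (snd c))"

text \<open>The manifold \<open>M\<close> is the union of the domains of the charts of an atlas \<open>A\<close>; the atlas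
  may be, but need not be, maximal.\<close>

definition smooth_atlas :: "('a::topological_space, 'b::euclidean_space) chart set \<Rightarrow> bool" where
  "smooth_atlas A \<longleftrightarrow>
     (\<forall>c\<in>A. is_chart c) \<and> (\<forall>c\<in>A. \<forall>d\<in>A. smooth_transition c d)"

text \<open>All charts of the time manifold \<open>\<real>\<close> with its standard smooth structure.\<close>

definition time_charts :: "(real, real) chart set" where
  "time_charts = {c. is_chart c \<and> smooth_transition c (UNIV, id) \<and> smooth_transition (UNIV, id) c}"


section \<open>The 1-jet space \<open>J\<^sup>1(\<real>, M)\<close>\<close>

definition smooth_curve_at ::
    "('m, 'b::euclidean_space) chart set \<Rightarrow> (real \<Rightarrow> 'm) \<Rightarrow> real \<Rightarrow> bool" where
  "smooth_curve_at A c t \<longleftrightarrow>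
     (\<exists>\<phi>\<in>A. \<exists>I. open I \<and> t \<in> I \<and> c ` I \<subseteq> fst \<phi> \<and> smooth_on I (snd \<phi> \<circ> c))"

text \<open>The 1-jet at \<open>t\<close> of a curve is represented by \<open>t\<close> together with the class of all curves
  that are smooth near \<open>t\<close> and have first order contact at \<open>t\<close> with the given one.\<close>

type_synonym 'm jet = "real \<times> (real \<Rightarrow> 'm) set"

definition jet1 :: "('m, 'b::euclidean_space) chart set \<Rightarrow> real \<Rightarrow> (real \<Rightarrow> 'm) \<Rightarrow> 'm jet" where
  "jet1 A t c = (t, {c'. smooth_curve_at A c' t \<and> c' t = c t \<and>
     (\<forall>\<phi>\<in>A. c t \<in> fst \<phi> \<longrightarrow>
        vector_derivative (snd \<phi> \<circ> c') (at t) = vector_derivative (snd \<phi> \<circ> c) (at t))})"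

definition jet_space :: "('m, 'b::euclidean_space) chart set \<Rightarrow> 'm jet set" where
  "jet_space A = {jet1 A t c | t c. smooth_curve_at A c t}"

definition jet_time :: "'m jet \<Rightarrow> real" where
  "jet_time p = fst p"

definition jet_curve :: "'m jet \<Rightarrow> real \<Rightarrow> 'm" where
  "jet_curve p = (SOME c. c \<in> snd p)"

definition jet_base :: "'m jet \<Rightarrow> 'm" where
  "jet_base p = jet_curve p (jet_time p)"

text \<open>A chart of the jet space is given by a time chart and a chart of \<open>M\<close>. The coordinates
  \<open>(t, x\<^sup>i, y\<^sub>1\<^sup>i)\<close> are elements of \<open>\<real> \<times> \<real>\<^sup>n \<times> \<real>\<^sup>n\<close>, where \<open>y\<^sub>1\<^sup>i\<close> is the derivative of
  \<open>x\<^sup>i\<close> along the curve with respect to the time coordinate of the chart.\<close>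

type_synonym ('m, 'n) jet_chart = "(real, real) chart \<times> ('m, real^'n) chart"
type_synonym 'n coords = "real \<times> (real^'n) \<times> (real^'n)"

definition jet_charts :: "('m, real^'n) chart set \<Rightarrow> ('m, 'n) jet_chart set" where
  "jet_charts A = time_charts \<times> A"

definition jet_dom :: "('m, real^'n) chart set \<Rightarrow> ('m, 'n) jet_chart \<Rightarrow> 'm jet set" where
  "jet_dom A \<kappa> =
     {p \<in> jet_space A. jet_time p \<in> fst (fst \<kappa>) \<and> jet_base p \<in> fst (snd \<kappa>)}"

definition jet_coord :: "('m, 'n::finite) jet_chart \<Rightarrow> 'm jet \<Rightarrow> 'n coords" where
  "jet_coord \<kappa> p =
     (let \<tau> = snd (fst \<kappa>); I = fst (fst \<kappa>); \<phi> = snd (snd \<kappa>) in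
       (\<tau> (jet_time p), \<phi> (jet_base p),
        vector_derivative (\<phi> \<circ> jet_curve p \<circ> inv_into I \<tau>) (at (\<tau> (jet_time p)))))"

definition jet_point :: "('m, real^'n) chart set \<Rightarrow> ('m, 'n) jet_chart \<Rightarrow> 'n coords \<Rightarrow> 'm jet" where
  "jet_point A \<kappa> = inv_into (jet_dom A \<kappa>) (jet_coord \<kappa>)"

definition jet_open :: "('m, real^'n) chart set \<Rightarrow> 'm jet set \<Rightarrow> bool" where
  "jet_open A U \<longleftrightarrow> U \<subseteq> jet_space A \<and>
     (\<forall>\<kappa>\<in>jet_charts A. open (jet_coord \<kappa> ` (U \<inter> jet_dom A \<kappa>)))"

text \<open>Derivative at \<open>p\<close> of a function on the jet space in the direction with components \<open>v\<close>
  in the chart \<open>\<kappa>\<close>.\<close>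

definition dir_deriv :: "('m, real^'n) chart set \<Rightarrow> ('m, 'n) jet_chart \<Rightarrow>
    ('m jet \<Rightarrow> 'b::real_normed_vector) \<Rightarrow> 'm jet \<Rightarrow> 'n coords \<Rightarrow> 'b" where
  "dir_deriv A \<kappa> f p v = frechet_derivative (f \<circ> jet_point A \<kappa>) (at (jet_coord \<kappa> p)) v"

text \<open>Jacobian at \<open>p\<close> of the change of coordinates from \<open>\<kappa>\<close> to \<open>\<kappa>'\<close>.\<close>

definition jac :: "('m, real^'n) chart set \<Rightarrow> ('m, 'n) jet_chart \<Rightarrow> ('m, 'n) jet_chart \<Rightarrow>
    'm jet \<Rightarrow> 'n coords \<Rightarrow> 'n coords" where
  "jac A \<kappa> \<kappa>' p v = dir_deriv A \<kappa> (jet_coord \<kappa>') p v"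

definition smooth_in_chart :: "('m, real^'n) chart set \<Rightarrow> ('m, 'n) jet_chart \<Rightarrow> 'm jet set \<Rightarrow>
    ('m jet \<Rightarrow> 'b::real_normed_vector) \<Rightarrow> bool" where
  "smooth_in_chart A \<kappa> U f \<longleftrightarrow>
     smooth_on (jet_coord \<kappa> ` (U \<inter> jet_dom A \<kappa>)) (f \<circ> jet_point A \<kappa>)"

definition smooth_function ::
    "('m, real^'n) chart set \<Rightarrow> 'm jet set \<Rightarrow> ('m jet \<Rightarrow> real) \<Rightarrow> bool" where
  "smooth_function A U f \<longleftrightarrow> (\<forall>\<kappa>\<in>jet_charts A. smooth_in_chart A \<kappa> U f)"


section \<open>Vector fields and linear connections\<close>

text \<open>A vector field on an open set \<open>U\<close> of the jet space is a family of smooth components with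
  respect to the natural bases \<open>\<partial>/\<partial>t, \<partial>/\<partial>x\<^sup>i, \<partial>/\<partial>y\<^sub>1\<^sup>i\<close> of all charts, which transforms by the
  Jacobian matrices. The values of the family off \<open>U\<close> or off the domain of the chart in question
  are irrelevant, so vector fields are compared by \<open>vf_eq\<close>.\<close>

type_synonym ('m, 'n) vfield = "('m, 'n) jet_chart \<Rightarrow> 'm jet \<Rightarrow> 'n coords"

definition vector_field ::
    "('m, real^'n) chart set \<Rightarrow> 'm jet set \<Rightarrow> ('m, 'n) vfield \<Rightarrow> bool" where
  "vector_field A U X \<longleftrightarrow>
     (\<forall>\<kappa>\<in>jet_charts A. smooth_in_chart A \<kappa> U (X \<kappa>)) \<and>
     (\<forall>\<kappa>\<in>jet_charts A. \<forall>\<kappa>'\<in>jet_charts A. \<forall>p\<in>U \<inter> jet_dom A \<kappa> \<inter> jet_dom A \<kappa>'.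
        X \<kappa>' p = jac A \<kappa> \<kappa>' p (X \<kappa> p))"

definition vf_eq :: "('m, real^'n) chart set \<Rightarrow> 'm jet set \<Rightarrow>
    ('m, 'n) vfield \<Rightarrow> ('m, 'n) vfield \<Rightarrow> bool" where
  "vf_eq A U X Y \<longleftrightarrow> (\<forall>\<kappa>\<in>jet_charts A. \<forall>p\<in>U \<inter> jet_dom A \<kappa>. X \<kappa> p = Y \<kappa> p)"

definition vf_add :: "('m, 'n::finite) vfield \<Rightarrow> ('m, 'n) vfield \<Rightarrow> ('m, 'n) vfield" where
  "vf_add X Y = (\<lambda>\<kappa> p. X \<kappa> p + Y \<kappa> p)"

definition vf_diff :: "('m, 'n::finite) vfield \<Rightarrow> ('m, 'n) vfield \<Rightarrow> ('m, 'n) vfield" where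
  "vf_diff X Y = (\<lambda>\<kappa> p. X \<kappa> p - Y \<kappa> p)"

definition vf_scale :: "('m jet \<Rightarrow> real) \<Rightarrow> ('m, 'n::finite) vfield \<Rightarrow> ('m, 'n) vfield" where
  "vf_scale f X = (\<lambda>\<kappa> p. f p *\<^sub>R X \<kappa> p)"

definition lie_bracket :: "('m, real^'n) chart set \<Rightarrow>
    ('m, 'n) vfield \<Rightarrow> ('m, 'n) vfield \<Rightarrow> ('m, 'n) vfield" where
  "lie_bracket A X Y =
     (\<lambda>\<kappa> p. dir_deriv A \<kappa> (Y \<kappa>) p (X \<kappa> p) - dir_deriv A \<kappa> (X \<kappa>) p (Y \<kappa> p))"

text \<open>Since a connection has to be applied to the local frames of charts, it is given as a family
  of operators \<open>nab U\<close> on the vector fields on open sets \<open>U\<close>, compatible with restriction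
  (the last clause, which for \<open>V = U\<close> also says that \<open>nab U\<close> respects \<open>vf_eq A U\<close>).
  The fourth clause is the Leibniz rule \<open>\<nabla>\<^sub>X(fY) = X(f) Y + f \<nabla>\<^sub>XY\<close>; with constant \<open>f\<close> it
  yields homogeneity in \<open>Y\<close>.\<close>

definition linear_connection :: "('m, real^'n) chart set \<Rightarrow>
    ('m jet set \<Rightarrow> ('m, 'n) vfield \<Rightarrow> ('m, 'n) vfield \<Rightarrow> ('m, 'n) vfield) \<Rightarrow> bool" where
  "linear_connection A nab \<longleftrightarrow>
    (\<forall>U. jet_open A U \<longrightarrow>
      (\<forall>X Y. vector_field A U X \<and> vector_field A U Y \<longrightarrow>
        vector_field A U (nab U X Y)) \<and>
      (\<forall>X X' Y. vector_field A U X \<and> vector_field A U X' \<and> vector_field A U Y \<longrightarrow>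
        vf_eq A U (nab U (vf_add X X') Y) (vf_add (nab U X Y) (nab U X' Y)) \<and>
        vf_eq A U (nab U Y (vf_add X X')) (vf_add (nab U Y X) (nab U Y X'))) \<and>
      (\<forall>f X Y. smooth_function A U f \<and> vector_field A U X \<and> vector_field A U Y \<longrightarrow>
        vf_eq A U (nab U (vf_scale f X) Y) (vf_scale f (nab U X Y))) \<and>
      (\<forall>f X Y. smooth_function A U f \<and> vector_field A U X \<and> vector_field A U Y \<longrightarrow>
        vf_eq A U (nab U X (vf_scale f Y))
          (\<lambda>\<kappa> p. dir_deriv A \<kappa> f p (X \<kappa> p) *\<^sub>R Y \<kappa> p + f p *\<^sub>R nab U X Y \<kappa> p)) \<and>
      (\<forall>V X Y X' Y'. jet_open A V \<and> V \<subseteq> U \<and> vector_field A U X \<and> vector_field A U Y \<and>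
        vector_field A V X' \<and> vector_field A V Y' \<and> vf_eq A V X X' \<and> vf_eq A V Y Y' \<longrightarrow>
        vf_eq A V (nab U X Y) (nab V X' Y')))"

definition curvature :: "('m, real^'n) chart set \<Rightarrow>
    ('m jet set \<Rightarrow> ('m, 'n) vfield \<Rightarrow> ('m, 'n) vfield \<Rightarrow> ('m, 'n) vfield) \<Rightarrow> 'm jet set \<Rightarrow>
    ('m, 'n) vfield \<Rightarrow> ('m, 'n) vfield \<Rightarrow> ('m, 'n) vfield \<Rightarrow> ('m, 'n) vfield" where
  "curvature A nab U X Y Z =
     vf_diff (vf_diff (nab U X (nab U Y Z)) (nab U Y (nab U X Z))) (nab U (lie_bracket A X Y) Z)"


section \<open>Nonlinear connections and adapted bases\<close>

text \<open>In the chart \<open>\<kappa>\<close> at \<open>p\<close>, \<open>M \<kappa> p $ j\<close> is \<open>M\<^bsub>(1)1\<^esub>\<^bsup>(j)\<^esup>\<close> and \<open>N \<kappa> p $ j $ i\<close> is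
  \<open>N\<^bsub>(1)i\<^esub>\<^bsup>(j)\<^esup>\<close> (the upper index comes first). In the transformation laws the chart \<open>\<kappa>'\<close> carries
  the coordinates written with a tilde.\<close>

definition nonlinear_connection :: "('m, real^'n) chart set \<Rightarrow>
    (('m, 'n) jet_chart \<Rightarrow> 'm jet \<Rightarrow> real^'n) \<Rightarrow>
    (('m, 'n) jet_chart \<Rightarrow> 'm jet \<Rightarrow> real^'n^'n) \<Rightarrow> bool" where
  "nonlinear_connection A M N \<longleftrightarrow>
    (\<forall>\<kappa>\<in>jet_charts A. smooth_in_chart A \<kappa> (jet_dom A \<kappa>) (M \<kappa>) \<and>
                       smooth_in_chart A \<kappa> (jet_dom A \<kappa>) (N \<kappa>)) \<and>
    (\<forall>\<kappa>\<in>jet_charts A. \<forall>\<kappa>'\<in>jet_charts A. \<forall>p\<in>jet_dom A \<kappa> \<inter> jet_dom A \<kappa>'.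
      let dt_dt' = fst (jac A \<kappa>' \<kappa> p (1, 0, 0));
          dx'_dx = (\<lambda>k j. fst (snd (jac A \<kappa> \<kappa>' p (0, axis j 1, 0))) $ k);
          dx_dx' = (\<lambda>i l. fst (snd (jac A \<kappa>' \<kappa> p (0, axis l 1, 0))) $ i);
          dy'_dt = (\<lambda>k. snd (snd (jac A \<kappa> \<kappa>' p (1, 0, 0))) $ k);
          dy'_dx = (\<lambda>k i. snd (snd (jac A \<kappa> \<kappa>' p (0, axis i 1, 0))) $ k)
      in (\<forall>k. M \<kappa>' p $ k =
                (\<Sum>j\<in>UNIV. M \<kappa> p $ j * dt_dt'\<^sup>2 * dx'_dx k j) - dt_dt' * dy'_dt k) \<and>
         (\<forall>k l. N \<kappa>' p $ k $ l =
                (\<Sum>i\<in>UNIV. \<Sum>j\<in>UNIV. N \<kappa> p $ j $ i * dt_dt' * dx_dx' i l * dx'_dx k j)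
                - (\<Sum>i\<in>UNIV. dx_dx' i l * dy'_dx k i)))"

text \<open>Indices of adapted components: the time index \<open>1\<close>, the spatial indices \<open>i\<close>, and the vertical
  index pairs formed by \<open>(i)\<close> and \<open>(1)\<close>.\<close>

datatype 'n index = Tm | Sp 'n | Vt 'n

text \<open>Natural components of the adapted basis vectors \<open>\<delta>/\<delta>t\<close>, \<open>\<delta>/\<delta>x\<^sup>i\<close>, \<open>\<partial>/\<partial>y\<^sub>1\<^sup>i\<close> of \<open>\<kappa>\<close>.\<close>

fun basis_vec :: "(('m, 'n::finite) jet_chart \<Rightarrow> 'm jet \<Rightarrow> real^'n) \<Rightarrow>
    (('m, 'n) jet_chart \<Rightarrow> 'm jet \<Rightarrow> real^'n^'n) \<Rightarrow>
    ('m, 'n) jet_chart \<Rightarrow> 'n index \<Rightarrow> 'm jet \<Rightarrow> 'n coords" where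
  "basis_vec M N \<kappa> Tm p = (1, 0, - M \<kappa> p)"
| "basis_vec M N \<kappa> (Sp i) p = (0, axis i 1, - (\<chi> j. N \<kappa> p $ j $ i))"
| "basis_vec M N \<kappa> (Vt i) p = (0, 0, axis i 1)"

text \<open>Components of the vector with natural components \<open>v\<close> in the adapted basis of \<open>\<kappa>\<close> at \<open>p\<close>,
  see \<open>adapted_decomposition\<close>.\<close>

fun adapted_comp :: "(('m, 'n::finite) jet_chart \<Rightarrow> 'm jet \<Rightarrow> real^'n) \<Rightarrow>
    (('m, 'n) jet_chart \<Rightarrow> 'm jet \<Rightarrow> real^'n^'n) \<Rightarrow>
    ('m, 'n) jet_chart \<Rightarrow> 'n index \<Rightarrow> 'm jet \<Rightarrow> 'n coords \<Rightarrow> real" where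
  "adapted_comp M N \<kappa> Tm p v = fst v"
| "adapted_comp M N \<kappa> (Sp i) p v = fst (snd v) $ i"
| "adapted_comp M N \<kappa> (Vt i) p v = snd (snd v) $ i + fst v * M \<kappa> p $ i
     + (\<Sum>j\<in>UNIV. fst (snd v) $ j * N \<kappa> p $ i $ j)"

lemma adapted_decomposition:
  "v = adapted_comp M N \<kappa> Tm p v *\<^sub>R basis_vec M N \<kappa> Tm p
     + (\<Sum>i\<in>UNIV. adapted_comp M N \<kappa> (Sp i) p v *\<^sub>R basis_vec M N \<kappa> (Sp i) p)
     + (\<Sum>i\<in>UNIV. adapted_comp M N \<kappa> (Vt i) p v *\<^sub>R basis_vec M N \<kappa> (Vt i) p)"
  by (cases v)
    (auto simp: prod_eq_iff vec_eq_iff fst_sum snd_sum axis_def sum_negf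
      if_distrib[where f = "\<lambda>x. _ * x"] cong: if_cong)

definition proj_hR :: "(('m, 'n::finite) jet_chart \<Rightarrow> 'm jet \<Rightarrow> real^'n) \<Rightarrow>
    (('m, 'n) jet_chart \<Rightarrow> 'm jet \<Rightarrow> real^'n^'n) \<Rightarrow> ('m, 'n) vfield \<Rightarrow> ('m, 'n) vfield" where
  "proj_hR M N X = (\<lambda>\<kappa> p. adapted_comp M N \<kappa> Tm p (X \<kappa> p) *\<^sub>R basis_vec M N \<kappa> Tm p)"

definition proj_hM :: "(('m, 'n::finite) jet_chart \<Rightarrow> 'm jet \<Rightarrow> real^'n) \<Rightarrow>
    (('m, 'n) jet_chart \<Rightarrow> 'm jet \<Rightarrow> real^'n^'n) \<Rightarrow> ('m, 'n) vfield \<Rightarrow> ('m, 'n) vfield" where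
  "proj_hM M N X =
     (\<lambda>\<kappa> p. \<Sum>i\<in>UNIV. adapted_comp M N \<kappa> (Sp i) p (X \<kappa> p) *\<^sub>R basis_vec M N \<kappa> (Sp i) p)"

definition proj_v :: "(('m, 'n::finite) jet_chart \<Rightarrow> 'm jet \<Rightarrow> real^'n) \<Rightarrow>
    (('m, 'n) jet_chart \<Rightarrow> 'm jet \<Rightarrow> real^'n^'n) \<Rightarrow> ('m, 'n) vfield \<Rightarrow> ('m, 'n) vfield" where
  "proj_v M N X =
     (\<lambda>\<kappa> p. \<Sum>i\<in>UNIV. adapted_comp M N \<kappa> (Vt i) p (X \<kappa> p) *\<^sub>R basis_vec M N \<kappa> (Vt i) p)"

definition gamma_linear_connection :: "('m, real^'n) chart set \<Rightarrow>
    (('m, 'n) jet_chart \<Rightarrow> 'm jet \<Rightarrow> real^'n) \<Rightarrow>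
    (('m, 'n) jet_chart \<Rightarrow> 'm jet \<Rightarrow> real^'n^'n) \<Rightarrow>
    ('m jet set \<Rightarrow> ('m, 'n) vfield \<Rightarrow> ('m, 'n) vfield \<Rightarrow> ('m, 'n) vfield) \<Rightarrow> bool" where
  "gamma_linear_connection A M N nab \<longleftrightarrow> linear_connection A nab \<and>
     (\<forall>U X Y. jet_open A U \<and> vector_field A U X \<and> vector_field A U Y \<longrightarrow>
       (\<forall>h \<in> {proj_hR M N, proj_hM M N, proj_v M N}.
          vf_eq A U (nab U X (h Y)) (h (nab U X Y))))"


section \<open>Adapted coefficients, torsion, curvature and covariant derivatives\<close>

text \<open>The adapted basis of \<open>\<kappa>\<close> as vector fields on the domain of \<open>\<kappa>\<close>, that is, with their
  components in all other charts.\<close>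

definition adapted_frame :: "('m, real^'n) chart set \<Rightarrow>
    (('m, 'n) jet_chart \<Rightarrow> 'm jet \<Rightarrow> real^'n) \<Rightarrow>
    (('m, 'n) jet_chart \<Rightarrow> 'm jet \<Rightarrow> real^'n^'n) \<Rightarrow>
    ('m, 'n) jet_chart \<Rightarrow> 'n index \<Rightarrow> ('m, 'n) vfield" where
  "adapted_frame A M N \<kappa> a = (\<lambda>\<kappa>' p. jac A \<kappa> \<kappa>' p (basis_vec M N \<kappa> a p))"

text \<open>\<open>adapted_deriv A M N \<kappa> a f\<close> is \<open>\<delta>f/\<delta>t\<close>, \<open>\<delta>f/\<delta>x\<^sup>i\<close> or \<open>\<partial>f/\<partial>y\<^sub>1\<^sup>i\<close>.\<close>

definition adapted_deriv :: "('m, real^'n) chart set \<Rightarrow>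
    (('m, 'n) jet_chart \<Rightarrow> 'm jet \<Rightarrow> real^'n) \<Rightarrow>
    (('m, 'n) jet_chart \<Rightarrow> 'm jet \<Rightarrow> real^'n^'n) \<Rightarrow>
    ('m, 'n) jet_chart \<Rightarrow> 'n index \<Rightarrow> ('m jet \<Rightarrow> real) \<Rightarrow> 'm jet \<Rightarrow> real" where
  "adapted_deriv A M N \<kappa> a f p = dir_deriv A \<kappa> f p (basis_vec M N \<kappa> a p)"

text \<open>Writing \<open>e\<^sub>a\<close> for the adapted basis, \<open>conn_coef A M N nab \<kappa> a b d\<close> is the coefficient of
  \<open>e\<^sub>a\<close> in \<open>\<nabla>\<^bsub>e\<^sub>d\<^esub> e\<^sub>b\<close>. For a \<open>\<Gamma>\<close>-linear connection it vanishes unless \<open>a\<close> and \<open>b\<close> are of the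
  same kind. The remaining ones are the nine adapted coefficients:
    \<^item> \<open>Tm Tm d\<close>: the coefficients \<open>G\<^sub>1\<^sub>1\<^sup>1\<close>, \<open>L\<^sub>1\<^sub>j\<^sup>1\<close>, \<open>C\<^bsub>1(j)\<^esub>\<^bsup>1(1)\<^esup>\<close> (with a bar);
    \<^item> \<open>(Sp k) (Sp i) d\<close>: the coefficients \<open>G\<^sub>i\<^sub>1\<^sup>k\<close>, \<open>L\<^sub>i\<^sub>j\<^sup>k\<close>, \<open>C\<^bsub>i(j)\<^esub>\<^bsup>k(1)\<^esup>\<close>;
    \<^item> \<open>(Vt k) (Vt i) d\<close>: the coefficients \<open>G\<^bsub>(1)(i)1\<^esub>\<^bsup>(k)(1)\<^esup>\<close>, \<open>L\<^bsub>(1)(i)j\<^esub>\<^bsup>(k)(1)\<^esup>\<close>,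
      \<open>C\<^bsub>(1)(i)(j)\<^esub>\<^bsup>(k)(1)(1)\<^esup>\<close>;
  each time for \<open>d\<close> equal to \<open>Tm\<close>, \<open>Sp j\<close>, \<open>Vt j\<close>, respectively.\<close>

definition conn_coef :: "('m, real^'n) chart set \<Rightarrow>
    (('m, 'n) jet_chart \<Rightarrow> 'm jet \<Rightarrow> real^'n) \<Rightarrow>
    (('m, 'n) jet_chart \<Rightarrow> 'm jet \<Rightarrow> real^'n^'n) \<Rightarrow>
    ('m jet set \<Rightarrow> ('m, 'n) vfield \<Rightarrow> ('m, 'n) vfield \<Rightarrow> ('m, 'n) vfield) \<Rightarrow>
    ('m, 'n) jet_chart \<Rightarrow> 'n index \<Rightarrow> 'n index \<Rightarrow> 'n index \<Rightarrow> 'm jet \<Rightarrow> real" where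
  "conn_coef A M N nab \<kappa> a b d p =
     adapted_comp M N \<kappa> a p
       (nab (jet_dom A \<kappa>) (adapted_frame A M N \<kappa> d) (adapted_frame A M N \<kappa> b) \<kappa> p)"

text \<open>\<open>curv_coef A M N nab \<kappa> a b c d\<close> is the coefficient of \<open>e\<^sub>a\<close> in \<open>\<^bold>R(e\<^sub>d, e\<^sub>c) e\<^sub>b\<close>, that is, the
  component of the curvature d-tensor with upper index \<open>a\<close> and lower indices \<open>b\<close>, \<open>c\<close>, \<open>d\<close> in this
  order: of \<open>R\<close> for \<open>(c, d)\<close> equal to \<open>(Tm, Sp k)\<close> or \<open>(Sp j, Sp k)\<close>, of \<open>P\<close> for
  \<open>(Tm, Vt k)\<close> or \<open>(Sp j, Vt k)\<close>, of \<open>S\<close> for \<open>(Vt j, Vt k)\<close> (with a bar if \<open>a = b = Tm\<close>).\<close>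

definition curv_coef :: "('m, real^'n) chart set \<Rightarrow>
    (('m, 'n) jet_chart \<Rightarrow> 'm jet \<Rightarrow> real^'n) \<Rightarrow>
    (('m, 'n) jet_chart \<Rightarrow> 'm jet \<Rightarrow> real^'n^'n) \<Rightarrow>
    ('m jet set \<Rightarrow> ('m, 'n) vfield \<Rightarrow> ('m, 'n) vfield \<Rightarrow> ('m, 'n) vfield) \<Rightarrow>
    ('m, 'n) jet_chart \<Rightarrow> 'n index \<Rightarrow> 'n index \<Rightarrow> 'n index \<Rightarrow> 'n index \<Rightarrow> 'm jet \<Rightarrow> real" where
  "curv_coef A M N nab \<kappa> a b c d p =
     adapted_comp M N \<kappa> a p
       (curvature A nab (jet_dom A \<kappa>) (adapted_frame A M N \<kappa> d) (adapted_frame A M N \<kappa> c)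
          (adapted_frame A M N \<kappa> b) \<kappa> p)"

text \<open>The torsion d-tensors. In each case the upper index, if it is not \<open>1\<close>, is the first index
  argument: \<open>tors_Tbar_1 j\<close> is \<open>T\<^sub>1\<^sub>j\<^sup>1\<close> (with a bar), \<open>tors_T_1 r j\<close> is \<open>T\<^sub>1\<^sub>j\<^sup>r\<close>, \<open>tors_T r i j\<close> is
  \<open>T\<^sub>i\<^sub>j\<^sup>r\<close>, \<open>tors_S r i j\<close> is \<open>S\<^bsub>(1)(i)(j)\<^esub>\<^bsup>(r)(1)(1)\<^esup>\<close>, \<open>tors_P_1 r j\<close> is \<open>P\<^bsub>(1)1(j)\<^esub>\<^bsup>(r) (1)\<^esup>\<close>,
  \<open>tors_P r i j\<close> is \<open>P\<^bsub>(1)i(j)\<^esub>\<^bsup>(r) (1)\<^esup>\<close>, \<open>tors_R_1 r j\<close> is \<open>R\<^bsub>(1)1j\<^esub>\<^bsup>(r)\<^esup>\<close> and \<open>tors_R r i j\<close> is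
  \<open>R\<^bsub>(1)ij\<^esub>\<^bsup>(r)\<^esup>\<close>.\<close>

definition tors_Tbar_1 where
  "tors_Tbar_1 A M N nab \<kappa> j p = conn_coef A M N nab \<kappa> Tm Tm (Sp j) p"

definition tors_T_1 where
  "tors_T_1 A M N nab \<kappa> r j p = - conn_coef A M N nab \<kappa> (Sp r) (Sp j) Tm p"

definition tors_T where
  "tors_T A M N nab \<kappa> r i j p =
     conn_coef A M N nab \<kappa> (Sp r) (Sp i) (Sp j) p - conn_coef A M N nab \<kappa> (Sp r) (Sp j) (Sp i) p"

definition tors_S where
  "tors_S A M N nab \<kappa> r i j p =
     conn_coef A M N nab \<kappa> (Vt r) (Vt i) (Vt j) p - conn_coef A M N nab \<kappa> (Vt r) (Vt j) (Vt i) p"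

definition tors_P_1 where
  "tors_P_1 A M N nab \<kappa> r j p =
     adapted_deriv A M N \<kappa> (Vt j) (\<lambda>q. M \<kappa> q $ r) p - conn_coef A M N nab \<kappa> (Vt r) (Vt j) Tm p"

definition tors_P where
  "tors_P A M N nab \<kappa> r i j p =
     adapted_deriv A M N \<kappa> (Vt j) (\<lambda>q. N \<kappa> q $ r $ i) p
     - conn_coef A M N nab \<kappa> (Vt r) (Vt j) (Sp i) p"

definition tors_R_1 where
  "tors_R_1 A M N \<kappa> r j p =
     adapted_deriv A M N \<kappa> (Sp j) (\<lambda>q. M \<kappa> q $ r) p
     - adapted_deriv A M N \<kappa> Tm (\<lambda>q. N \<kappa> q $ r $ j) p"

definition tors_R where
  "tors_R A M N \<kappa> r i j p =
     adapted_deriv A M N \<kappa> (Sp j) (\<lambda>q. N \<kappa> q $ r $ i) p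
     - adapted_deriv A M N \<kappa> (Sp i) (\<lambda>q. N \<kappa> q $ r $ j) p"

text \<open>The components in \<open>\<kappa>\<close> of a d-tensor are given by a function \<open>D us ls p\<close> of the lists \<open>us\<close> of
  contravariant and \<open>ls\<close> of covariant indices. The covariant derivative in the direction of \<open>e\<^sub>d\<close>
  adds \<open>d\<close> as the last covariant index: \<open>cov_deriv A M N nab \<kappa> D us (ls @ [d])\<close> is the component of
  \<open>D\<^sub>/\<^sub>1\<close>, \<open>D\<^bsub>|p\<^esub>\<close> or \<open>D|\<^bsub>(p)\<^esub>\<^bsup>(1)\<^esup>\<close> for \<open>d\<close> equal to \<open>Tm\<close>, \<open>Sp p\<close> or \<open>Vt p\<close>.\<close>

type_synonym ('m, 'n) dtensor = "'n index list \<Rightarrow> 'n index list \<Rightarrow> 'm jet \<Rightarrow> real"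

fun same_kind :: "'n index \<Rightarrow> 'n index set" where
  "same_kind Tm = {Tm}"
| "same_kind (Sp i) = range Sp"
| "same_kind (Vt i) = range Vt"

definition cov_deriv :: "('m, real^'n) chart set \<Rightarrow>
    (('m, 'n) jet_chart \<Rightarrow> 'm jet \<Rightarrow> real^'n) \<Rightarrow>
    (('m, 'n) jet_chart \<Rightarrow> 'm jet \<Rightarrow> real^'n^'n) \<Rightarrow>
    ('m jet set \<Rightarrow> ('m, 'n) vfield \<Rightarrow> ('m, 'n) vfield \<Rightarrow> ('m, 'n) vfield) \<Rightarrow>
    ('m, 'n) jet_chart \<Rightarrow> ('m, 'n) dtensor \<Rightarrow> ('m, 'n) dtensor" where
  "cov_deriv A M N nab \<kappa> D us ls' p =
     (let ls = butlast ls'; d = last ls' in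
        adapted_deriv A M N \<kappa> d (D us ls) p
        + (\<Sum>m<length us. \<Sum>r\<in>same_kind (us ! m).
             D (us[m := r]) ls p * conn_coef A M N nab \<kappa> (us ! m) r d p)
        - (\<Sum>m<length ls. \<Sum>r\<in>same_kind (ls ! m).
             D us (ls[m := r]) p * conn_coef A M N nab \<kappa> r (ls ! m) d p))"

text \<open>The d-tensor (with one contravariant index) of adapted components
  \<open>X\<^sup>1\<close>, \<open>X\<^sup>i\<close>, \<open>X\<^bsub>(1)\<^esub>\<^bsup>(i)\<^esup>\<close> of a vector field.\<close>

definition vf_dtensor :: "(('m, 'n::finite) jet_chart \<Rightarrow> 'm jet \<Rightarrow> real^'n) \<Rightarrow>
    (('m, 'n) jet_chart \<Rightarrow> 'm jet \<Rightarrow> real^'n^'n) \<Rightarrow>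
    ('m, 'n) jet_chart \<Rightarrow> ('m, 'n) vfield \<Rightarrow> ('m, 'n) dtensor" where
  "vf_dtensor M N \<kappa> X us ls p = adapted_comp M N \<kappa> (hd us) p (X \<kappa> p)"

end

theory Submission
  imports Defs
begin

text \<open>
  The fifteen Ricci identities are components of a single one. For a linear connection with torsion
  \<open>T\<close>, the second covariant derivatives of a vector field \<open>X\<close> along vectors \<open>c\<close>, \<open>d\<close>, taken in both
  orders, differ by \<open>\<^bold>R(d, c) X - \<nabla>\<^bsub>T(d, c)\<^esub> X\<close>. Let \<open>e\<^sub>a\<close> be the adapted frame, where \<open>a\<close> runs through the
  time, space and vertical indices, let \<open>C\<close> be the connection coefficients, and let \<open>W r\<close> be the coefficient
  of \<open>e\<^sub>r\<close> in \<open>[e\<^sub>d, e\<^sub>c]\<close>. In this frame the identity becomes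

    \<open>X\<^bsup>a\<^esup>\<^bsub>;c;d\<^esub> - X\<^bsup>a\<^esup>\<^bsub>;d;c\<^esub> = (\<Sum>b. X\<^bsup>b\<^esup> R a b c d) - (\<Sum>r. X\<^bsup>a\<^esup>\<^bsub>;r\<^esub> (C r c d - C r d c - W r))\<close>,

  which is \<open>ricci_identity\<close>. It is an algebraic consequence of two facts: on functions, the frame
  derivatives satisfy \<open>e\<^sub>d e\<^sub>c f - e\<^sub>c e\<^sub>d f = (\<Sum>r. W r e\<^sub>r f)\<close> (\<open>adapted_deriv_commutator\<close>), and the curvature of
  the frame fields can be expressed by \<open>C\<close>, its frame derivatives and \<open>W\<close> (\<open>curv_coef_formula\<close>).

  The adapted frame has two special features that produce the fifteen cases. Its time and space
  components are constant, so brackets are vertical and their components are frame derivatives of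
  \<open>M\<close> and \<open>N\<close> (\<open>bracket_coef_horizontal\<close>, \<open>bracket_coef_vertical\<close>). And \<open>C a b d\<close> vanishes unless \<open>a\<close> and \<open>b\<close>
  are both time, both space or both vertical indices (\<open>C_kind\<close>): the transformation law of the nonlinear
  connection makes the three distributions spanned by the frame independent of the chart
  (\<open>frame_kind\<close>), so that the projections onto them fix the corresponding frame fields, and the
  connection commutes with these projections.

  The connection operates on vector fields, that is, on families of components in all charts, smooth
  in each of them. Before it can be applied to the frame of one chart and to its brackets, these have
  to be recognized as vector fields. This rests on the smoothness of the coordinate changes of the
  jet space (\<open>jet_transition_smooth\<close>), where the coordinates are computed from chosen representatives of
  jets, and on the symmetry of second derivatives, by which brackets transform as vectors
  (\<open>vector_field_lie_bracket\<close>).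
\<close>

section \<open>Rules for the Frechet derivative\<close>

lemma frechet_derivative_apply_linear:
  assumes "f differentiable (at x)"
  shows "frechet_derivative f (at x) (a + b) = frechet_derivative f (at x) a + frechet_derivative f (at x) b"
    and "frechet_derivative f (at x) (c *\<^sub>R a) = c *\<^sub>R frechet_derivative f (at x) a"
    and "frechet_derivative f (at x) (a - b) = frechet_derivative f (at x) a - frechet_derivative f (at x) b"
    and "frechet_derivative f (at x) (- a) = - frechet_derivative f (at x) a"
    and "frechet_derivative f (at x) 0 = 0"
    and "frechet_derivative f (at x) (sum h I) = (\<Sum>i\<in>I. frechet_derivative f (at x) (h i))"
proof -
  interpret linear "frechet_derivative f (at x)"
    using assms by (rule linear_frechet_derivative)
  show "frechet_derivative f (at x) (a + b) = frechet_derivative f (at x) a + frechet_derivative f (at x) b"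
    "frechet_derivative f (at x) (c *\<^sub>R a) = c *\<^sub>R frechet_derivative f (at x) a"
    "frechet_derivative f (at x) (a - b) = frechet_derivative f (at x) a - frechet_derivative f (at x) b"
    "frechet_derivative f (at x) (- a) = - frechet_derivative f (at x) a"
    "frechet_derivative f (at x) 0 = 0"
    "frechet_derivative f (at x) (sum h I) = (\<Sum>i\<in>I. frechet_derivative f (at x) (h i))"
    by (rule add scale diff neg zero sum)+
qed

lemma frechet_derivative_eqI:
  "(f has_derivative f') (at x) \<Longrightarrow> frechet_derivative f (at x) = f'"
  by (metis frechet_derivative_at)

lemma differentiable_frechet:
  "f differentiable (at x) \<Longrightarrow> (f has_derivative frechet_derivative f (at x)) (at x)"
  by (simp add: frechet_derivative_works)

lemma frechet_derivative_cong_open: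
  assumes "open S" "x \<in> S" "\<And>y. y \<in> S \<Longrightarrow> f y = g y"
  shows "frechet_derivative f (at x) = frechet_derivative g (at x)"
proof -
  have "(f has_derivative f') (at x) \<longleftrightarrow> (g has_derivative f') (at x)" for f'
    using assms has_derivative_transform_within_open[of f f' x UNIV S g]
      has_derivative_transform_within_open[of g f' x UNIV S f] by auto
  then show ?thesis by (simp add: frechet_derivative_def)
qed

lemma differentiable_cong_open:
  assumes "open S" "x \<in> S" "\<And>y. y \<in> S \<Longrightarrow> f y = g y" "f differentiable (at x)"
  shows "g differentiable (at x)"
  using assms has_derivative_transform_within_open[of f _ x UNIV S g]
  unfolding differentiable_def by blast

lemma frechet_derivative_chain:
  assumes "f differentiable (at x)" "g differentiable (at (f x))"
  shows "frechet_derivative (\<lambda>x. g (f x)) (at x) v =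
    frechet_derivative g (at (f x)) (frechet_derivative f (at x) v)"
  using frechet_derivative_compose[OF assms] by (simp add: o_def)

lemma frechet_derivative_bounded_linear:
  assumes "bounded_linear L" "f differentiable (at x)"
  shows "frechet_derivative (\<lambda>x. L (f x)) (at x) v = L (frechet_derivative f (at x) v)"
  using frechet_derivative_eqI[OF bounded_linear.has_derivative[OF assms(1) differentiable_frechet[OF assms(2)]]]
  by simp

lemma differentiable_bounded_linear:
  assumes "bounded_linear L" "f differentiable (at x)"
  shows "(\<lambda>x. L (f x)) differentiable (at x)"
  using bounded_linear.has_derivative[OF assms(1) differentiable_frechet[OF assms(2)]]
  by (rule differentiableI)

lemma frechet_derivative_bilinear:
  assumes "bounded_bilinear B" "f differentiable (at x)" "g differentiable (at x)"
  shows "frechet_derivative (\<lambda>x. B (f x) (g x)) (at x) v =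
    B (f x) (frechet_derivative g (at x) v) + B (frechet_derivative f (at x) v) (g x)"
  using frechet_derivative_eqI[OF bounded_bilinear.FDERIV[OF assms(1)
    differentiable_frechet[OF assms(2)] differentiable_frechet[OF assms(3)]]]
  by simp

lemma frechet_derivative_add:
  assumes "f differentiable (at x)" "g differentiable (at x)"
  shows "frechet_derivative (\<lambda>x. f x + g x) (at x) v =
    frechet_derivative f (at x) v + frechet_derivative g (at x) v"
  using frechet_derivative_eqI[OF has_derivative_add[OF
    differentiable_frechet[OF assms(1)] differentiable_frechet[OF assms(2)]]]
  by simp

lemma frechet_derivative_sum:
  assumes "\<And>i. i \<in> I \<Longrightarrow> f i differentiable (at x)"
  shows "frechet_derivative (\<lambda>x. \<Sum>i\<in>I. f i x) (at x) v =
    (\<Sum>i\<in>I. frechet_derivative (f i) (at x) v)"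
  using frechet_derivative_eqI[OF has_derivative_sum[of I f, OF
    differentiable_frechet[OF assms]]]
  by simp

section \<open>Closure properties of smooth maps\<close>

lemma C_on_subset: "C_on k S f \<Longrightarrow> T \<subseteq> S \<Longrightarrow> C_on k T f"
  by (induct k arbitrary: f) (auto intro: continuous_on_subset)

lemma C_on_cong:
  assumes "open S" "\<And>x. x \<in> S \<Longrightarrow> f x = g x" "C_on k S f"
  shows "C_on k S g"
  using assms(2,3)
proof (induct k arbitrary: f g)
  case 0
  then show ?case by (metis C_on.simps(1) continuous_on_cong)
next
  case (Suc k)
  have "frechet_derivative f (at x) v = frechet_derivative g (at x) v" if "x \<in> S" for x v
    using frechet_derivative_cong_open[OF assms(1) that, of f g] Suc(2) by simp
  with Suc(1)[of "\<lambda>x. frechet_derivative f (at x) v" "\<lambda>x. frechet_derivative g (at x) v" for v] Suc(2,3)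
  show ?case using differentiable_cong_open[OF assms(1), of _ f g] by auto
qed

lemma C_on_Suc_imp: "C_on (Suc k) S f \<Longrightarrow> C_on k S f"
  by (induct k arbitrary: f)
    (auto intro!: continuous_at_imp_continuous_on differentiable_imp_continuous_within)

lemma C_on_const: "C_on k S (\<lambda>x. c)"
  by (induct k arbitrary: c) auto

lemma C_on_bounded_linear: "bounded_linear L \<Longrightarrow> C_on k S L"
  by (cases k)
    (auto simp: C_on_const frechet_derivative_eqI[OF bounded_linear_imp_has_derivative]
      linear_continuous_on bounded_linear_imp_differentiable)

lemma C_on_add:
  assumes "open S" "C_on k S f" "C_on k S g"
  shows "C_on k S (\<lambda>x. f x + g x)"
  using assms(2,3)
proof (induct k arbitrary: f g)
  case 0 then show ?case by (auto intro: continuous_on_add)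
next
  case (Suc k)
  have "C_on k S (\<lambda>x. frechet_derivative (\<lambda>x. f x + g x) (at x) v)" for v
    by (rule C_on_cong[OF assms(1) _ Suc(1)[of "\<lambda>x. frechet_derivative f (at x) v" "\<lambda>x. frechet_derivative g (at x) v"]])
       (use Suc(2,3) in \<open>auto simp: frechet_derivative_add\<close>)
  with Suc(2,3) show ?case by auto
qed

lemma C_on_bilinear:
  assumes "open S" "bounded_bilinear B" "C_on k S f" "C_on k S g"
  shows "C_on k S (\<lambda>x. B (f x) (g x))"
  using assms(3,4)
proof (induct k arbitrary: f g)
  case 0 then show ?case using bounded_bilinear.continuous_on[OF assms(2)] by auto
next
  case (Suc k)
  have "C_on k S (\<lambda>x. frechet_derivative (\<lambda>x. B (f x) (g x)) (at x) v)" for v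
    by (rule C_on_cong[OF assms(1) _ C_on_add[OF assms(1)
          Suc(1)[of f "\<lambda>x. frechet_derivative g (at x) v"]
          Suc(1)[of "\<lambda>x. frechet_derivative f (at x) v" g]]])
       (use Suc(2,3) C_on_Suc_imp[OF Suc(2)] C_on_Suc_imp[OF Suc(3)] in
         \<open>auto simp: frechet_derivative_bilinear[OF assms(2)]\<close>)
  moreover have "(\<lambda>x. B (f x) (g x)) differentiable (at x)" if "x \<in> S" for x
    using bounded_bilinear.FDERIV[OF assms(2)] Suc(2,3) that unfolding differentiable_def C_on.simps by metis
  ultimately show ?case by auto
qed

lemma C_on_linear_comp:
  assumes "open S" "bounded_linear L" "C_on k S f"
  shows "C_on k S (\<lambda>x. L (f x))"
  using assms(3)
proof (induct k arbitrary: f)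
  case 0 then show ?case using bounded_linear.continuous_on[OF assms(2)] by auto
next
  case (Suc k)
  have "C_on k S (\<lambda>x. frechet_derivative (\<lambda>x. L (f x)) (at x) v)" for v
    by (rule C_on_cong[OF assms(1) _ Suc(1)[of "\<lambda>x. frechet_derivative f (at x) v"]])
       (use Suc(2) in \<open>auto simp: frechet_derivative_bounded_linear[OF assms(2)]\<close>)
  moreover have "(\<lambda>x. L (f x)) differentiable (at x)" if "x \<in> S" for x
    using differentiable_bounded_linear[OF assms(2), of f x] Suc(2) that by simp
  ultimately show ?case by auto
qed

lemma C_on_sum:
  assumes "open S" "\<And>i. i \<in> I \<Longrightarrow> C_on k S (f i)"
  shows "C_on k S (\<lambda>x. \<Sum>i\<in>I. f i x)"
  using assms(2)
  by (induct I rule: infinite_finite_induct) (auto intro: C_on_const C_on_add[OF assms(1)])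

lemma frechet_derivative_Basis:
  fixes g :: "'b::euclidean_space \<Rightarrow> 'c::real_normed_vector"
  assumes "g differentiable (at y)"
  shows "frechet_derivative g (at y) w = (\<Sum>b\<in>Basis. (w \<bullet> b) *\<^sub>R frechet_derivative g (at y) b)"
proof -
  have "frechet_derivative g (at y) (\<Sum>b\<in>Basis. (w \<bullet> b) *\<^sub>R b) =
      (\<Sum>b\<in>Basis. (w \<bullet> b) *\<^sub>R frechet_derivative g (at y) b)"
    by (simp only: frechet_derivative_apply_linear[OF assms])
  then show ?thesis by (simp only: euclidean_representation)
qed

text \<open>The derivative of \<open>g \<circ> f\<close> in a fixed direction is a derivative of \<open>g\<close> in a direction that
  moves with the point, whereas \<open>C_on\<close> only speaks of fixed directions. Expanding the moving direction
  in the basis turns the chain rule into a sum of products to which the induction hypothesis applies.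
  The same expansion proves \<open>smooth_on_frechet\<close> and \<open>frechet_derivative_frechet_apply\<close> below.\<close>

lemma C_on_compose:
  fixes f :: "'a::real_normed_vector \<Rightarrow> 'b::euclidean_space" and g :: "'b \<Rightarrow> 'c::real_normed_vector"
  assumes "open S" "open T" "f ` S \<subseteq> T" "C_on k S f" "C_on k T g"
  shows "C_on k S (\<lambda>x. g (f x))"
  using assms(4,5)
proof (induct k arbitrary: g)
  case 0 then show ?case
    using continuous_on_compose2[of T g S f] assms(3) by auto
next
  case (Suc k)
  have "C_on k S (\<lambda>x. frechet_derivative (\<lambda>x. g (f x)) (at x) v)" for v
  proof (rule C_on_cong[OF assms(1)])
    show "C_on k S (\<lambda>x. \<Sum>b\<in>Basis. (frechet_derivative f (at x) v \<bullet> b) *\<^sub>R frechet_derivative g (at (f x)) b)"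
      using Suc(1)[of "\<lambda>y. frechet_derivative g (at y) _"] Suc(2,3) C_on_Suc_imp[OF Suc(2)]
      by (auto intro!: C_on_sum C_on_bilinear[OF assms(1) bounded_bilinear_scaleR] C_on_linear_comp[of S "\<lambda>z. z \<bullet> _"] assms(1)
          bounded_linear_inner_left)
    show "(\<Sum>b\<in>Basis. (frechet_derivative f (at x) v \<bullet> b) *\<^sub>R frechet_derivative g (at (f x)) b)
      = frechet_derivative (\<lambda>x. g (f x)) (at x) v" if "x \<in> S" for x
      using that Suc(2,3) assms(3)
      by (auto simp: image_subset_iff frechet_derivative_chain frechet_derivative_Basis[symmetric])
  qed
  moreover have "(\<lambda>x. g (f x)) differentiable (at x)" if "x \<in> S" for x
    using that Suc(2,3) assms(3) differentiable_chain_at[of f x g] by (auto simp: o_def)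
  ultimately show ?case by auto
qed

lemma smooth_on_subset: "smooth_on S f \<Longrightarrow> T \<subseteq> S \<Longrightarrow> smooth_on T f"
  unfolding smooth_on_def using C_on_subset by blast

lemma smooth_on_cong:
  "open S \<Longrightarrow> smooth_on S f \<Longrightarrow> (\<And>x. x \<in> S \<Longrightarrow> f x = g x) \<Longrightarrow> smooth_on S g"
  unfolding smooth_on_def using C_on_cong by blast

lemma smooth_on_const: "smooth_on S (\<lambda>x. c)"
  unfolding smooth_on_def by (simp add: C_on_const)

lemma smooth_on_bounded_linear: "bounded_linear L \<Longrightarrow> smooth_on S L"
  unfolding smooth_on_def by (simp add: C_on_bounded_linear)

lemma smooth_on_linear_comp:
  "open S \<Longrightarrow> bounded_linear L \<Longrightarrow> smooth_on S f \<Longrightarrow> smooth_on S (\<lambda>x. L (f x))"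
  unfolding smooth_on_def by (simp add: C_on_linear_comp)

lemma smooth_on_bilinear:
  "open S \<Longrightarrow> bounded_bilinear B \<Longrightarrow> smooth_on S f \<Longrightarrow> smooth_on S g \<Longrightarrow> smooth_on S (\<lambda>x. B (f x) (g x))"
  unfolding smooth_on_def by (simp add: C_on_bilinear)

lemma smooth_on_add: "open S \<Longrightarrow> smooth_on S f \<Longrightarrow> smooth_on S g \<Longrightarrow> smooth_on S (\<lambda>x. f x + g x)"
  unfolding smooth_on_def by (simp add: C_on_add)

lemma smooth_on_minus: "open S \<Longrightarrow> smooth_on S f \<Longrightarrow> smooth_on S (\<lambda>x. - f x)"
  using smooth_on_linear_comp[of S uminus f] bounded_linear_minus[OF bounded_linear_ident] by auto

lemma smooth_on_diff: "open S \<Longrightarrow> smooth_on S f \<Longrightarrow> smooth_on S g \<Longrightarrow> smooth_on S (\<lambda>x. f x - g x)"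
  using smooth_on_add[of S f "\<lambda>x. - g x"] smooth_on_minus by auto

lemma smooth_on_scaleR: "open S \<Longrightarrow> smooth_on S f \<Longrightarrow> smooth_on S g \<Longrightarrow> smooth_on S (\<lambda>x. f x *\<^sub>R g x)"
  using smooth_on_bilinear bounded_bilinear_scaleR by blast

lemma smooth_on_sum:
  "open S \<Longrightarrow> (\<And>i. i \<in> I \<Longrightarrow> smooth_on S (f i)) \<Longrightarrow> smooth_on S (\<lambda>x. \<Sum>i\<in>I. f i x)"
  unfolding smooth_on_def by (simp add: C_on_sum)

lemma smooth_on_Pair:
  assumes "open S" "smooth_on S f" "smooth_on S g"
  shows "smooth_on S (\<lambda>x. (f x, g x))"
proof -
  have "smooth_on S (\<lambda>x. (f x, 0) + (0, g x))"
    using assms by (intro smooth_on_add smooth_on_linear_comp[of S "\<lambda>z. (z, 0)"]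
      smooth_on_linear_comp[of S "\<lambda>z. (0, z)"]) (auto intro: bounded_linear_Pair)
  then show ?thesis by simp
qed

lemma smooth_on_fst: "open S \<Longrightarrow> smooth_on S f \<Longrightarrow> smooth_on S (\<lambda>x. fst (f x))"
  using smooth_on_linear_comp[OF _ bounded_linear_fst] .

lemma smooth_on_snd: "open S \<Longrightarrow> smooth_on S f \<Longrightarrow> smooth_on S (\<lambda>x. snd (f x))"
  using smooth_on_linear_comp[OF _ bounded_linear_snd] .

lemma smooth_on_compose:
  fixes f :: "'a::real_normed_vector \<Rightarrow> 'b::euclidean_space" and g :: "'b \<Rightarrow> 'c::real_normed_vector"
  assumes "open S" "open T" "\<And>x. x \<in> S \<Longrightarrow> f x \<in> T" "smooth_on S f" "smooth_on T g"
  shows "smooth_on S (\<lambda>x. g (f x))"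
  using assms C_on_compose[of S T f] unfolding smooth_on_def by blast

lemma smooth_on_differentiable: "smooth_on S f \<Longrightarrow> x \<in> S \<Longrightarrow> f differentiable (at x)"
  unfolding smooth_on_def by (metis C_on.simps(2))

lemma smooth_on_continuous_on: "smooth_on S f \<Longrightarrow> continuous_on S f"
  unfolding smooth_on_def by (metis C_on.simps(1))

lemma smooth_on_frechet_const: "smooth_on S f \<Longrightarrow> smooth_on S (\<lambda>x. frechet_derivative f (at x) v)"
  unfolding smooth_on_def by (metis C_on.simps(2))

lemma smooth_on_frechet:
  fixes f :: "'a::euclidean_space \<Rightarrow> 'b::real_normed_vector"
  assumes "open S" "smooth_on S f" "smooth_on S v"
  shows "smooth_on S (\<lambda>x. frechet_derivative f (at x) (v x))"
proof (rule smooth_on_cong[OF assms(1)])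
  show "smooth_on S (\<lambda>x. \<Sum>b\<in>Basis. (v x \<bullet> b) *\<^sub>R frechet_derivative f (at x) b)"
    using assms by (intro smooth_on_sum smooth_on_scaleR smooth_on_frechet_const
      smooth_on_linear_comp[of S "\<lambda>z. z \<bullet> _"] bounded_linear_inner_left)
qed (simp add: frechet_derivative_Basis[symmetric] smooth_on_differentiable[OF assms(2)])

section \<open>Symmetry of the second derivative\<close>

text \<open>The second difference of \<open>f\<close> over a small parallelogram with edges \<open>h u\<close> and \<open>h v\<close> is symmetric
  in \<open>u\<close> and \<open>v\<close>. Two applications of the mean value theorem show that it is \<open>h\<^sup>2\<close> times a value of
  either mixed derivative close to \<open>x\<close>, so by continuity the two mixed derivatives cannot differ at \<open>x\<close>.\<close>

lemma symmetric_second_derivative_real: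
  fixes f :: "'a::euclidean_space \<Rightarrow> real"
  assumes S: "open S" "x \<in> S" and f: "smooth_on S f"
  shows "frechet_derivative (\<lambda>y. frechet_derivative f (at y) u) (at x) v =
    frechet_derivative (\<lambda>y. frechet_derivative f (at y) v) (at x) u"
proof (rule ccontr)
  define D where "D u y = frechet_derivative f (at y) u" for u y
  define H where "H u v y = frechet_derivative (D u) (at y) v" for u v y
  have smD: "smooth_on S (D u)" for u
    unfolding D_def by (rule smooth_on_frechet_const[OF f])
  have smH: "smooth_on S (H u v)" for u v
    unfolding H_def by (rule smooth_on_frechet_const[OF smD])
  \<comment> \<open>the mean value theorem, first in the direction \<open>a\<close> and then in the direction \<open>b\<close>\<close>
  have key: "\<exists>s t. 0 < s \<and> s < h \<and> 0 < t \<and> t < h \<and>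
      f (x + h *\<^sub>R a + h *\<^sub>R b) - f (x + h *\<^sub>R a) - f (x + h *\<^sub>R b) + f x = h * h * H a b (x + s *\<^sub>R a + t *\<^sub>R b)"
    if h: "h > 0" and sub: "\<And>s t. 0 \<le> s \<Longrightarrow> s \<le> h \<Longrightarrow> 0 \<le> t \<Longrightarrow> t \<le> h \<Longrightarrow> x + s *\<^sub>R a + t *\<^sub>R b \<in> S"
    for h a b
  proof -
    have d1: "((\<lambda>s. f (x + s *\<^sub>R a + t *\<^sub>R b)) has_real_derivative D a (x + s *\<^sub>R a + t *\<^sub>R b)) (at s)"
      if "0 \<le> s" "s \<le> h" "0 \<le> t" "t \<le> h" for s t
    proof -
      have "((\<lambda>s. x + s *\<^sub>R a + t *\<^sub>R b) has_derivative (\<lambda>r. r *\<^sub>R a)) (at s)"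
        by (auto intro!: derivative_eq_intros)
      from diff_chain_at[OF this differentiable_frechet[OF smooth_on_differentiable[OF f sub[OF that]]]]
      have "((\<lambda>s. f (x + s *\<^sub>R a + t *\<^sub>R b)) has_derivative (\<lambda>r. D a (x + s *\<^sub>R a + t *\<^sub>R b) * r)) (at s)"
        by (simp add: o_def D_def mult.commute frechet_derivative_apply_linear[OF smooth_on_differentiable[OF f sub[OF that]]])
      then show ?thesis by (simp add: has_field_derivative_def)
    qed
    have d2: "((\<lambda>t. D a (x + s *\<^sub>R a + t *\<^sub>R b)) has_real_derivative H a b (x + s *\<^sub>R a + t *\<^sub>R b)) (at t)"
      if "0 \<le> s" "s \<le> h" "0 \<le> t" "t \<le> h" for s t
    proof -
      have "((\<lambda>t. x + s *\<^sub>R a + t *\<^sub>R b) has_derivative (\<lambda>r. r *\<^sub>R b)) (at t)"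
        by (auto intro!: derivative_eq_intros)
      from diff_chain_at[OF this differentiable_frechet[OF smooth_on_differentiable[OF smD sub[OF that]]]]
      have "((\<lambda>t. D a (x + s *\<^sub>R a + t *\<^sub>R b)) has_derivative (\<lambda>r. H a b (x + s *\<^sub>R a + t *\<^sub>R b) * r)) (at t)"
        by (simp add: o_def H_def mult.commute frechet_derivative_apply_linear[OF smooth_on_differentiable[OF smD sub[OF that]]])
      then show ?thesis by (simp add: has_field_derivative_def)
    qed
    have "\<exists>s>0. s < h \<and>
      (f (x + h *\<^sub>R a + h *\<^sub>R b) - f (x + h *\<^sub>R a + 0 *\<^sub>R b)) - (f (x + 0 *\<^sub>R a + h *\<^sub>R b) - f (x + 0 *\<^sub>R a + 0 *\<^sub>R b))
       = (h - 0) * (D a (x + s *\<^sub>R a + h *\<^sub>R b) - D a (x + s *\<^sub>R a + 0 *\<^sub>R b))"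
      by (rule MVT2[OF h], rule DERIV_diff; rule d1) (use h in auto)
    then obtain s where s: "0 < s" "s < h"
      "f (x + h *\<^sub>R a + h *\<^sub>R b) - f (x + h *\<^sub>R a) - f (x + h *\<^sub>R b) + f x
       = h * (D a (x + s *\<^sub>R a + h *\<^sub>R b) - D a (x + s *\<^sub>R a))"
      by (auto simp: algebra_simps)
    have "\<exists>t>0. t < h \<and>
      D a (x + s *\<^sub>R a + h *\<^sub>R b) - D a (x + s *\<^sub>R a + 0 *\<^sub>R b) = (h - 0) * H a b (x + s *\<^sub>R a + t *\<^sub>R b)"
      by (rule MVT2[OF h], rule d2) (use s in auto)
    then obtain t where t: "0 < t" "t < h"
      "D a (x + s *\<^sub>R a + h *\<^sub>R b) - D a (x + s *\<^sub>R a) = h * H a b (x + s *\<^sub>R a + t *\<^sub>R b)"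
      by auto
    show ?thesis using s t by (intro exI[of _ s] exI[of _ t]) simp
  qed
  assume "frechet_derivative (\<lambda>y. frechet_derivative f (at y) u) (at x) v \<noteq>
    frechet_derivative (\<lambda>y. frechet_derivative f (at y) v) (at x) u"
  then have ne: "H u v x \<noteq> H v u x" by (simp add: H_def D_def[abs_def])
  define e where "e = \<bar>H u v x - H v u x\<bar> / 2"
  have e: "e > 0" using ne by (simp add: e_def)
  have cont: "\<exists>d>0. \<forall>y. dist y x < d \<longrightarrow> y \<in> S \<and> \<bar>H a b y - H a b x\<bar> < e" for a b
  proof -
    have "continuous (at x) (H a b)"
      using smooth_on_continuous_on[OF smH] S continuous_on_eq_continuous_at by blast
    then obtain d1 where d1: "d1 > 0" "\<And>y. dist y x < d1 \<Longrightarrow> dist (H a b y) (H a b x) < e"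
      using e unfolding continuous_at_eps_delta by blast
    obtain d2 where "d2 > 0" "ball x d2 \<subseteq> S" using S open_contains_ball by blast
    then show ?thesis
      using d1 by (intro exI[of _ "min d1 d2"]) (auto simp: dist_real_def dist_commute subset_eq)
  qed
  obtain d1 d2 where d: "d1 > 0" "\<And>y. dist y x < d1 \<Longrightarrow> y \<in> S \<and> \<bar>H u v y - H u v x\<bar> < e"
      "d2 > 0" "\<And>y. dist y x < d2 \<Longrightarrow> y \<in> S \<and> \<bar>H v u y - H v u x\<bar> < e"
    using cont[of u v] cont[of v u] by metis
  have "norm u + norm v + 1 > 0"
    using norm_ge_zero[of u] norm_ge_zero[of v] by linarith
  \<comment> \<open>this size keeps both parallelograms inside the balls of radius \<open>d1\<close> and \<open>d2\<close>\<close>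
  define h where "h = min d1 d2 / (2 * (norm u + norm v + 1))"
  have h: "h > 0" using d \<open>norm u + norm v + 1 > 0\<close> by (simp add: h_def)
  have near: "dist (x + s *\<^sub>R a + t *\<^sub>R b) x < min d1 d2"
    if "0 \<le> s" "s \<le> h" "0 \<le> t" "t \<le> h" "norm a + norm b = norm u + norm v" for s t a b
  proof -
    have "dist (x + s *\<^sub>R a + t *\<^sub>R b) x \<le> s * norm a + t * norm b"
      using norm_triangle_ineq[of "s *\<^sub>R a" "t *\<^sub>R b"] that by (simp add: dist_norm)
    also have "\<dots> \<le> h * (norm u + norm v)"
      using that by (metis add_mono distrib_left mult_right_mono norm_ge_zero)
    also have "\<dots> < h * (2 * (norm u + norm v + 1))"
      using h \<open>norm u + norm v + 1 > 0\<close> by (auto simp: algebra_simps intro!: add_nonneg_pos)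
    also have "\<dots> = min d1 d2"
      using \<open>norm u + norm v + 1 > 0\<close> by (simp add: h_def)
    finally show ?thesis .
  qed
  have "\<exists>s t. 0 < s \<and> s < h \<and> 0 < t \<and> t < h \<and>
    f (x + h *\<^sub>R u + h *\<^sub>R v) - f (x + h *\<^sub>R u) - f (x + h *\<^sub>R v) + f x = h * h * H u v (x + s *\<^sub>R u + t *\<^sub>R v)"
    by (rule key[OF h]) (use near[of _ _ u v] d(2) in auto)
  then obtain s t where st: "0 < s" "s < h" "0 < t" "t < h"
    "f (x + h *\<^sub>R u + h *\<^sub>R v) - f (x + h *\<^sub>R u) - f (x + h *\<^sub>R v) + f x = h * h * H u v (x + s *\<^sub>R u + t *\<^sub>R v)"
    by blast
  have "\<exists>s t. 0 < s \<and> s < h \<and> 0 < t \<and> t < h \<and>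
    f (x + h *\<^sub>R v + h *\<^sub>R u) - f (x + h *\<^sub>R v) - f (x + h *\<^sub>R u) + f x = h * h * H v u (x + s *\<^sub>R v + t *\<^sub>R u)"
    by (rule key[OF h]) (use near[of _ _ v u] d(2) in auto)
  then obtain s' t' where st': "0 < s'" "s' < h" "0 < t'" "t' < h"
    "f (x + h *\<^sub>R v + h *\<^sub>R u) - f (x + h *\<^sub>R v) - f (x + h *\<^sub>R u) + f x = h * h * H v u (x + s' *\<^sub>R v + t' *\<^sub>R u)"
    by blast
  have "h * h * H u v (x + s *\<^sub>R u + t *\<^sub>R v) = h * h * H v u (x + s' *\<^sub>R v + t' *\<^sub>R u)"
    using st(5) st'(5) by (simp add: algebra_simps)
  then have "H u v (x + s *\<^sub>R u + t *\<^sub>R v) = H v u (x + s' *\<^sub>R v + t' *\<^sub>R u)"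
    using h by simp
  moreover have "\<bar>H u v (x + s *\<^sub>R u + t *\<^sub>R v) - H u v x\<bar> < e"
    using d(2) near[of s t u v] st by simp
  moreover have "\<bar>H v u (x + s' *\<^sub>R v + t' *\<^sub>R u) - H v u x\<bar> < e"
    using d(4) near[of s' t' v u] st' by simp
  ultimately show False unfolding e_def by (smt (verit) field_sum_of_halves)
qed

lemma symmetric_second_derivative:
  fixes f :: "'a::euclidean_space \<Rightarrow> 'b::euclidean_space"
  assumes S: "open S" "x \<in> S" and f: "smooth_on S f"
  shows "frechet_derivative (\<lambda>y. frechet_derivative f (at y) u) (at x) v =
    frechet_derivative (\<lambda>y. frechet_derivative f (at y) v) (at x) u"
proof (rule euclidean_eqI)
  fix b :: 'b
  have *: "frechet_derivative (\<lambda>y. frechet_derivative f (at y) u) (at x) v \<bullet> b =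
    frechet_derivative (\<lambda>y. frechet_derivative (\<lambda>z. f z \<bullet> b) (at y) u) (at x) v" for u v
  proof -
    have "frechet_derivative (\<lambda>y. frechet_derivative (\<lambda>z. f z \<bullet> b) (at y) u) (at x) v =
      frechet_derivative (\<lambda>y. frechet_derivative f (at y) u \<bullet> b) (at x) v"
      by (rule fun_cong[OF frechet_derivative_cong_open[OF S]])
        (simp add: frechet_derivative_bounded_linear[OF bounded_linear_inner_left] smooth_on_differentiable[OF f])
    then show ?thesis
      by (simp add: frechet_derivative_bounded_linear[OF bounded_linear_inner_left]
         smooth_on_differentiable[OF smooth_on_frechet_const[OF f] S(2)])
  qed
  show "frechet_derivative (\<lambda>y. frechet_derivative f (at y) u) (at x) v \<bullet> b =
    frechet_derivative (\<lambda>y. frechet_derivative f (at y) v) (at x) u \<bullet> b"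
    unfolding * using symmetric_second_derivative_real[OF S smooth_on_linear_comp[OF S(1) bounded_linear_inner_left f]] .
qed

section \<open>Charts and curves\<close>

abbreviation chart_inv :: "('a, 'b) chart \<Rightarrow> 'b \<Rightarrow> 'a" where
  "chart_inv c \<equiv> inv_into (fst c) (snd c)"

abbreviation transition :: "('a, 'b) chart \<Rightarrow> ('a, 'b) chart \<Rightarrow> 'b \<Rightarrow> 'b" where
  "transition c d \<equiv> snd d \<circ> chart_inv c"

lemma chart_inj: "is_chart c \<Longrightarrow> inj_on (snd c) (fst c)"
  unfolding is_chart_def homeomorphism_def by (metis inj_on_inverseI)

lemma chart_inv_coord: "is_chart c \<Longrightarrow> x \<in> fst c \<Longrightarrow> chart_inv c (snd c x) = x"
  by (simp add: chart_inj)

lemma chart_image_open: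
  assumes "is_chart c" "open W"
  shows "open (snd c ` (fst c \<inter> W))"
proof -
  have "openin (top_of_set (snd c ` fst c)) (snd c ` (fst c \<inter> W))"
    using assms unfolding is_chart_def
    by (intro homeomorphism_imp_open_map[of "fst c" _ "snd c" "chart_inv c"]) auto
  then show ?thesis using assms openin_open_trans unfolding is_chart_def by blast
qed

lemma chart_overlap_open:
  "is_chart c \<Longrightarrow> is_chart d \<Longrightarrow> open (snd c ` (fst c \<inter> fst d))"
  by (rule chart_image_open) (simp_all add: is_chart_def)

lemma transition_mem_overlap:
  assumes "is_chart c" "s \<in> snd c ` (fst c \<inter> fst d)"
  shows "transition c d s \<in> snd d ` (fst d \<inter> fst c)"
  using assms by (auto simp: chart_inv_coord)

lemma smooth_transitionD:
  "smooth_transition c d \<Longrightarrow> smooth_on (snd c ` (fst c \<inter> fst d)) (transition c d)"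
  by (simp add: smooth_transition_def)

lemma time_chart_is_chart: "c \<in> time_charts \<Longrightarrow> is_chart c"
  by (simp add: time_charts_def)

lemma time_chart_smooth: "c \<in> time_charts \<Longrightarrow> smooth_on (fst c) (snd c)"
  by (simp add: time_charts_def smooth_transition_def o_def inv_id[unfolded id_def] id_def)

lemma time_chart_inv_smooth: "c \<in> time_charts \<Longrightarrow> smooth_on (snd c ` fst c) (chart_inv c)"
  by (simp add: time_charts_def smooth_transition_def)

text \<open>Time charts are compatible with the identity chart of the line by definition; hence they are
  compatible with each other.\<close>

lemma time_transition_smooth:
  assumes "c \<in> time_charts" "d \<in> time_charts"
  shows "smooth_on (snd c ` (fst c \<inter> fst d)) (transition c d)"
proof -
  have "smooth_on (snd c ` (fst c \<inter> fst d)) (\<lambda>s. snd d (chart_inv c s))"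
  proof (rule smooth_on_compose[of _ "fst d" "chart_inv c" "snd d"])
    show "open (snd c ` (fst c \<inter> fst d))" "open (fst d)"
      using assms chart_image_open[of c "fst d"] by (auto simp: time_charts_def is_chart_def)
    show "smooth_on (snd c ` (fst c \<inter> fst d)) (chart_inv c)"
      by (rule smooth_on_subset[OF time_chart_inv_smooth[OF assms(1)]]) auto
    show "smooth_on (fst d) (snd d)"
      by (rule time_chart_smooth[OF assms(2)])
    show "chart_inv c s \<in> fst d" if "s \<in> snd c ` (fst c \<inter> fst d)" for s
      using that by (auto simp: chart_inv_coord time_chart_is_chart[OF assms(1)])
  qed
  then show ?thesis by (simp add: o_def)
qed

lemma differentiable_has_vector_derivative:
  "f differentiable (at t) \<Longrightarrow> (f has_vector_derivative vector_derivative f (at t)) (at t)"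
  by (simp add: vector_derivative_works[symmetric])

lemma vector_derivative_chain_frechet:
  assumes "f differentiable (at t)" "g differentiable (at (f t))"
  shows "vector_derivative (g \<circ> f) (at t) = frechet_derivative g (at (f t)) (vector_derivative f (at t))"
proof -
  have "(f has_vector_derivative vector_derivative f (at t)) (at t)"
    using assms(1) by (rule differentiable_has_vector_derivative)
  from vector_derivative_diff_chain_within[OF this, of g "frechet_derivative g (at (f t))"]
  show ?thesis using differentiable_frechet[OF assms(2)]
    by (intro vector_derivative_at) (auto intro: has_derivative_at_withinI)
qed

lemma vector_derivative_cong_open:
  assumes "open S" "x \<in> S" "\<And>y. y \<in> S \<Longrightarrow> f y = g y"
  shows "vector_derivative f (at x) = vector_derivative g (at x)"
proof -
  have "(f has_vector_derivative f') (at x) \<longleftrightarrow> (g has_vector_derivative f') (at x)" for f'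
    using assms has_vector_derivative_transform_within_open[of f f' x S g]
      has_vector_derivative_transform_within_open[of g f' x S f] by auto
  then show ?thesis by (simp add: vector_derivative_def)
qed

definition velocity :: "('m, 'b::real_normed_vector) chart \<Rightarrow> (real \<Rightarrow> 'm) \<Rightarrow> real \<Rightarrow> 'b" where
  "velocity \<phi> c t = vector_derivative (snd \<phi> \<circ> c) (at t)"

locale jet_atlas =
  fixes A :: "('m::topological_space, real^'n) chart set"
  assumes atlas: "smooth_atlas A"
begin

lemma is_chart: "\<phi> \<in> A \<Longrightarrow> is_chart \<phi>"
  using atlas by (simp add: smooth_atlas_def)

lemma transition_smooth:
  "\<phi> \<in> A \<Longrightarrow> \<psi> \<in> A \<Longrightarrow> smooth_on (snd \<phi> ` (fst \<phi> \<inter> fst \<psi>)) (transition \<phi> \<psi>)"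
  using atlas by (simp add: smooth_atlas_def smooth_transitionD)

lemma overlap_open:
  "\<phi> \<in> A \<Longrightarrow> \<psi> \<in> A \<Longrightarrow> open (snd \<phi> ` (fst \<phi> \<inter> fst \<psi>))"
  by (intro chart_overlap_open is_chart)

text \<open>The definition of a smooth curve grants smoothness in one chart only. In that chart the curve is
  continuous, so it stays in the overlap with any other chart around \<open>\<gamma> t\<close> for a while, and the
  transition map carries the smoothness over.\<close>

lemma smooth_curve_in_chart:
  assumes "smooth_curve_at A \<gamma> t" "\<phi> \<in> A" "\<gamma> t \<in> fst \<phi>"
  obtains W where "open W" "t \<in> W" "\<gamma> ` W \<subseteq> fst \<phi>" "smooth_on W (snd \<phi> \<circ> \<gamma>)"
proof -
  obtain \<theta> I where \<theta>: "\<theta> \<in> A" "open I" "t \<in> I" "\<gamma> ` I \<subseteq> fst \<theta>" "smooth_on I (snd \<theta> \<circ> \<gamma>)"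
    using assms(1) unfolding smooth_curve_at_def by blast
  define O' where "O' = snd \<theta> ` (fst \<theta> \<inter> fst \<phi>)"
  have O': "open O'" using overlap_open assms \<theta> unfolding O'_def by blast
  define W where "W = I \<inter> (snd \<theta> \<circ> \<gamma>) -` O'"
  have W: "open W"
    unfolding W_def by (rule continuous_open_preimage[OF smooth_on_continuous_on[OF \<theta>(5)] \<theta>(2) O'])
  have tW: "t \<in> W" using \<theta> assms(3) by (auto simp: W_def O'_def)
  have sub: "\<gamma> s \<in> fst \<phi>" if "s \<in> W" for s
  proof -
    obtain z where "z \<in> fst \<theta> \<inter> fst \<phi>" "snd \<theta> (\<gamma> s) = snd \<theta> z" "\<gamma> s \<in> fst \<theta>"
      using \<theta>(4) \<open>s \<in> W\<close> by (auto simp: W_def O'_def)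
    then show ?thesis using inj_onD[OF chart_inj[OF is_chart[OF \<theta>(1)]]] by blast
  qed
  have "smooth_on W (\<lambda>s. transition \<theta> \<phi> ((snd \<theta> \<circ> \<gamma>) s))"
  proof (rule smooth_on_compose[OF W O', of "snd \<theta> \<circ> \<gamma>" "transition \<theta> \<phi>"])
    show "smooth_on W (snd \<theta> \<circ> \<gamma>)"
      by (rule smooth_on_subset[OF \<theta>(5)]) (auto simp: W_def)
    show "smooth_on O' (transition \<theta> \<phi>)"
      unfolding O'_def by (rule transition_smooth[OF \<theta>(1) assms(2)])
  qed (simp add: W_def)
  then have "smooth_on W (snd \<phi> \<circ> \<gamma>)"
  proof (rule smooth_on_cong[OF W])
    show "transition \<theta> \<phi> ((snd \<theta> \<circ> \<gamma>) s) = (snd \<phi> \<circ> \<gamma>) s" if "s \<in> W" for s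
      using \<theta>(4) that chart_inv_coord[OF is_chart[OF \<theta>(1)], of "\<gamma> s"] by (auto simp: W_def)
  qed
  then show ?thesis using that[OF W tW] sub by blast
qed

lemma smooth_curve_differentiable:
  assumes "smooth_curve_at A \<gamma> t" "\<phi> \<in> A" "\<gamma> t \<in> fst \<phi>"
  shows "(snd \<phi> \<circ> \<gamma>) differentiable (at t)"
  using smooth_curve_in_chart[OF assms] smooth_on_differentiable by metis

lemma velocity_transition:
  assumes "smooth_curve_at A \<gamma> t" "\<phi> \<in> A" "\<psi> \<in> A" "\<gamma> t \<in> fst \<phi>" "\<gamma> t \<in> fst \<psi>"
  shows "velocity \<psi> \<gamma> t = frechet_derivative (transition \<phi> \<psi>) (at (snd \<phi> (\<gamma> t))) (velocity \<phi> \<gamma> t)"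
proof -
  obtain W where W: "open W" "t \<in> W" "\<gamma> ` W \<subseteq> fst \<phi>"
    using smooth_curve_in_chart[OF assms(1,2,4)] by metis
  have "velocity \<psi> \<gamma> t = vector_derivative (transition \<phi> \<psi> \<circ> (snd \<phi> \<circ> \<gamma>)) (at t)"
    unfolding velocity_def
    by (rule vector_derivative_cong_open[OF W(1,2)])
       (use W(3) chart_inv_coord[OF is_chart[OF assms(2)]] in auto)
  also have "\<dots> = frechet_derivative (transition \<phi> \<psi>) (at ((snd \<phi> \<circ> \<gamma>) t)) (velocity \<phi> \<gamma> t)"
    unfolding velocity_def
    by (rule vector_derivative_chain_frechet[OF smooth_curve_differentiable[OF assms(1,2,4)]])
       (use smooth_on_differentiable[OF transition_smooth[OF assms(2,3)]] assms(4,5) in auto)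
  finally show ?thesis by simp
qed

section \<open>Jets\<close>

text \<open>Velocities that agree in one chart agree in all of them, by \<open>velocity_transition\<close>.\<close>

lemma jet1_eqI:
  assumes "smooth_curve_at A \<gamma> t" "smooth_curve_at A \<gamma>' t" "\<gamma> t = \<gamma>' t"
    and "\<phi> \<in> A" "\<gamma> t \<in> fst \<phi>" "velocity \<phi> \<gamma> t = velocity \<phi> \<gamma>' t"
  shows "jet1 A t \<gamma> = jet1 A t \<gamma>'"
proof -
  have "velocity \<psi> \<gamma> t = velocity \<psi> \<gamma>' t" if "\<psi> \<in> A" "\<gamma> t \<in> fst \<psi>" for \<psi>
    using velocity_transition[OF assms(1,4) that(1) assms(5) that(2)]
      velocity_transition[OF assms(2,4) that(1)] assms that by simp
  then show ?thesis unfolding jet1_def velocity_def using assms(3) by auto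
qed

text \<open>The choice made by \<open>jet_curve\<close> is harmless: whatever member of the class it picks, this curve
  has the base point and the velocities of the given one.\<close>

lemma jet_curve_jet1:
  assumes "smooth_curve_at A \<gamma> t"
  shows "smooth_curve_at A (jet_curve (jet1 A t \<gamma>)) t" "jet_curve (jet1 A t \<gamma>) t = \<gamma> t"
    "\<And>\<phi>. \<phi> \<in> A \<Longrightarrow> \<gamma> t \<in> fst \<phi> \<Longrightarrow> velocity \<phi> (jet_curve (jet1 A t \<gamma>)) t = velocity \<phi> \<gamma> t"
proof -
  have "\<gamma> \<in> snd (jet1 A t \<gamma>)" using assms by (simp add: jet1_def)
  then have "jet_curve (jet1 A t \<gamma>) \<in> snd (jet1 A t \<gamma>)"
    unfolding jet_curve_def by (rule someI[of "\<lambda>c. c \<in> snd (jet1 A t \<gamma>)"])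
  then show "smooth_curve_at A (jet_curve (jet1 A t \<gamma>)) t" "jet_curve (jet1 A t \<gamma>) t = \<gamma> t"
    "\<And>\<phi>. \<phi> \<in> A \<Longrightarrow> \<gamma> t \<in> fst \<phi> \<Longrightarrow> velocity \<phi> (jet_curve (jet1 A t \<gamma>)) t = velocity \<phi> \<gamma> t"
    by (auto simp: jet1_def velocity_def)
qed

lemma jet_time_jet1: "jet_time (jet1 A t \<gamma>) = t"
  by (simp add: jet_time_def jet1_def)

lemma jet_curve_smooth: "p \<in> jet_space A \<Longrightarrow> smooth_curve_at A (jet_curve p) (jet_time p)"
  unfolding jet_space_def using jet_curve_jet1(1) jet_time_jet1 by auto

lemma jet1_jet_curve:
  assumes "p \<in> jet_space A"
  shows "p = jet1 A (jet_time p) (jet_curve p)"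
proof -
  obtain t \<gamma> where p: "p = jet1 A t \<gamma>" and \<gamma>: "smooth_curve_at A \<gamma> t"
    using assms unfolding jet_space_def by blast
  obtain \<phi> where "\<phi> \<in> A" "\<gamma> t \<in> fst \<phi>" using \<gamma> unfolding smooth_curve_at_def by blast
  then show ?thesis
    using jet1_eqI[of \<gamma> t "jet_curve p" \<phi>] jet_curve_jet1[OF \<gamma>] \<gamma> unfolding p jet_time_jet1 by auto
qed

lemma jet_eqI:
  assumes "p \<in> jet_space A" "q \<in> jet_space A" "jet_time p = jet_time q" "jet_base p = jet_base q"
    "\<phi> \<in> A" "jet_base p \<in> fst \<phi>"
    "velocity \<phi> (jet_curve p) (jet_time p) = velocity \<phi> (jet_curve q) (jet_time q)"
  shows "p = q"
  using jet1_eqI[of "jet_curve p" "jet_time p" "jet_curve q" \<phi>]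
    jet1_jet_curve[OF assms(1)] jet1_jet_curve[OF assms(2)]
    jet_curve_smooth[OF assms(1)] jet_curve_smooth[OF assms(2)] assms(3-) unfolding jet_base_def
  by simp

text \<open>The jet is that of a curve which is a straight line in the chart.\<close>

lemma jet_exists:
  assumes "\<phi> \<in> A" "x \<in> fst \<phi>"
  obtains p where "p \<in> jet_space A" "jet_time p = t" "jet_base p = x"
    "velocity \<phi> (jet_curve p) t = w"
proof -
  define l where "l u = snd \<phi> x + (u - t) *\<^sub>R w" for u :: real
  define I where "I = l -` (snd \<phi> ` fst \<phi>)"
  define \<gamma> where "\<gamma> = chart_inv \<phi> \<circ> l"
  have I: "open I" unfolding I_def
    using is_chart[OF assms(1)]
    by (intro open_vimage) (auto simp: is_chart_def l_def[abs_def] intro!: continuous_intros)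
  have tI: "t \<in> I" using assms by (auto simp: I_def l_def)
  have sub: "\<gamma> ` I \<subseteq> fst \<phi>" by (auto simp: \<gamma>_def I_def inv_into_into)
  have eq: "(snd \<phi> \<circ> \<gamma>) u = l u" if "u \<in> I" for u
    using that by (auto simp: \<gamma>_def I_def f_inv_into_f)
  have "smooth_on I (\<lambda>u. (snd \<phi> x - t *\<^sub>R w) + u *\<^sub>R w)"
    using I by (intro smooth_on_add smooth_on_const smooth_on_bounded_linear bounded_linear_scaleR_left)
  then have "smooth_on I (snd \<phi> \<circ> \<gamma>)"
    by (rule smooth_on_cong[OF I]) (simp only: eq, simp add: l_def algebra_simps)
  then have \<gamma>: "smooth_curve_at A \<gamma> t"
    unfolding smooth_curve_at_def using assms I tI sub by blast
  have \<gamma>t: "\<gamma> t = x" using assms by (simp add: \<gamma>_def l_def chart_inv_coord is_chart)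
  have "velocity \<phi> \<gamma> t = vector_derivative l (at t)"
    unfolding velocity_def by (rule vector_derivative_cong_open[OF I tI eq])
  also have "\<dots> = w"
    unfolding l_def[abs_def] by (rule vector_derivative_at) (auto intro!: derivative_eq_intros)
  finally have "velocity \<phi> \<gamma> t = w" .
  then show ?thesis
    using that[of "jet1 A t \<gamma>"] jet_curve_jet1[OF \<gamma>] jet_time_jet1 \<gamma> \<gamma>t assms
    unfolding jet_space_def jet_base_def by auto
qed

end

section \<open>Coordinates of the jet space\<close>

lemma linear_vec_expansion:
  fixes f :: "real^'n \<Rightarrow> real^'m"
  assumes "linear f"
  shows "f w $ k = (\<Sum>j\<in>UNIV. w $ j * f (axis j 1) $ k)"
proof -
  have "f (\<Sum>j\<in>UNIV. w $ j *\<^sub>R axis j 1) = (\<Sum>j\<in>UNIV. w $ j *\<^sub>R f (axis j 1))"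
    by (simp add: linear_sum[OF assms] linear_scale[OF assms])
  moreover have "(\<Sum>j\<in>UNIV. w $ j *\<^sub>R axis j 1) = w"
    using basis_expansion[of w] by (simp add: scalar_mult_eq_scaleR)
  ultimately show ?thesis by simp
qed

text \<open>The coordinate change of the jet space. The factor \<open>dt/dt'\<close> in front of the derivative of the
  change of \<open>x\<close> is the derivative of the inverse change of time at the new time.\<close>

definition jet_transition ::
    "('m, 'n::finite) jet_chart \<Rightarrow> ('m, 'n) jet_chart \<Rightarrow> 'n coords \<Rightarrow> 'n coords" where
  "jet_transition \<kappa> \<kappa>' z =
    (transition (fst \<kappa>) (fst \<kappa>') (fst z),
     transition (snd \<kappa>) (snd \<kappa>') (fst (snd z)),
     frechet_derivative (transition (fst \<kappa>') (fst \<kappa>)) (at (transition (fst \<kappa>) (fst \<kappa>') (fst z))) 1 *\<^sub>R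
       frechet_derivative (transition (snd \<kappa>) (snd \<kappa>')) (at (fst (snd z))) (snd (snd z)))"

text \<open>This makes the third jet coordinate as good as the velocity with respect to the standard time.\<close>

lemma time_chart_inv_derivative_nonzero:
  assumes "c \<in> time_charts" "s \<in> snd c ` fst c"
  shows "vector_derivative (chart_inv c) (at s) \<noteq> 0"
proof
  assume z: "vector_derivative (chart_inv c) (at s) = 0"
  have op: "open (snd c ` fst c)" using assms(1) by (simp add: time_charts_def is_chart_def)
  have d: "chart_inv c differentiable (at s)" "snd c differentiable (at (chart_inv c s))"
    using smooth_on_differentiable[OF time_chart_inv_smooth[OF assms(1)] assms(2)]
      smooth_on_differentiable[OF time_chart_smooth[OF assms(1)]] assms(2) by (auto simp: inv_into_into)
  have "vector_derivative (snd c \<circ> chart_inv c) (at s) = vector_derivative (\<lambda>r. r) (at s)"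
    by (rule vector_derivative_cong_open[OF op assms(2)]) (auto simp: f_inv_into_f)
  then show False
    using vector_derivative_chain_frechet[OF d] z
    by (simp add: frechet_derivative_apply_linear(5)[OF d(2)])
qed

context jet_atlas begin

lemma jet_chartsE:
  assumes "\<kappa> \<in> jet_charts A"
  shows "fst \<kappa> \<in> time_charts" "snd \<kappa> \<in> A" "is_chart (fst \<kappa>)" "is_chart (snd \<kappa>)"
  using assms by (auto simp: jet_charts_def is_chart time_chart_is_chart)

lemma mem_jet_dom:
  "p \<in> jet_dom A \<kappa> \<longleftrightarrow> p \<in> jet_space A \<and> jet_time p \<in> fst (fst \<kappa>) \<and> jet_base p \<in> fst (snd \<kappa>)"
  by (simp add: jet_dom_def)

text \<open>By the chain rule, reading time in a chart multiplies the velocity by the derivative of the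
  inverse of that chart.\<close>

lemma jet_coord_eq:
  assumes "\<kappa> \<in> jet_charts A" "p \<in> jet_dom A \<kappa>"
  shows "jet_coord \<kappa> p = (snd (fst \<kappa>) (jet_time p), snd (snd \<kappa>) (jet_base p),
    vector_derivative (chart_inv (fst \<kappa>)) (at (snd (fst \<kappa>) (jet_time p))) *\<^sub>R
      velocity (snd \<kappa>) (jet_curve p) (jet_time p))"
proof -
  note \<kappa> = jet_chartsE[OF assms(1)]
  define s where "s = snd (fst \<kappa>) (jet_time p)"
  have p: "p \<in> jet_space A" "jet_time p \<in> fst (fst \<kappa>)" "jet_base p \<in> fst (snd \<kappa>)"
    using assms(2) by (auto simp: mem_jet_dom)
  have t: "chart_inv (fst \<kappa>) s = jet_time p" using p \<kappa> by (simp add: s_def chart_inv_coord)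
  have d1: "chart_inv (fst \<kappa>) differentiable (at s)"
    using smooth_on_differentiable[OF time_chart_inv_smooth[OF \<kappa>(1)]] p by (simp add: s_def)
  have d2: "(snd (snd \<kappa>) \<circ> jet_curve p) differentiable (at (chart_inv (fst \<kappa>) s))"
    using smooth_curve_differentiable[OF jet_curve_smooth[OF p(1)] \<kappa>(2)] p by (simp add: t jet_base_def)
  have "vector_derivative ((snd (snd \<kappa>) \<circ> jet_curve p) \<circ> chart_inv (fst \<kappa>)) (at s) =
    vector_derivative (chart_inv (fst \<kappa>)) (at s) *\<^sub>R velocity (snd \<kappa>) (jet_curve p) (jet_time p)"
    unfolding velocity_def
    using vector_derivative_at[OF vector_diff_chain_at[OF
      differentiable_has_vector_derivative[OF d1] differentiable_has_vector_derivative[OF d2]]]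
    by (simp only: t)
  then show ?thesis by (simp add: jet_coord_def Let_def s_def)
qed

lemma jet_coord_inj:
  assumes "\<kappa> \<in> jet_charts A"
  shows "inj_on (jet_coord \<kappa>) (jet_dom A \<kappa>)"
proof (rule inj_onI)
  fix p q assume pq: "p \<in> jet_dom A \<kappa>" "q \<in> jet_dom A \<kappa>" "jet_coord \<kappa> p = jet_coord \<kappa> q"
  note \<kappa> = jet_chartsE[OF assms]
  have t: "jet_time p = jet_time q"
    using pq jet_coord_eq[OF assms] inj_onD[OF chart_inj[OF \<kappa>(3)]] by (auto simp: mem_jet_dom)
  have b: "jet_base p = jet_base q"
    using pq jet_coord_eq[OF assms] inj_onD[OF chart_inj[OF \<kappa>(4)]] by (auto simp: mem_jet_dom)
  have "vector_derivative (chart_inv (fst \<kappa>)) (at (snd (fst \<kappa>) (jet_time p))) \<noteq> 0"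
    using time_chart_inv_derivative_nonzero[OF \<kappa>(1)] pq by (auto simp: mem_jet_dom)
  then have "velocity (snd \<kappa>) (jet_curve p) (jet_time p) = velocity (snd \<kappa>) (jet_curve q) (jet_time q)"
    using pq(3) t by (simp add: jet_coord_eq[OF assms pq(1)] jet_coord_eq[OF assms pq(2)])
  then show "p = q"
    using jet_eqI[of p q "snd \<kappa>"] pq t b \<kappa> by (auto simp: mem_jet_dom)
qed

lemma jet_point_coord:
  "\<kappa> \<in> jet_charts A \<Longrightarrow> p \<in> jet_dom A \<kappa> \<Longrightarrow> jet_point A \<kappa> (jet_coord \<kappa> p) = p"
  by (simp add: jet_point_def jet_coord_inj)

text \<open>Every velocity is realized by a jet, so the image of an overlap is a full product. In particular
  it is open, which is what derivatives with respect to the jet coordinates require.\<close>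

lemma jet_overlap_image:
  assumes "\<kappa> \<in> jet_charts A" "\<kappa>' \<in> jet_charts A"
  shows "jet_coord \<kappa> ` (jet_dom A \<kappa> \<inter> jet_dom A \<kappa>') =
    snd (fst \<kappa>) ` (fst (fst \<kappa>) \<inter> fst (fst \<kappa>')) \<times> snd (snd \<kappa>) ` (fst (snd \<kappa>) \<inter> fst (snd \<kappa>')) \<times> UNIV"
    (is "?L = ?T \<times> ?B \<times> UNIV")
proof
  show "?L \<subseteq> ?T \<times> ?B \<times> UNIV"
    using jet_coord_eq[OF assms(1)] by (auto simp: mem_jet_dom)
  note \<kappa> = jet_chartsE[OF assms(1)]
  show "?T \<times> ?B \<times> UNIV \<subseteq> ?L"
  proof clarify
    fix t x and y :: "real^'n"
    assume t: "t \<in> fst (fst \<kappa>)" "t \<in> fst (fst \<kappa>')" and x: "x \<in> fst (snd \<kappa>)" "x \<in> fst (snd \<kappa>')"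
    define i where "i = vector_derivative (chart_inv (fst \<kappa>)) (at (snd (fst \<kappa>) t))"
    have i: "i \<noteq> 0" using time_chart_inv_derivative_nonzero[OF \<kappa>(1)] t by (simp add: i_def)
    obtain p where p: "p \<in> jet_space A" "jet_time p = t" "jet_base p = x"
      "velocity (snd \<kappa>) (jet_curve p) t = inverse i *\<^sub>R y"
      using jet_exists[OF \<kappa>(2) x(1)] by metis
    have dom: "p \<in> jet_dom A \<kappa> \<inter> jet_dom A \<kappa>'" using p t x by (simp add: mem_jet_dom)
    moreover have "jet_coord \<kappa> p = (snd (fst \<kappa>) t, snd (snd \<kappa>) x, y)"
      using jet_coord_eq[OF assms(1), of p] dom p i by (simp add: i_def)
    ultimately show "(snd (fst \<kappa>) t, snd (snd \<kappa>) x, y) \<in> ?L" by (metis image_eqI)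
  qed
qed

lemma jet_overlap_open:
  assumes "\<kappa> \<in> jet_charts A" "\<kappa>' \<in> jet_charts A"
  shows "open (jet_coord \<kappa> ` (jet_dom A \<kappa> \<inter> jet_dom A \<kappa>'))"
  unfolding jet_overlap_image[OF assms]
  using jet_chartsE[OF assms(1)] jet_chartsE[OF assms(2)]
  by (intro open_Times chart_overlap_open open_UNIV)

lemma jet_open_dom: "\<kappa> \<in> jet_charts A \<Longrightarrow> jet_open A (jet_dom A \<kappa>)"
  unfolding jet_open_def using jet_overlap_open by (auto simp: mem_jet_dom Int_commute)

lemma jet_coord_transition:
  assumes "\<kappa> \<in> jet_charts A" "\<kappa>' \<in> jet_charts A" "p \<in> jet_dom A \<kappa>" "p \<in> jet_dom A \<kappa>'"
  shows "jet_coord \<kappa>' p = jet_transition \<kappa> \<kappa>' (jet_coord \<kappa> p)"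
proof -
  note \<kappa> = jet_chartsE[OF assms(1)] and \<kappa>' = jet_chartsE[OF assms(2)]
  let ?c = "fst \<kappa>" and ?c' = "fst \<kappa>'" and ?\<phi> = "snd \<kappa>" and ?\<phi>' = "snd \<kappa>'"
  let ?t = "jet_time p" and ?x = "jet_base p" and ?\<gamma> = "jet_curve p"
  let ?\<psi> = "frechet_derivative (transition ?\<phi> ?\<phi>') (at (snd ?\<phi> ?x))"
  let ?i = "vector_derivative (chart_inv ?c) (at (snd ?c ?t))"
  let ?r = "frechet_derivative (transition ?c' ?c) (at (snd ?c' ?t)) 1"
  have p: "p \<in> jet_space A" "?t \<in> fst ?c" "?t \<in> fst ?c'" "?x \<in> fst ?\<phi>" "?x \<in> fst ?\<phi>'"
    using assms by (auto simp: mem_jet_dom)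
  have op: "open (snd ?c' ` (fst ?c' \<inter> fst ?c))"
    using chart_image_open[OF \<kappa>'(3)] \<kappa>(3) by (simp add: is_chart_def)
  have mem: "snd ?c' ?t \<in> snd ?c' ` (fst ?c' \<inter> fst ?c)" using p by blast
  have inv: "chart_inv ?c (snd ?c ?t) = ?t" "chart_inv ?c' (snd ?c' ?t) = ?t" "chart_inv ?\<phi> (snd ?\<phi> ?x) = ?x"
    using p \<kappa> \<kappa>' by (simp_all add: chart_inv_coord)
  have d1: "transition ?c' ?c differentiable (at (snd ?c' ?t))"
    using smooth_on_differentiable[OF time_transition_smooth[OF \<kappa>'(1) \<kappa>(1)] mem] .
  have d2: "chart_inv ?c differentiable (at (transition ?c' ?c (snd ?c' ?t)))"
    using smooth_on_differentiable[OF time_chart_inv_smooth[OF \<kappa>(1)]] p by (simp add: inv del: inv_into_f_f)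
  have d3: "transition ?\<phi> ?\<phi>' differentiable (at (snd ?\<phi> ?x))"
    using smooth_on_differentiable[OF transition_smooth[OF \<kappa>(2) \<kappa>'(2)]] p by blast
  have "vector_derivative (chart_inv ?c') (at (snd ?c' ?t)) =
      vector_derivative (chart_inv ?c \<circ> transition ?c' ?c) (at (snd ?c' ?t))"
    by (rule vector_derivative_cong_open[OF op mem]) (use \<kappa> \<kappa>' in \<open>auto simp: chart_inv_coord\<close>)
  also have "\<dots> = ?r * ?i"
  proof -
    have "vector_derivative (chart_inv ?c \<circ> transition ?c' ?c) (at (snd ?c' ?t)) =
      vector_derivative (transition ?c' ?c) (at (snd ?c' ?t)) *\<^sub>R
      vector_derivative (chart_inv ?c) (at (transition ?c' ?c (snd ?c' ?t)))"
      by (rule vector_derivative_at[OF vector_diff_chain_at[OF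
          differentiable_has_vector_derivative[OF d1] differentiable_has_vector_derivative[OF d2]]])
    then show ?thesis
      using frechet_derivative_eq_vector_derivative[OF d1] by (simp add: inv del: inv_into_f_f)
  qed
  finally have i': "vector_derivative (chart_inv ?c') (at (snd ?c' ?t)) = ?r * ?i" .
  have "velocity ?\<phi>' ?\<gamma> ?t = ?\<psi> (velocity ?\<phi> ?\<gamma> ?t)"
    using velocity_transition[OF jet_curve_smooth[OF p(1)] \<kappa>(2) \<kappa>'(2)] p by (simp add: jet_base_def)
  then show ?thesis
    using jet_coord_eq[OF assms(1,3)] jet_coord_eq[OF assms(2,4)] i'
    by (simp add: jet_transition_def inv frechet_derivative_apply_linear[OF d3] del: inv_into_f_f)
qed

text \<open>The third component contains first derivatives of the transition maps of time and of \<open>M\<close>, which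
  are smooth because these maps are; it is linear in \<open>y\<close>.\<close>

lemma jet_transition_smooth:
  assumes "\<kappa> \<in> jet_charts A" "\<kappa>' \<in> jet_charts A"
  shows "smooth_on (jet_coord \<kappa> ` (jet_dom A \<kappa> \<inter> jet_dom A \<kappa>')) (jet_transition \<kappa> \<kappa>')"
proof -
  note \<kappa> = jet_chartsE[OF assms(1)] and \<kappa>' = jet_chartsE[OF assms(2)]
  let ?c = "fst \<kappa>" and ?c' = "fst \<kappa>'" and ?\<phi> = "snd \<kappa>" and ?\<phi>' = "snd \<kappa>'"
  let ?O = "jet_coord \<kappa> ` (jet_dom A \<kappa> \<inter> jet_dom A \<kappa>')"
  let ?T = "snd ?c ` (fst ?c \<inter> fst ?c')" and ?T' = "snd ?c' ` (fst ?c' \<inter> fst ?c)"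
  let ?B = "snd ?\<phi> ` (fst ?\<phi> \<inter> fst ?\<phi>')"
  have O: "open ?O" by (rule jet_overlap_open[OF assms])
  have T: "open ?T" "open ?T'" "open ?B"
    using \<kappa> \<kappa>' by (simp_all only: chart_overlap_open)
  have OT: "fst z \<in> ?T" "fst (snd z) \<in> ?B" if "z \<in> ?O" for z
    using that unfolding jet_overlap_image[OF assms] by auto
  have s1: "smooth_on ?O (\<lambda>z. fst z)" by (rule smooth_on_bounded_linear[OF bounded_linear_fst])
  have s2: "smooth_on ?O (\<lambda>z. fst (snd z))"
    by (rule smooth_on_fst[OF O smooth_on_bounded_linear[OF bounded_linear_snd]])
  have s3: "smooth_on ?O (\<lambda>z. snd (snd z))"
    by (rule smooth_on_snd[OF O smooth_on_bounded_linear[OF bounded_linear_snd]])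
  have t1: "smooth_on ?O (\<lambda>z. transition ?c ?c' (fst z))"
    by (rule smooth_on_compose[of ?O ?T fst "transition ?c ?c'", OF O T(1) OT(1) s1 time_transition_smooth[OF \<kappa>(1) \<kappa>'(1)]])
  have t2: "smooth_on ?O (\<lambda>z. transition ?\<phi> ?\<phi>' (fst (snd z)))"
    by (rule smooth_on_compose[of ?O ?B "\<lambda>z. fst (snd z)" "transition ?\<phi> ?\<phi>'", OF O T(3) OT(2) s2 transition_smooth[OF \<kappa>(2) \<kappa>'(2)]])
  have t3: "smooth_on ?O (\<lambda>z. frechet_derivative (transition ?c' ?c) (at (transition ?c ?c' (fst z))) 1)"
  proof (rule smooth_on_compose[of ?O ?T' "\<lambda>z. transition ?c ?c' (fst z)"
        "\<lambda>s. frechet_derivative (transition ?c' ?c) (at s) 1", OF O T(2) _ t1])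
    show "smooth_on ?T' (\<lambda>s. frechet_derivative (transition ?c' ?c) (at s) 1)"
      by (rule smooth_on_frechet_const[OF time_transition_smooth[OF \<kappa>'(1) \<kappa>(1)]])
    show "transition ?c ?c' (fst z) \<in> ?T'" if "z \<in> ?O" for z
      by (rule transition_mem_overlap[OF \<kappa>(3) OT(1)[OF that]])
  qed
  have t4: "smooth_on ?O (\<lambda>z. frechet_derivative (transition ?\<phi> ?\<phi>') (at (fst (snd z))) (snd (snd z)))"
  proof (rule smooth_on_cong[OF O])
    have "smooth_on ?O (\<lambda>z. frechet_derivative (transition ?\<phi> ?\<phi>') (at (fst (snd z))) b)" for b
      by (rule smooth_on_compose[of ?O ?B "\<lambda>z. fst (snd z)" "\<lambda>x. frechet_derivative (transition ?\<phi> ?\<phi>') (at x) b",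
            OF O T(3) OT(2) s2 smooth_on_frechet_const[OF transition_smooth[OF \<kappa>(2) \<kappa>'(2)]]])
    then show "smooth_on ?O (\<lambda>z. \<Sum>b\<in>Basis. (snd (snd z) \<bullet> b) *\<^sub>R
        frechet_derivative (transition ?\<phi> ?\<phi>') (at (fst (snd z))) b)"
      by (intro smooth_on_sum smooth_on_scaleR O smooth_on_linear_comp[OF O bounded_linear_inner_left s3])
  qed (simp add: frechet_derivative_Basis[symmetric] smooth_on_differentiable[OF transition_smooth[OF \<kappa>(2) \<kappa>'(2)] OT(2)])
  show ?thesis
    unfolding jet_transition_def[abs_def]
    by (intro smooth_on_Pair O t1 t2 smooth_on_scaleR t3 t4)
qed

lemma jet_coord_point_transition:
  assumes "\<kappa> \<in> jet_charts A" "\<kappa>' \<in> jet_charts A" "z \<in> jet_coord \<kappa> ` (jet_dom A \<kappa> \<inter> jet_dom A \<kappa>')"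
  shows "(jet_coord \<kappa>' \<circ> jet_point A \<kappa>) z = jet_transition \<kappa> \<kappa>' z"
proof -
  obtain p where "z = jet_coord \<kappa> p" "p \<in> jet_dom A \<kappa>" "p \<in> jet_dom A \<kappa>'"
    using assms(3) by blast
  then show ?thesis
    using jet_coord_transition[OF assms(1,2)] jet_point_coord[OF assms(1)] by simp
qed

lemma jet_coord_point_smooth:
  assumes "\<kappa> \<in> jet_charts A" "\<kappa>' \<in> jet_charts A"
  shows "smooth_on (jet_coord \<kappa> ` (jet_dom A \<kappa> \<inter> jet_dom A \<kappa>')) (jet_coord \<kappa>' \<circ> jet_point A \<kappa>)"
  by (rule smooth_on_cong[OF jet_overlap_open[OF assms] jet_transition_smooth[OF assms]])
    (rule jet_coord_point_transition[OF assms, symmetric])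

lemma jet_coord_point_differentiable:
  assumes "\<kappa> \<in> jet_charts A" "\<kappa>' \<in> jet_charts A" "p \<in> jet_dom A \<kappa>" "p \<in> jet_dom A \<kappa>'"
  shows "(jet_coord \<kappa>' \<circ> jet_point A \<kappa>) differentiable (at (jet_coord \<kappa> p))"
  using smooth_on_differentiable[OF jet_coord_point_smooth[OF assms(1,2)]] assms(3,4) by blast

section \<open>Jacobians of the coordinate changes\<close>

lemma jac_apply_linear:
  assumes "\<kappa> \<in> jet_charts A" "\<kappa>' \<in> jet_charts A" "p \<in> jet_dom A \<kappa>" "p \<in> jet_dom A \<kappa>'"
  shows "jac A \<kappa> \<kappa>' p (u + v) = jac A \<kappa> \<kappa>' p u + jac A \<kappa> \<kappa>' p v"
    and "jac A \<kappa> \<kappa>' p (r *\<^sub>R u) = r *\<^sub>R jac A \<kappa> \<kappa>' p u"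
    and "jac A \<kappa> \<kappa>' p (u - v) = jac A \<kappa> \<kappa>' p u - jac A \<kappa> \<kappa>' p v"
  using frechet_derivative_apply_linear[OF jet_coord_point_differentiable[OF assms]]
  by (auto simp: jac_def dir_deriv_def)

text \<open>A directional derivative can be taken in any chart, provided that the direction is transported by
  the Jacobian.\<close>

lemma dir_deriv_jac:
  assumes "\<kappa> \<in> jet_charts A" "\<kappa>' \<in> jet_charts A" "p \<in> jet_dom A \<kappa>" "p \<in> jet_dom A \<kappa>'"
    and "(f \<circ> jet_point A \<kappa>') differentiable (at (jet_coord \<kappa>' p))"
  shows "dir_deriv A \<kappa>' f p (jac A \<kappa> \<kappa>' p v) = dir_deriv A \<kappa> f p v"
proof -
  have pp: "jet_coord \<kappa> p \<in> jet_coord \<kappa> ` (jet_dom A \<kappa> \<inter> jet_dom A \<kappa>')" using assms by blast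
  have "frechet_derivative (f \<circ> jet_point A \<kappa>) (at (jet_coord \<kappa> p)) v =
    frechet_derivative (\<lambda>z. (f \<circ> jet_point A \<kappa>') ((jet_coord \<kappa>' \<circ> jet_point A \<kappa>) z)) (at (jet_coord \<kappa> p)) v"
  proof (rule fun_cong[OF frechet_derivative_cong_open[OF jet_overlap_open[OF assms(1,2)] pp]])
    fix y assume "y \<in> jet_coord \<kappa> ` (jet_dom A \<kappa> \<inter> jet_dom A \<kappa>')"
    then obtain q where "y = jet_coord \<kappa> q" "q \<in> jet_dom A \<kappa>" "q \<in> jet_dom A \<kappa>'" by blast
    then show "(f \<circ> jet_point A \<kappa>) y = (f \<circ> jet_point A \<kappa>') ((jet_coord \<kappa>' \<circ> jet_point A \<kappa>) y)"
      using jet_point_coord[OF assms(1)] jet_point_coord[OF assms(2)] by simp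
  qed
  also have "\<dots> = frechet_derivative (f \<circ> jet_point A \<kappa>') (at (jet_coord \<kappa>' p))
      (frechet_derivative (jet_coord \<kappa>' \<circ> jet_point A \<kappa>) (at (jet_coord \<kappa> p)) v)"
    using frechet_derivative_chain[OF jet_coord_point_differentiable[OF assms(1-4)], of "f \<circ> jet_point A \<kappa>'" v]
      assms(5) jet_point_coord[OF assms(1,3)] by simp
  finally show ?thesis by (simp add: dir_deriv_def jac_def)
qed

lemma jac_jac:
  assumes "\<kappa> \<in> jet_charts A" "\<kappa>' \<in> jet_charts A" "\<kappa>'' \<in> jet_charts A"
    "p \<in> jet_dom A \<kappa>" "p \<in> jet_dom A \<kappa>'" "p \<in> jet_dom A \<kappa>''"
  shows "jac A \<kappa>' \<kappa>'' p (jac A \<kappa> \<kappa>' p v) = jac A \<kappa> \<kappa>'' p v"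
  using dir_deriv_jac[OF assms(1,2,4,5) jet_coord_point_differentiable[OF assms(2,3,5,6)]]
  by (simp add: jac_def)

lemma jac_self:
  assumes "\<kappa> \<in> jet_charts A" "p \<in> jet_dom A \<kappa>"
  shows "jac A \<kappa> \<kappa> p v = v"
proof -
  have "frechet_derivative (jet_coord \<kappa> \<circ> jet_point A \<kappa>) (at (jet_coord \<kappa> p)) =
    frechet_derivative (\<lambda>z. z) (at (jet_coord \<kappa> p))"
  proof (rule frechet_derivative_cong_open[OF jet_overlap_open[OF assms(1,1)]])
    fix y assume "y \<in> jet_coord \<kappa> ` (jet_dom A \<kappa> \<inter> jet_dom A \<kappa>)"
    then obtain q where "y = jet_coord \<kappa> q" "q \<in> jet_dom A \<kappa>" by blast
    then show "(jet_coord \<kappa> \<circ> jet_point A \<kappa>) y = y"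
      using jet_point_coord[OF assms(1)] by simp
  qed (use assms in blast)
  then show ?thesis by (simp add: jac_def dir_deriv_def)
qed

text \<open>The Jacobian is block triangular. Time and space components of a vector transform among
  themselves, and a vertical vector stays vertical, transforming by \<open>dt/dt'\<close> times the Jacobian of the
  space coordinates.\<close>

lemma jac_structure:
  assumes "\<kappa> \<in> jet_charts A" "\<kappa>' \<in> jet_charts A" "p \<in> jet_dom A \<kappa>" "p \<in> jet_dom A \<kappa>'"
  defines "z \<equiv> jet_coord \<kappa> p"
  shows "fst (jac A \<kappa> \<kappa>' p v) = frechet_derivative (transition (fst \<kappa>) (fst \<kappa>')) (at (fst z)) (fst v)"
    and "fst (snd (jac A \<kappa> \<kappa>' p v)) =
      frechet_derivative (transition (snd \<kappa>) (snd \<kappa>')) (at (fst (snd z))) (fst (snd v))"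
    and "snd (snd (jac A \<kappa> \<kappa>' p (0, 0, w))) =
      frechet_derivative (transition (fst \<kappa>') (fst \<kappa>)) (at (fst (jet_coord \<kappa>' p))) 1 *\<^sub>R
      frechet_derivative (transition (snd \<kappa>) (snd \<kappa>')) (at (fst (snd z))) w"
proof -
  note \<kappa> = jet_chartsE[OF assms(1)] and \<kappa>' = jet_chartsE[OF assms(2)]
  have zO: "z \<in> jet_coord \<kappa> ` (jet_dom A \<kappa> \<inter> jet_dom A \<kappa>')" using assms by blast
  have zT: "fst z \<in> snd (fst \<kappa>) ` (fst (fst \<kappa>) \<inter> fst (fst \<kappa>'))"
    "fst (snd z) \<in> snd (snd \<kappa>) ` (fst (snd \<kappa>) \<inter> fst (snd \<kappa>'))"
    using zO unfolding jet_overlap_image[OF assms(1,2)] by auto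
  have d: "jet_transition \<kappa> \<kappa>' differentiable (at z)"
    by (rule smooth_on_differentiable[OF jet_transition_smooth[OF assms(1,2)] zO])
  have d1: "transition (fst \<kappa>) (fst \<kappa>') differentiable (at (fst z))"
    by (rule smooth_on_differentiable[OF time_transition_smooth[OF \<kappa>(1) \<kappa>'(1)] zT(1)])
  have d2: "transition (snd \<kappa>) (snd \<kappa>') differentiable (at (fst (snd z)))"
    by (rule smooth_on_differentiable[OF transition_smooth[OF \<kappa>(2) \<kappa>'(2)] zT(2)])
  have jac: "jac A \<kappa> \<kappa>' p v = frechet_derivative (jet_transition \<kappa> \<kappa>') (at z) v" for v
    unfolding jac_def dir_deriv_def z_def
    by (rule fun_cong[OF frechet_derivative_cong_open[OF jet_overlap_open[OF assms(1,2)]]])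
      (use zO jet_coord_point_transition[OF assms(1,2)] in \<open>auto simp: z_def\<close>)
  have bl: "bounded_linear (\<lambda>v :: real \<times> (real^'n) \<times> (real^'n). fst (snd v))"
      "bounded_linear (\<lambda>v :: real \<times> (real^'n) \<times> (real^'n). snd (snd v))"
    by (intro bounded_linear_compose[OF bounded_linear_fst] bounded_linear_compose[OF bounded_linear_snd] bounded_linear_snd)+
  have f1: "((\<lambda>v. fst v) :: 'n coords \<Rightarrow> real) differentiable (at z)"
    by (rule bounded_linear_imp_differentiable[OF bounded_linear_fst])
  have f1': "frechet_derivative ((\<lambda>v. fst v) :: 'n coords \<Rightarrow> real) (at z) v = fst v" for v
    by (rule fun_cong[OF frechet_derivative_eqI[OF bounded_linear_imp_has_derivative[OF bounded_linear_fst]]])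
  have f2: "((\<lambda>v. fst (snd v)) :: 'n coords \<Rightarrow> _) differentiable (at z)"
    by (rule bounded_linear_imp_differentiable[OF bl(1)])
  have f2': "frechet_derivative ((\<lambda>v. fst (snd v)) :: 'n coords \<Rightarrow> _) (at z) v = fst (snd v)" for v
    by (rule fun_cong[OF frechet_derivative_eqI[OF bounded_linear_imp_has_derivative[OF bl(1)]]])
  show "fst (jac A \<kappa> \<kappa>' p v) = frechet_derivative (transition (fst \<kappa>) (fst \<kappa>')) (at (fst z)) (fst v)"
    unfolding jac frechet_derivative_bounded_linear[OF bounded_linear_fst d, symmetric]
    using frechet_derivative_chain[OF f1 d1] by (simp add: jet_transition_def f1' del: o_apply)
  show "fst (snd (jac A \<kappa> \<kappa>' p v)) =
      frechet_derivative (transition (snd \<kappa>) (snd \<kappa>')) (at (fst (snd z))) (fst (snd v))"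
    unfolding jac frechet_derivative_bounded_linear[OF bl(1) d, symmetric]
    using frechet_derivative_chain[OF f2 d2] by (simp add: jet_transition_def f2' del: o_apply)
  \<comment> \<open>restricted to a fibre, the change of coordinates is linear\<close>
  define l where "l r = z + r *\<^sub>R (0, 0, w)" for r :: real
  define k where "k = frechet_derivative (transition (fst \<kappa>') (fst \<kappa>)) (at (fst (jet_coord \<kappa>' p))) 1"
  have l: "(l has_vector_derivative (0, 0, w)) (at 0)"
    unfolding l_def[abs_def] by (auto intro!: derivative_eq_intros)
  have l0: "l 0 = z" by (simp add: l_def prod_eq_iff)
  have k: "frechet_derivative (transition (fst \<kappa>') (fst \<kappa>)) (at (transition (fst \<kappa>) (fst \<kappa>') (fst z))) 1 = k"
    unfolding k_def jet_coord_transition[OF assms(1-4)] z_def jet_transition_def by simp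
  have "((\<lambda>r. snd (snd (jet_transition \<kappa> \<kappa>' (l r)))) has_vector_derivative
      frechet_derivative (\<lambda>z. snd (snd (jet_transition \<kappa> \<kappa>' z))) (at z) (0, 0, w)) (at 0)"
    using vector_derivative_diff_chain_within[OF l, of "\<lambda>z. snd (snd (jet_transition \<kappa> \<kappa>' z))"]
      differentiable_frechet[OF differentiable_bounded_linear[OF bl(2) d]]
    by (auto simp: l0 o_def intro: has_derivative_at_withinI)
  moreover have "snd (snd (jet_transition \<kappa> \<kappa>' (l r))) =
      snd (snd (jet_transition \<kappa> \<kappa>' z)) + r *\<^sub>R
        k *\<^sub>R frechet_derivative (transition (snd \<kappa>) (snd \<kappa>')) (at (fst (snd z))) w" for r
    using k by (simp add: jet_transition_def l_def frechet_derivative_apply_linear[OF d2] algebra_simps)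
  moreover have "((\<lambda>r. snd (snd (jet_transition \<kappa> \<kappa>' z)) + r *\<^sub>R
        k *\<^sub>R frechet_derivative (transition (snd \<kappa>) (snd \<kappa>')) (at (fst (snd z))) w) has_vector_derivative
        k *\<^sub>R frechet_derivative (transition (snd \<kappa>) (snd \<kappa>')) (at (fst (snd z))) w) (at 0)"
    by (auto intro!: derivative_eq_intros)
  ultimately have "frechet_derivative (\<lambda>z. snd (snd (jet_transition \<kappa> \<kappa>' z))) (at z) (0, 0, w) =
      k *\<^sub>R frechet_derivative (transition (snd \<kappa>) (snd \<kappa>')) (at (fst (snd z))) w"
    using vector_derivative_unique_at by (metis (no_types, lifting) ext)
  then show "snd (snd (jac A \<kappa> \<kappa>' p (0, 0, w))) =
      frechet_derivative (transition (fst \<kappa>') (fst \<kappa>)) (at (fst (jet_coord \<kappa>' p))) 1 *\<^sub>R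
      frechet_derivative (transition (snd \<kappa>) (snd \<kappa>')) (at (fst (snd z))) w"
    unfolding jac frechet_derivative_bounded_linear[OF bl(2) d, symmetric] k_def .
qed

end

text \<open>The product rule for \<open>z \<mapsto> Df(z)(y(z))\<close>. Its first summand is a second derivative of \<open>f\<close>, which is
  symmetric in \<open>h\<close> and \<open>y x\<close>. This is why second derivatives cancel in commutators, both of derivations
  (\<open>dir_deriv_commutator\<close>) and of coordinate changes (\<open>vector_field_lie_bracket\<close>).\<close>

lemma frechet_derivative_frechet_apply:
  fixes f :: "'a::euclidean_space \<Rightarrow> 'b::real_normed_vector"
  assumes S: "open S" "x \<in> S" and f: "smooth_on S f" and y: "y differentiable (at x)"
  shows "frechet_derivative (\<lambda>z. frechet_derivative f (at z) (y z)) (at x) h =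
    frechet_derivative (\<lambda>z. frechet_derivative f (at z) (y x)) (at x) h
    + frechet_derivative f (at x) (frechet_derivative y (at x) h)"
proof -
  have df: "f differentiable (at z)" if "z \<in> S" for z
    using smooth_on_differentiable[OF f that] .
  have dD: "(\<lambda>z. frechet_derivative f (at z) b) differentiable (at x)" for b
    using smooth_on_differentiable[OF smooth_on_frechet_const[OF f] S(2)] .
  have dy: "(\<lambda>z. y z \<bullet> b) differentiable (at x)" for b
    by (rule differentiable_bounded_linear[OF bounded_linear_inner_left y])
  have ds: "(\<lambda>z. u z *\<^sub>R frechet_derivative f (at z) b) differentiable (at x)"
    if "u differentiable (at x)" for u :: "'a \<Rightarrow> real" and b
    using bounded_bilinear.FDERIV[OF bounded_bilinear_scaleR differentiable_frechet[OF that] differentiable_frechet[OF dD]]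
    by (rule differentiableI)
  have eq: "frechet_derivative (\<lambda>z. frechet_derivative f (at z) (w z)) (at x) h =
      (\<Sum>b\<in>Basis. (w x \<bullet> b) *\<^sub>R frechet_derivative (\<lambda>z. frechet_derivative f (at z) b) (at x) h +
        frechet_derivative (\<lambda>z. w z \<bullet> b) (at x) h *\<^sub>R frechet_derivative f (at x) b)"
    if w: "\<And>b. (\<lambda>z. w z \<bullet> b) differentiable (at x)" for w
  proof -
    have "frechet_derivative (\<lambda>z. frechet_derivative f (at z) (w z)) (at x) =
      frechet_derivative (\<lambda>z. \<Sum>b\<in>Basis. (w z \<bullet> b) *\<^sub>R frechet_derivative f (at z) b) (at x)"
      by (rule frechet_derivative_cong_open[OF S]) (rule frechet_derivative_Basis[OF df])
    then show ?thesis
      using w by (simp add: frechet_derivative_sum ds frechet_derivative_bilinear[OF bounded_bilinear_scaleR] dD)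
  qed
  show ?thesis
    unfolding eq[of y, OF dy] eq[of "\<lambda>z. y x", OF differentiable_const]
      frechet_derivative_Basis[OF df[OF S(2)], of "frechet_derivative y (at x) h"]
    by (simp add: sum.distrib frechet_derivative_bounded_linear[OF bounded_linear_inner_left y])
qed

section \<open>Adapted components\<close>

lemma UNIV_index: "(UNIV :: 'n index set) = insert Tm (range Sp \<union> range Vt)"
proof -
  have "a \<in> insert Tm (range Sp \<union> range Vt)" for a :: "'n index"
    by (cases a) auto
  then show ?thesis by (simp add: set_eq_iff)
qed

lemma finite_index: "finite (UNIV :: 'n::finite index set)"
  by (simp add: UNIV_index)

lemma sum_range_Sp: "(\<Sum>a\<in>range Sp. f a) = (\<Sum>i\<in>UNIV. f (Sp i))"
  by (subst sum.reindex) (auto simp: inj_on_def)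

lemma sum_range_Vt: "(\<Sum>a\<in>range Vt. f a) = (\<Sum>i\<in>UNIV. f (Vt i))"
  by (subst sum.reindex) (auto simp: inj_on_def)

lemma sum_index:
  fixes f :: "'n::finite index \<Rightarrow> 'a::comm_monoid_add"
  shows "(\<Sum>a\<in>UNIV. f a) = f Tm + (\<Sum>i\<in>UNIV. f (Sp i)) + (\<Sum>i\<in>UNIV. f (Vt i))"
proof -
  have "(\<Sum>a\<in>UNIV. f a) = f Tm + (sum f (range Sp) + sum f (range Vt))"
    unfolding UNIV_index by (subst sum.insert; (subst sum.union_disjoint)?) auto
  then show ?thesis by (simp add: sum_range_Sp sum_range_Vt add.assoc)
qed

lemma adapted_comp_linear:
  "adapted_comp M N \<kappa> a p (u + v) = adapted_comp M N \<kappa> a p u + adapted_comp M N \<kappa> a p v"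
  "adapted_comp M N \<kappa> a p (r *\<^sub>R u) = r * adapted_comp M N \<kappa> a p u"
  "adapted_comp M N \<kappa> a p 0 = 0"
  "adapted_comp M N \<kappa> a p (u - v) = adapted_comp M N \<kappa> a p u - adapted_comp M N \<kappa> a p v"
  by (cases a; simp add: algebra_simps sum.distrib sum_distrib_left sum_subtractf)+

lemma adapted_comp_sum:
  "adapted_comp M N \<kappa> a p (sum f I) = (\<Sum>i\<in>I. adapted_comp M N \<kappa> a p (f i))"
  by (induct I rule: infinite_finite_induct) (simp_all add: adapted_comp_linear)

lemma adapted_comp_basis:
  "adapted_comp M N \<kappa> a p (basis_vec M N \<kappa> b p) = (if a = b then 1 else 0)"
  by (cases a; cases b)
    (auto simp: axis_def if_distrib[where f = "\<lambda>x. x * _"] cong: if_cong)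

lemma adapted_decomposition_sum:
  "v = (\<Sum>a\<in>UNIV. adapted_comp M N \<kappa> a p v *\<^sub>R basis_vec M N \<kappa> a p)"
  unfolding sum_index by (rule adapted_decomposition)

text \<open>All computations take place over the domain of one chart \<open>\<kappa>\<close>, where a function is smooth if
  and only if it is so in the coordinates of \<open>\<kappa>\<close>. The connection, however, acts on vector fields given in
  all charts, so it has to be shown that what is smooth in \<open>\<kappa>\<close> is smooth in the others.\<close>

locale jet_chart = jet_atlas A for A :: "('m::topological_space, real^'n) chart set" +
  fixes \<kappa> :: "('m, 'n) jet_chart"
  assumes chart: "\<kappa> \<in> jet_charts A"
begin

abbreviation "Dom \<equiv> jet_dom A \<kappa>"
abbreviation "smooth \<equiv> smooth_in_chart A \<kappa> Dom"
abbreviation "img \<equiv> jet_coord \<kappa> ` (Dom \<inter> Dom)"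

lemma img_open: "open img"
  by (rule jet_overlap_open[OF chart chart])

lemma coord_in_img: "p \<in> Dom \<Longrightarrow> jet_coord \<kappa> p \<in> img"
  by blast

lemma coord_point: "z \<in> img \<Longrightarrow> jet_coord \<kappa> (jet_point A \<kappa> z) = z"
  using jet_point_coord[OF chart] by auto

lemma point_in_dom: "z \<in> img \<Longrightarrow> jet_point A \<kappa> z \<in> Dom"
  using jet_point_coord[OF chart] by auto

lemma smooth_iff: "smooth f \<longleftrightarrow> smooth_on img (\<lambda>z. f (jet_point A \<kappa> z))"
  by (simp add: smooth_in_chart_def o_def)

lemma smooth_cong:
  assumes "smooth f" "\<And>p. p \<in> Dom \<Longrightarrow> f p = g p"
  shows "smooth g"
  using assms(1) unfolding smooth_iff
  by (rule smooth_on_cong[OF img_open]) (rule assms(2)[OF point_in_dom])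

lemma smooth_const: "smooth (\<lambda>p. c)"
  unfolding smooth_iff by (rule smooth_on_const)

lemma smooth_add: "smooth f \<Longrightarrow> smooth g \<Longrightarrow> smooth (\<lambda>p. f p + g p)"
  unfolding smooth_iff by (rule smooth_on_add[OF img_open])

lemma smooth_diff: "smooth f \<Longrightarrow> smooth g \<Longrightarrow> smooth (\<lambda>p. f p - g p)"
  unfolding smooth_iff by (rule smooth_on_diff[OF img_open])

lemma smooth_minus: "smooth f \<Longrightarrow> smooth (\<lambda>p. - f p)"
  unfolding smooth_iff by (rule smooth_on_minus[OF img_open])

lemma smooth_scaleR: "smooth f \<Longrightarrow> smooth g \<Longrightarrow> smooth (\<lambda>p. f p *\<^sub>R g p)"
  unfolding smooth_iff by (rule smooth_on_scaleR[OF img_open])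

lemma smooth_mult: "smooth f \<Longrightarrow> smooth g \<Longrightarrow> smooth (\<lambda>p. f p * g p :: real)"
  using smooth_scaleR[of f g] by simp

lemma smooth_sum: "(\<And>i. i \<in> I \<Longrightarrow> smooth (f i)) \<Longrightarrow> smooth (\<lambda>p. \<Sum>i\<in>I. f i p)"
  unfolding smooth_iff by (rule smooth_on_sum[OF img_open])

lemma smooth_Pair: "smooth f \<Longrightarrow> smooth g \<Longrightarrow> smooth (\<lambda>p. (f p, g p))"
  unfolding smooth_iff by (rule smooth_on_Pair[OF img_open])

lemma smooth_linear:
  fixes L :: "'b::euclidean_space \<Rightarrow> 'c::real_normed_vector"
  assumes "linear L" "smooth f"
  shows "smooth (\<lambda>p. L (f p))"
  using smooth_on_linear_comp[OF img_open, of L "\<lambda>z. f (jet_point A \<kappa> z)"] assms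
  unfolding smooth_iff by (simp add: linear_conv_bounded_linear)

lemma smooth_differentiable:
  "smooth f \<Longrightarrow> p \<in> Dom \<Longrightarrow> (f \<circ> jet_point A \<kappa>) differentiable (at (jet_coord \<kappa> p))"
  unfolding smooth_in_chart_def by (rule smooth_on_differentiable[OF _ coord_in_img])

lemma smooth_dir_deriv:
  assumes "smooth f" "smooth v"
  shows "smooth (\<lambda>p. dir_deriv A \<kappa> f p (v p))"
proof -
  have "smooth_on img (\<lambda>z. frechet_derivative (f \<circ> jet_point A \<kappa>) (at z) (v (jet_point A \<kappa> z)))"
    using assms smooth_on_frechet[OF img_open, of "f \<circ> jet_point A \<kappa>" "\<lambda>z. v (jet_point A \<kappa> z)"]
    unfolding smooth_iff by (simp add: o_def)
  then show ?thesis
    unfolding smooth_iff dir_deriv_def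
    by (rule smooth_on_cong[OF img_open]) (simp add: coord_point)
qed

lemma smooth_in_other_chart:
  assumes "smooth f" "\<kappa>' \<in> jet_charts A"
  shows "smooth_in_chart A \<kappa>' Dom f"
proof -
  let ?O = "jet_coord \<kappa>' ` (jet_dom A \<kappa>' \<inter> Dom)"
  have O: "open ?O" by (rule jet_overlap_open[OF assms(2) chart])
  have "smooth_on ?O (\<lambda>z. (f \<circ> jet_point A \<kappa>) ((jet_coord \<kappa> \<circ> jet_point A \<kappa>') z))"
  proof (rule smooth_on_compose[OF O img_open, of "jet_coord \<kappa> \<circ> jet_point A \<kappa>'" "f \<circ> jet_point A \<kappa>"])
    show "smooth_on ?O (jet_coord \<kappa> \<circ> jet_point A \<kappa>')"
      by (rule jet_coord_point_smooth[OF assms(2) chart])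
    show "smooth_on img (f \<circ> jet_point A \<kappa>)"
      using assms(1) by (simp add: smooth_in_chart_def)
    show "(jet_coord \<kappa> \<circ> jet_point A \<kappa>') z \<in> img" if z: "z \<in> ?O" for z
    proof -
      obtain q where "z = jet_coord \<kappa>' q" "q \<in> jet_dom A \<kappa>'" "q \<in> Dom" using z by blast
      then show ?thesis using jet_point_coord[OF assms(2)] by simp
    qed
  qed
  then have "smooth_on ?O (f \<circ> jet_point A \<kappa>')"
  proof (rule smooth_on_cong[OF O])
    fix z assume "z \<in> ?O"
    then obtain q where "z = jet_coord \<kappa>' q" "q \<in> jet_dom A \<kappa>'" "q \<in> Dom" by blast
    then show "(f \<circ> jet_point A \<kappa>) ((jet_coord \<kappa> \<circ> jet_point A \<kappa>') z) = (f \<circ> jet_point A \<kappa>') z"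
      using jet_point_coord[OF assms(2)] jet_point_coord[OF chart] by simp
  qed
  then show ?thesis by (simp add: smooth_in_chart_def Int_commute)
qed

lemma smooth_function: "smooth f \<Longrightarrow> smooth_function A Dom f"
  by (simp add: smooth_function_def smooth_in_other_chart)

section \<open>Vector fields over a chart domain\<close>

text \<open>The vector field over the domain of \<open>\<kappa>\<close> with prescribed components in \<open>\<kappa>\<close>.\<close>

definition spread :: "('m jet \<Rightarrow> 'n coords) \<Rightarrow> ('m, 'n) vfield" where
  "spread v = (\<lambda>\<kappa>' p. jac A \<kappa> \<kappa>' p (v p))"

lemma spread_chart: "p \<in> Dom \<Longrightarrow> spread v \<kappa> p = v p"
  by (simp add: spread_def jac_self[OF chart])

lemma vector_field_spread:
  assumes "smooth v"
  shows "vector_field A Dom (spread v)"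
  unfolding vector_field_def
proof (intro conjI ballI)
  fix \<kappa>' assume \<kappa>': "\<kappa>' \<in> jet_charts A"
  let ?O = "jet_coord \<kappa> ` (Dom \<inter> jet_dom A \<kappa>')"
  let ?O' = "jet_coord \<kappa>' ` (jet_dom A \<kappa>' \<inter> Dom)"
  have O: "open ?O" "open ?O'" using jet_overlap_open[OF chart \<kappa>'] jet_overlap_open[OF \<kappa>' chart] by auto
  have v: "smooth_on ?O (\<lambda>z. v (jet_point A \<kappa> z))"
    using assms unfolding smooth_iff by (rule smooth_on_subset) blast
  have j: "smooth_on ?O (\<lambda>z. frechet_derivative (jet_coord \<kappa>' \<circ> jet_point A \<kappa>) (at z) (v (jet_point A \<kappa> z)))"
    by (rule smooth_on_frechet[OF O(1) jet_coord_point_smooth[OF chart \<kappa>'] v])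
  have "smooth_on ?O' (\<lambda>z. frechet_derivative (jet_coord \<kappa>' \<circ> jet_point A \<kappa>)
      (at ((jet_coord \<kappa> \<circ> jet_point A \<kappa>') z)) (v (jet_point A \<kappa> ((jet_coord \<kappa> \<circ> jet_point A \<kappa>') z))))"
  proof (rule smooth_on_compose[OF O(2,1), of "jet_coord \<kappa> \<circ> jet_point A \<kappa>'"
       "\<lambda>z. frechet_derivative (jet_coord \<kappa>' \<circ> jet_point A \<kappa>) (at z) (v (jet_point A \<kappa> z))"])
    show "smooth_on ?O' (jet_coord \<kappa> \<circ> jet_point A \<kappa>')"
      by (rule jet_coord_point_smooth[OF \<kappa>' chart])
    show "(jet_coord \<kappa> \<circ> jet_point A \<kappa>') z \<in> ?O" if z: "z \<in> ?O'" for z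
    proof -
      obtain q where "z = jet_coord \<kappa>' q" "q \<in> jet_dom A \<kappa>'" "q \<in> Dom" using z by blast
      then show ?thesis using jet_point_coord[OF \<kappa>'] by simp
    qed
  qed (rule j)
  then have "smooth_on ?O' (spread v \<kappa>' \<circ> jet_point A \<kappa>')"
  proof (rule smooth_on_cong[OF O(2)])
    fix z assume "z \<in> ?O'"
    then obtain q where "z = jet_coord \<kappa>' q" "q \<in> jet_dom A \<kappa>'" "q \<in> Dom" by blast
    then show "frechet_derivative (jet_coord \<kappa>' \<circ> jet_point A \<kappa>)
      (at ((jet_coord \<kappa> \<circ> jet_point A \<kappa>') z)) (v (jet_point A \<kappa> ((jet_coord \<kappa> \<circ> jet_point A \<kappa>') z)))
      = (spread v \<kappa>' \<circ> jet_point A \<kappa>') z"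
      using jet_point_coord[OF \<kappa>'] jet_point_coord[OF chart]
      by (simp add: spread_def jac_def dir_deriv_def)
  qed
  then show "smooth_in_chart A \<kappa>' Dom (spread v \<kappa>')"
    by (simp add: smooth_in_chart_def Int_commute)
next
  fix \<kappa>1 \<kappa>2 p
  assume "\<kappa>1 \<in> jet_charts A" "\<kappa>2 \<in> jet_charts A" "p \<in> Dom \<inter> jet_dom A \<kappa>1 \<inter> jet_dom A \<kappa>2"
  then show "spread v \<kappa>2 p = jac A \<kappa>1 \<kappa>2 p (spread v \<kappa>1 p)"
    unfolding spread_def using jac_jac[OF chart] by simp
qed

lemma vector_field_smooth: "vector_field A Dom X \<Longrightarrow> smooth (X \<kappa>)"
  using chart by (simp add: vector_field_def)

lemma vector_field_chart:
  assumes "vector_field A Dom X" "p \<in> Dom" "\<kappa>' \<in> jet_charts A" "p \<in> jet_dom A \<kappa>'"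
  shows "X \<kappa>' p = jac A \<kappa> \<kappa>' p (X \<kappa> p)"
  using assms chart unfolding vector_field_def by blast

lemma vf_eqI:
  assumes "vector_field A Dom X" "vector_field A Dom Y" "\<And>p. p \<in> Dom \<Longrightarrow> X \<kappa> p = Y \<kappa> p"
  shows "vf_eq A Dom X Y"
  unfolding vf_eq_def
proof (intro ballI)
  fix \<kappa>' p assume *: "\<kappa>' \<in> jet_charts A" "p \<in> Dom \<inter> jet_dom A \<kappa>'"
  then have p: "p \<in> Dom" "p \<in> jet_dom A \<kappa>'" by blast+
  show "X \<kappa>' p = Y \<kappa>' p"
    using vector_field_chart[OF assms(1) p(1) *(1) p(2)] vector_field_chart[OF assms(2) p(1) *(1) p(2)]
      assms(3)[OF p(1)] by simp
qed

lemma vf_eqD: "vf_eq A Dom X Y \<Longrightarrow> p \<in> Dom \<Longrightarrow> X \<kappa> p = Y \<kappa> p"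
  using chart unfolding vf_eq_def by blast

text \<open>Because Jacobians compose, the transformation law has to be checked from \<open>\<kappa>\<close> to the other charts
  only, and smoothness in \<open>\<kappa>\<close> only.\<close>

lemma vector_fieldI:
  assumes "smooth (X \<kappa>)"
    "\<And>\<kappa>' p. \<kappa>' \<in> jet_charts A \<Longrightarrow> p \<in> Dom \<Longrightarrow> p \<in> jet_dom A \<kappa>' \<Longrightarrow> X \<kappa>' p = jac A \<kappa> \<kappa>' p (X \<kappa> p)"
  shows "vector_field A Dom X"
  unfolding vector_field_def
proof (intro conjI ballI)
  note vf = vector_field_spread[OF assms(1)]
  fix \<kappa>' assume \<kappa>': "\<kappa>' \<in> jet_charts A"
  have O: "open (jet_coord \<kappa>' ` (Dom \<inter> jet_dom A \<kappa>'))"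
    using jet_overlap_open[OF \<kappa>' chart] by (simp add: Int_commute)
  have "smooth_on (jet_coord \<kappa>' ` (Dom \<inter> jet_dom A \<kappa>')) (spread (X \<kappa>) \<kappa>' \<circ> jet_point A \<kappa>')"
    using vf \<kappa>' by (simp add: vector_field_def smooth_in_chart_def)
  then show "smooth_in_chart A \<kappa>' Dom (X \<kappa>')"
    unfolding smooth_in_chart_def
  proof (rule smooth_on_cong[OF O])
    fix z assume "z \<in> jet_coord \<kappa>' ` (Dom \<inter> jet_dom A \<kappa>')"
    then obtain q where "z = jet_coord \<kappa>' q" "q \<in> jet_dom A \<kappa>'" "q \<in> Dom" by blast
    then show "(spread (X \<kappa>) \<kappa>' \<circ> jet_point A \<kappa>') z = (X \<kappa>' \<circ> jet_point A \<kappa>') z"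
      using jet_point_coord[OF \<kappa>'] assms(2)[OF \<kappa>', of q] by (simp add: spread_def)
  qed
next
  fix \<kappa>1 \<kappa>2 p
  assume *: "\<kappa>1 \<in> jet_charts A" "\<kappa>2 \<in> jet_charts A" "p \<in> Dom \<inter> jet_dom A \<kappa>1 \<inter> jet_dom A \<kappa>2"
  then have p: "p \<in> Dom" "p \<in> jet_dom A \<kappa>1" "p \<in> jet_dom A \<kappa>2" by blast+
  show "X \<kappa>2 p = jac A \<kappa>1 \<kappa>2 p (X \<kappa>1 p)"
    unfolding assms(2)[OF *(1) p(1,2)] assms(2)[OF *(2) p(1,3)]
    using jac_jac[OF chart *(1,2) p] by simp
qed

lemma vector_field_add:
  assumes "vector_field A Dom X" "vector_field A Dom Y"
  shows "vector_field A Dom (vf_add X Y)"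
proof (rule vector_fieldI)
  show "smooth (vf_add X Y \<kappa>)"
    unfolding vf_add_def by (intro smooth_add vector_field_smooth assms)
  show "vf_add X Y \<kappa>' p = jac A \<kappa> \<kappa>' p (vf_add X Y \<kappa> p)"
    if "\<kappa>' \<in> jet_charts A" "p \<in> Dom" "p \<in> jet_dom A \<kappa>'" for \<kappa>' p
    unfolding vf_add_def jac_apply_linear[OF chart that]
    using vector_field_chart[OF assms(1) that(2,1,3)] vector_field_chart[OF assms(2) that(2,1,3)] by simp
qed

lemma vector_field_scale:
  assumes "smooth f" "vector_field A Dom X"
  shows "vector_field A Dom (vf_scale f X)"
proof (rule vector_fieldI)
  show "smooth (vf_scale f X \<kappa>)"
    unfolding vf_scale_def by (intro smooth_scaleR vector_field_smooth assms)
  show "vf_scale f X \<kappa>' p = jac A \<kappa> \<kappa>' p (vf_scale f X \<kappa> p)"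
    if "\<kappa>' \<in> jet_charts A" "p \<in> Dom" "p \<in> jet_dom A \<kappa>'" for \<kappa>' p
    unfolding vf_scale_def jac_apply_linear[OF chart that]
    using vector_field_chart[OF assms(2) that(2,1,3)] by simp
qed

text \<open>Differentiating the transformation law of \<open>Y\<close> produces a second derivative of the coordinate
  change, taken in the directions \<open>Y\<close> and \<open>u\<close>.\<close>

lemma dir_deriv_vector_field_chart:
  assumes Y: "vector_field A Dom Y" and p: "\<kappa>' \<in> jet_charts A" "p \<in> Dom" "p \<in> jet_dom A \<kappa>'"
  shows "dir_deriv A \<kappa>' (Y \<kappa>') p (jac A \<kappa> \<kappa>' p u) =
    frechet_derivative (\<lambda>z. frechet_derivative (jet_coord \<kappa>' \<circ> jet_point A \<kappa>) (at z) (Y \<kappa> p)) (at (jet_coord \<kappa> p)) u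
    + jac A \<kappa> \<kappa>' p (dir_deriv A \<kappa> (Y \<kappa>) p u)"
proof -
  let ?O = "jet_coord \<kappa> ` (Dom \<inter> jet_dom A \<kappa>')" and ?y = "Y \<kappa> \<circ> jet_point A \<kappa>"
  let ?T = "jet_coord \<kappa>' \<circ> jet_point A \<kappa>"
  have O: "open ?O" "jet_coord \<kappa> p \<in> ?O" using jet_overlap_open[OF chart p(1)] p by auto
  have "smooth_on (jet_coord \<kappa>' ` (Dom \<inter> jet_dom A \<kappa>')) (Y \<kappa>' \<circ> jet_point A \<kappa>')"
    using Y p(1) by (simp add: vector_field_def smooth_in_chart_def)
  then have dY: "(Y \<kappa>' \<circ> jet_point A \<kappa>') differentiable (at (jet_coord \<kappa>' p))"
    by (rule smooth_on_differentiable) (use p in blast)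
  have "dir_deriv A \<kappa>' (Y \<kappa>') p (jac A \<kappa> \<kappa>' p u) = dir_deriv A \<kappa> (Y \<kappa>') p u"
    by (rule dir_deriv_jac[OF chart p dY])
  also have "\<dots> = frechet_derivative (\<lambda>z. frechet_derivative ?T (at z) (?y z)) (at (jet_coord \<kappa> p)) u"
    unfolding dir_deriv_def
  proof (rule fun_cong[OF frechet_derivative_cong_open[OF O]])
    fix z assume "z \<in> ?O"
    then obtain q where "z = jet_coord \<kappa> q" "q \<in> Dom" "q \<in> jet_dom A \<kappa>'" by blast
    then show "(Y \<kappa>' \<circ> jet_point A \<kappa>) z = frechet_derivative ?T (at z) (?y z)"
      using jet_point_coord[OF chart] vector_field_chart[OF Y _ p(1), of q] by (simp add: jac_def dir_deriv_def)
  qed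
  also have "\<dots> = frechet_derivative (\<lambda>z. frechet_derivative ?T (at z) (?y (jet_coord \<kappa> p))) (at (jet_coord \<kappa> p)) u
     + frechet_derivative ?T (at (jet_coord \<kappa> p)) (frechet_derivative ?y (at (jet_coord \<kappa> p)) u)"
    by (rule frechet_derivative_frechet_apply[OF O jet_coord_point_smooth[OF chart p(1)]
        smooth_differentiable[OF vector_field_smooth[OF Y] p(2)]])
  finally show ?thesis by (simp add: jac_def dir_deriv_def jet_point_coord[OF chart p(2)])
qed

text \<open>The second derivatives of the coordinate change in \<open>X(Y)\<close> and \<open>Y(X)\<close> are the same by symmetry, so
  the components of the bracket transform by the Jacobian.\<close>

lemma vector_field_lie_bracket:
  assumes X: "vector_field A Dom X" and Y: "vector_field A Dom Y"
  shows "vector_field A Dom (lie_bracket A X Y)"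
proof (rule vector_fieldI)
  show "smooth (lie_bracket A X Y \<kappa>)"
    unfolding lie_bracket_def by (intro smooth_diff smooth_dir_deriv vector_field_smooth X Y)
  fix \<kappa>' p assume p: "\<kappa>' \<in> jet_charts A" "p \<in> Dom" "p \<in> jet_dom A \<kappa>'"
  have O: "open (jet_coord \<kappa> ` (Dom \<inter> jet_dom A \<kappa>'))" "jet_coord \<kappa> p \<in> jet_coord \<kappa> ` (Dom \<inter> jet_dom A \<kappa>')"
    using jet_overlap_open[OF chart p(1)] p by auto
  show "lie_bracket A X Y \<kappa>' p = jac A \<kappa> \<kappa>' p (lie_bracket A X Y \<kappa> p)"
    unfolding lie_bracket_def vector_field_chart[OF X p(2,1,3)] vector_field_chart[OF Y p(2,1,3)]
      dir_deriv_vector_field_chart[OF X p] dir_deriv_vector_field_chart[OF Y p]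
      jac_apply_linear[OF chart p]
    using symmetric_second_derivative[OF O jet_coord_point_smooth[OF chart p(1)]] by simp
qed

end

lemma same_kind_sym: "a \<in> same_kind b \<longleftrightarrow> b \<in> same_kind a"
  by (cases a; cases b) auto

lemma same_kind_trans: "a \<in> same_kind b \<Longrightarrow> same_kind a = same_kind b"
  by (cases a; cases b) auto

lemma sum_same_kind:
  fixes f :: "'n::finite index \<Rightarrow> 'a::comm_monoid_add"
  assumes "\<And>r. r \<notin> same_kind a \<Longrightarrow> f r = 0"
  shows "(\<Sum>r\<in>same_kind a. f r) = (\<Sum>r\<in>UNIV. f r)"
  using assms by (intro sum.mono_neutral_left finite_index) auto

locale gamma_connection_chart = jet_chart A \<kappa>
  for A :: "('m::topological_space, real^'n) chart set" and \<kappa> +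
  fixes M :: "('m, 'n) jet_chart \<Rightarrow> 'm jet \<Rightarrow> real^'n"
    and N :: "('m, 'n) jet_chart \<Rightarrow> 'm jet \<Rightarrow> real^'n^'n"
    and nab :: "'m jet set \<Rightarrow> ('m, 'n) vfield \<Rightarrow> ('m, 'n) vfield \<Rightarrow> ('m, 'n) vfield"
  assumes nonlinear: "nonlinear_connection A M N"
    and gamma_linear: "gamma_linear_connection A M N nab"
begin

abbreviation "e \<equiv> basis_vec M N \<kappa>"
abbreviation "E \<equiv> adapted_frame A M N \<kappa>"
abbreviation "cmp \<equiv> adapted_comp M N \<kappa>"
abbreviation "C \<equiv> conn_coef A M N nab \<kappa>"
abbreviation "\<delta> \<equiv> adapted_deriv A M N \<kappa>"

section \<open>The adapted frame\<close>

lemma MN_smooth: "smooth (M \<kappa>)" "smooth (N \<kappa>)"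
  using nonlinear chart by (auto simp: nonlinear_connection_def)

lemma M_comp_smooth: "smooth (\<lambda>p. M \<kappa> p $ i)"
  by (rule smooth_linear[OF _ MN_smooth(1)]) (auto intro!: linearI)

lemma N_comp_smooth: "smooth (\<lambda>p. N \<kappa> p $ i $ j)"
  by (rule smooth_linear[OF _ MN_smooth(2), of "\<lambda>X. X $ i $ j"]) (auto intro!: linearI)

lemma basis_smooth: "smooth (e a)"
proof (cases a)
  case Tm
  have "smooth (\<lambda>p. (1 :: real, 0 :: real^'n, - M \<kappa> p))"
    by (intro smooth_Pair smooth_const smooth_minus MN_smooth)
  then show ?thesis by (rule smooth_cong) (simp add: Tm)
next
  case (Sp i)
  have "linear (\<lambda>X :: real^'n^'n. \<chi> j. X $ j $ i)"
    by (auto intro!: linearI simp: vec_eq_iff)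
  then have "smooth (\<lambda>p. (0 :: real, axis i 1 :: real^'n, - (\<chi> j. N \<kappa> p $ j $ i)))"
    by (intro smooth_Pair smooth_const smooth_minus smooth_linear[OF _ MN_smooth(2)])
  then show ?thesis by (rule smooth_cong) (simp add: Sp)
next
  case (Vt i)
  show ?thesis by (rule smooth_cong[OF smooth_const]) (simp add: Vt)
qed

lemma comp_smooth:
  assumes "smooth v"
  shows "smooth (\<lambda>p. cmp a p (v p))"
proof (cases a)
  case Tm
  have "smooth (\<lambda>p. fst (v p))" by (rule smooth_linear[OF _ assms]) (auto intro!: linearI)
  then show ?thesis by (rule smooth_cong) (simp add: Tm)
next
  case (Sp i)
  have "smooth (\<lambda>p. fst (snd (v p)) $ i)"
    by (rule smooth_linear[OF _ assms, of "\<lambda>v. fst (snd v) $ i"]) (auto intro!: linearI)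
  then show ?thesis by (rule smooth_cong) (simp add: Sp)
next
  case (Vt i)
  have 1: "smooth (\<lambda>p. fst (v p))" by (rule smooth_linear[OF _ assms]) (auto intro!: linearI)
  have 2: "smooth (\<lambda>p. fst (snd (v p)) $ j)" for j
    by (rule smooth_linear[OF _ assms, of "\<lambda>v. fst (snd v) $ j"]) (auto intro!: linearI)
  have 3: "smooth (\<lambda>p. snd (snd (v p)) $ j)" for j
    by (rule smooth_linear[OF _ assms, of "\<lambda>v. snd (snd v) $ j"]) (auto intro!: linearI)
  have "smooth (\<lambda>p. snd (snd (v p)) $ i + fst (v p) * M \<kappa> p $ i
     + (\<Sum>j\<in>UNIV. fst (snd (v p)) $ j * N \<kappa> p $ i $ j))"
    by (intro smooth_add smooth_sum smooth_mult 1 2 3 M_comp_smooth N_comp_smooth)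
  then show ?thesis by (rule smooth_cong) (simp add: Vt)
qed

lemma frame_spread: "E a = spread (e a)"
  by (simp add: adapted_frame_def spread_def)

lemma frame_vector_field: "vector_field A Dom (E a)"
  unfolding frame_spread by (rule vector_field_spread[OF basis_smooth])

lemma frame_chart: "p \<in> Dom \<Longrightarrow> E a \<kappa> p = e a p"
  by (simp add: frame_spread spread_chart)

text \<open>The transformation law of a nonlinear connection says precisely that the line spanned by
  \<open>\<delta>/\<delta>t\<close> and the space spanned by the \<open>\<delta>/\<delta>x\<^sup>i\<close> do not depend on the chart: the inhomogeneous terms
  of the law for \<open>M\<close> and \<open>N\<close> cancel the vertical parts that the Jacobian gives to the images of
  \<open>\<partial>/\<partial>t\<close> and \<open>\<partial>/\<partial>x\<^sup>i\<close>.\<close>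

lemma frame_kind:
  assumes "\<kappa>' \<in> jet_charts A" "p \<in> Dom" "p \<in> jet_dom A \<kappa>'" "a \<notin> same_kind b"
  shows "adapted_comp M N \<kappa>' a p (E b \<kappa>' p) = 0"
proof -
  let ?z = "jet_coord \<kappa> p" and ?z' = "jet_coord \<kappa>' p"
  let ?J = "jac A \<kappa> \<kappa>' p" and ?J' = "jac A \<kappa>' \<kappa> p"
  let ?\<sigma> = "frechet_derivative (transition (fst \<kappa>) (fst \<kappa>')) (at (fst ?z))"
  let ?\<rho> = "frechet_derivative (transition (fst \<kappa>') (fst \<kappa>)) (at (fst ?z')) 1"
  let ?\<psi> = "frechet_derivative (transition (snd \<kappa>) (snd \<kappa>')) (at (fst (snd ?z)))"
  let ?\<psi>' = "frechet_derivative (transition (snd \<kappa>') (snd \<kappa>)) (at (fst (snd ?z')))"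
  note J = jac_structure[OF chart assms(1-3)]
  note J' = jac_structure[OF assms(1) chart assms(3,2)]
  note Jlin = jac_apply_linear[OF chart assms(1-3)]
  note JJ = jac_jac[OF chart assms(1) chart assms(2,3,2)] jac_self[OF chart assms(2)]
  have J0: "?J 0 = 0" using Jlin(2)[of 0 0] by simp
  have \<sigma>0: "?\<sigma> 0 = 0" using J(1)[of 0] J0 by simp
  have \<psi>lin: "linear ?\<psi>"
  proof (rule linearI)
    show "?\<psi> (x + y) = ?\<psi> x + ?\<psi> y" for x y
      using J(2)[of "(0, x, 0)"] J(2)[of "(0, y, 0)"] J(2)[of "(0, x, 0) + (0, y, 0)"]
      unfolding Jlin by simp
    show "?\<psi> (r *\<^sub>R x) = r *\<^sub>R ?\<psi> x" for r x
      using J(2)[of "(0, x, 0)"] J(2)[of "r *\<^sub>R (0, x, 0)"] unfolding Jlin by simp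
  qed
  have \<psi>'lin: "linear ?\<psi>'"
  proof (rule linearI)
    note J'lin = jac_apply_linear[OF assms(1) chart assms(3,2)]
    show "?\<psi>' (x + y) = ?\<psi>' x + ?\<psi>' y" for x y
      using J'(2)[of "(0, x, 0)"] J'(2)[of "(0, y, 0)"] J'(2)[of "(0, x, 0) + (0, y, 0)"]
      unfolding J'lin by simp
    show "?\<psi>' (r *\<^sub>R x) = r *\<^sub>R ?\<psi>' x" for r x
      using J'(2)[of "(0, x, 0)"] J'(2)[of "r *\<^sub>R (0, x, 0)"] unfolding J'lin by simp
  qed
  \<comment> \<open>the Jacobians of a coordinate change and of its inverse are inverse to each other\<close>
  have \<psi>'\<psi>: "?\<psi>' (?\<psi> x) = x" for x
    using JJ(1)[of "(0, x, 0)"] J'(2)[of "?J (0, x, 0)"] J(2)[of "(0, x, 0)"] JJ(2) by simp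
  have \<sigma>\<rho>: "?\<sigma> 1 * ?\<rho> = 1"
  proof -
    have "fst (?J' (r *\<^sub>R (1, 0, 0))) = r * ?\<rho>" for r
      unfolding jac_apply_linear[OF assms(1) chart assms(3,2)] using J'(1)[of "(1, 0, 0)"] by simp
    moreover have "fst (?J' (?J (1, 0, 0))) = fst (?J' (?\<sigma> 1 *\<^sub>R (1, 0, 0)))"
      using J'(1) J(1)[of "(1, 0, 0)"] by simp
    ultimately show ?thesis using JJ by simp
  qed
  have split: "?J (x, y, w) = ?J (x, y, 0) + ?J (0, 0, w)" for x y w
    using Jlin(1)[of "(x, y, 0)" "(0, 0, w)"] by simp
  have lawM: "M \<kappa>' p $ k = (\<Sum>j\<in>UNIV. M \<kappa> p $ j * ?\<rho>\<^sup>2 * ?\<psi> (axis j 1) $ k)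
      - ?\<rho> * snd (snd (?J (1, 0, 0))) $ k" for k
    using nonlinear chart assms(1-3) J'(1)[of "(1, 0, 0)"] J(2)[of "(0, axis _ 1, 0)"]
    by (simp add: nonlinear_connection_def Let_def)
  have lawN: "N \<kappa>' p $ k $ l =
      (\<Sum>i\<in>UNIV. \<Sum>j\<in>UNIV. N \<kappa> p $ j $ i * ?\<rho> * ?\<psi>' (axis l 1) $ i * ?\<psi> (axis j 1) $ k)
      - (\<Sum>i\<in>UNIV. ?\<psi>' (axis l 1) $ i * snd (snd (?J (0, axis i 1, 0))) $ k)" for k l
    using nonlinear chart assms(1-3) J'(1)[of "(1, 0, 0)"] J(2)[of "(0, axis _ 1, 0)"] J'(2)[of "(0, axis _ 1, 0)"]
    by (simp add: nonlinear_connection_def Let_def)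
  show ?thesis
  proof (cases b)
    case Tm
    have v: "E b \<kappa>' p = ?J (1, 0, 0) + ?J (0, 0, - M \<kappa> p)"
      using split[of 1 0 "- M \<kappa> p"] by (simp add: adapted_frame_def Tm)
    have fs: "fst (E b \<kappa>' p) = ?\<sigma> 1" "fst (snd (E b \<kappa>' p)) = 0"
      by (simp_all add: adapted_frame_def Tm J linear_0[OF \<psi>lin])
    show ?thesis
    proof (cases a)
      case (Vt k)
      have "snd (snd (E b \<kappa>' p)) $ k = snd (snd (?J (1, 0, 0))) $ k - ?\<rho> * ?\<psi> (M \<kappa> p) $ k"
        unfolding v by (simp add: J(3) linear_neg[OF \<psi>lin])
      moreover have "?\<sigma> 1 * M \<kappa>' p $ k = ?\<rho> * ?\<psi> (M \<kappa> p) $ k - snd (snd (?J (1, 0, 0))) $ k"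
      proof -
        have "(\<Sum>j\<in>UNIV. M \<kappa> p $ j * ?\<rho>\<^sup>2 * ?\<psi> (axis j 1) $ k) = ?\<rho>\<^sup>2 * ?\<psi> (M \<kappa> p) $ k"
          unfolding linear_vec_expansion[OF \<psi>lin, of "M \<kappa> p"] sum_distrib_left
          by (intro sum.cong) (auto simp: mult_ac)
        then have "?\<sigma> 1 * M \<kappa>' p $ k =
            (?\<sigma> 1 * ?\<rho>) * (?\<rho> * ?\<psi> (M \<kappa> p) $ k) - (?\<sigma> 1 * ?\<rho>) * snd (snd (?J (1, 0, 0))) $ k"
          unfolding lawM by (simp add: algebra_simps power2_eq_square)
        then show ?thesis unfolding \<sigma>\<rho> by simp
      qed
      ultimately show ?thesis using fs by (simp add: Vt)
    qed (use assms(4) fs Tm in auto)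
  next
    case (Sp i)
    define n where "n = (\<chi> j. N \<kappa> p $ j $ i)"
    have v: "E b \<kappa>' p = ?J (0, axis i 1, 0) + ?J (0, 0, - n)"
      using split[of 0 "axis i 1" "- n"] by (simp add: adapted_frame_def Sp n_def)
    have fs: "fst (E b \<kappa>' p) = 0" "fst (snd (E b \<kappa>' p)) = ?\<psi> (axis i 1)"
      by (simp_all add: adapted_frame_def Sp J \<sigma>0)
    show ?thesis
    proof (cases a)
      case (Vt k)
      have 1: "snd (snd (E b \<kappa>' p)) $ k = snd (snd (?J (0, axis i 1, 0))) $ k - ?\<rho> * ?\<psi> n $ k"
        unfolding v by (simp add: J(3) linear_neg[OF \<psi>lin])
      have inv: "(\<Sum>l\<in>UNIV. ?\<psi> (axis i 1) $ l * ?\<psi>' (axis l 1) $ h) = (if h = i then 1 else 0)" for h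
        using linear_vec_expansion[OF \<psi>'lin, of "?\<psi> (axis i 1)" h] by (simp add: \<psi>'\<psi> axis_def)
      \<comment> \<open>collect the terms so that the inverse Jacobian can be summed against the Jacobian\<close>
      have N1: "N \<kappa>' p $ k $ l = (\<Sum>h\<in>UNIV. ?\<psi>' (axis l 1) $ h *
          ((\<Sum>j\<in>UNIV. N \<kappa> p $ j $ h * ?\<rho> * ?\<psi> (axis j 1) $ k) - snd (snd (?J (0, axis h 1, 0))) $ k))" for l
        unfolding lawN sum_subtractf[symmetric] right_diff_distrib sum_distrib_left by (simp add: mult_ac)
      have "(\<Sum>l\<in>UNIV. ?\<psi> (axis i 1) $ l * N \<kappa>' p $ k $ l) =
        (\<Sum>h\<in>UNIV. (\<Sum>l\<in>UNIV. ?\<psi> (axis i 1) $ l * ?\<psi>' (axis l 1) $ h) *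
          ((\<Sum>j\<in>UNIV. N \<kappa> p $ j $ h * ?\<rho> * ?\<psi> (axis j 1) $ k) - snd (snd (?J (0, axis h 1, 0))) $ k))"
        unfolding N1 sum_distrib_left sum_distrib_right by (subst sum.swap) (simp only: mult.assoc)
      also have "\<dots> = (\<Sum>j\<in>UNIV. N \<kappa> p $ j $ i * ?\<rho> * ?\<psi> (axis j 1) $ k) - snd (snd (?J (0, axis i 1, 0))) $ k"
        unfolding inv by (simp add: if_distrib[where f = "\<lambda>x. x * _"] cong: if_cong)
      also have "(\<Sum>j\<in>UNIV. N \<kappa> p $ j $ i * ?\<rho> * ?\<psi> (axis j 1) $ k) = ?\<rho> * ?\<psi> n $ k"
        unfolding linear_vec_expansion[OF \<psi>lin, of n] sum_distrib_left
        by (intro sum.cong) (auto simp: n_def)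
      finally have 2: "(\<Sum>l\<in>UNIV. ?\<psi> (axis i 1) $ l * N \<kappa>' p $ k $ l) =
        ?\<rho> * ?\<psi> n $ k - snd (snd (?J (0, axis i 1, 0))) $ k" .
      show ?thesis
        unfolding Vt adapted_comp.simps fs 1 2 by simp
    qed (use assms(4) fs Sp in auto)
  next
    case (Vt i)
    have "fst (E b \<kappa>' p) = 0" "fst (snd (E b \<kappa>' p)) = 0"
      by (simp_all add: adapted_frame_def Vt J \<sigma>0 linear_0[OF \<psi>lin])
    then show ?thesis using assms(4) Vt by (cases a) auto
  qed
qed

text \<open>The one of the projections \<open>h\<^bsub>\<real>\<^esub>\<close>, \<open>h\<^bsub>M\<^esub>\<close> and \<open>v\<close> onto the summand that contains \<open>e\<^sub>b\<close>.\<close>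

fun proj_kind :: "'n index \<Rightarrow> ('m, 'n) vfield \<Rightarrow> ('m, 'n) vfield" where
  "proj_kind Tm = proj_hR M N"
| "proj_kind (Sp i) = proj_hM M N"
| "proj_kind (Vt i) = proj_v M N"

lemma proj_kind_sum:
  "proj_kind b Y \<kappa>' p =
    (\<Sum>a\<in>same_kind b. adapted_comp M N \<kappa>' a p (Y \<kappa>' p) *\<^sub>R basis_vec M N \<kappa>' a p)"
  by (cases b) (simp_all add: proj_hR_def proj_hM_def proj_v_def sum_range_Sp sum_range_Vt)

text \<open>The projections are computed with the adapted basis of whichever chart the components refer to.
  That they fix the frame of \<open>\<kappa>\<close> in every chart is the content of \<open>frame_kind\<close>.\<close>

lemma proj_frame:
  assumes "\<kappa>' \<in> jet_charts A" "p \<in> Dom" "p \<in> jet_dom A \<kappa>'"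
  shows "proj_kind b (E b) \<kappa>' p = E b \<kappa>' p"
proof -
  have "proj_kind b (E b) \<kappa>' p =
      (\<Sum>a\<in>UNIV. adapted_comp M N \<kappa>' a p (E b \<kappa>' p) *\<^sub>R basis_vec M N \<kappa>' a p)"
    unfolding proj_kind_sum by (rule sum_same_kind) (simp add: frame_kind[OF assms])
  then show ?thesis using adapted_decomposition_sum[of "E b \<kappa>' p" M N \<kappa>' p] by simp
qed

section \<open>The connection in the adapted frame\<close>

lemma connection: "linear_connection A nab"
  using gamma_linear by (simp add: gamma_linear_connection_def)

lemma nab_vector_field:
  "vector_field A Dom X \<Longrightarrow> vector_field A Dom Y \<Longrightarrow> vector_field A Dom (nab Dom X Y)"
  using connection jet_open_dom[OF chart] unfolding linear_connection_def by blast

lemma nab_add: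
  assumes "vector_field A Dom X" "vector_field A Dom X'" "vector_field A Dom Y" "p \<in> Dom"
  shows "nab Dom (vf_add X X') Y \<kappa> p = nab Dom X Y \<kappa> p + nab Dom X' Y \<kappa> p"
    "nab Dom Y (vf_add X X') \<kappa> p = nab Dom Y X \<kappa> p + nab Dom Y X' \<kappa> p"
proof -
  have h: "vf_eq A Dom (nab Dom (vf_add X X') Y) (vf_add (nab Dom X Y) (nab Dom X' Y)) \<and>
        vf_eq A Dom (nab Dom Y (vf_add X X')) (vf_add (nab Dom Y X) (nab Dom Y X'))"
    using connection jet_open_dom[OF chart] assms unfolding linear_connection_def by blast
  then show "nab Dom (vf_add X X') Y \<kappa> p = nab Dom X Y \<kappa> p + nab Dom X' Y \<kappa> p"
    "nab Dom Y (vf_add X X') \<kappa> p = nab Dom Y X \<kappa> p + nab Dom Y X' \<kappa> p"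
    using vf_eqD[OF conjunct1[OF h] assms(4)] vf_eqD[OF conjunct2[OF h] assms(4)]
    by (simp_all add: vf_add_def)
qed

lemma nab_scale:
  assumes "smooth f" "vector_field A Dom X" "vector_field A Dom Y" "p \<in> Dom"
  shows "nab Dom (vf_scale f X) Y \<kappa> p = f p *\<^sub>R nab Dom X Y \<kappa> p"
proof -
  have "vf_eq A Dom (nab Dom (vf_scale f X) Y) (vf_scale f (nab Dom X Y))"
    using connection jet_open_dom[OF chart] assms(2,3) smooth_function[OF assms(1)] unfolding linear_connection_def by blast
  from vf_eqD[OF this assms(4)] show ?thesis by (simp add: vf_scale_def)
qed

lemma nab_leibniz:
  assumes "smooth f" "vector_field A Dom X" "vector_field A Dom Y" "p \<in> Dom"
  shows "nab Dom X (vf_scale f Y) \<kappa> p =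
    dir_deriv A \<kappa> f p (X \<kappa> p) *\<^sub>R Y \<kappa> p + f p *\<^sub>R nab Dom X Y \<kappa> p"
proof -
  have "vf_eq A Dom (nab Dom X (vf_scale f Y))
     (\<lambda>\<kappa> p. dir_deriv A \<kappa> f p (X \<kappa> p) *\<^sub>R Y \<kappa> p + f p *\<^sub>R nab Dom X Y \<kappa> p)"
    using connection jet_open_dom[OF chart] assms(2,3) smooth_function[OF assms(1)] unfolding linear_connection_def by blast
  from vf_eqD[OF this assms(4)] show ?thesis .
qed

lemma nab_cong:
  assumes "vector_field A Dom X" "vector_field A Dom Y" "vector_field A Dom X'" "vector_field A Dom Y'"
    "\<And>q. q \<in> Dom \<Longrightarrow> X \<kappa> q = X' \<kappa> q" "\<And>q. q \<in> Dom \<Longrightarrow> Y \<kappa> q = Y' \<kappa> q" "p \<in> Dom"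
  shows "nab Dom X Y \<kappa> p = nab Dom X' Y' \<kappa> p"
proof -
  have "vf_eq A Dom X X'" "vf_eq A Dom Y Y'" using assms by (auto intro!: vf_eqI)
  then have "vf_eq A Dom (nab Dom X Y) (nab Dom X' Y')"
    using connection jet_open_dom[OF chart] assms(1-4) unfolding linear_connection_def by blast
  then show ?thesis by (rule vf_eqD[OF _ assms(7)])
qed

text \<open>Partial sums of the expansion of a vector field in the frame, for inductions that use the
  additivity of the connection.\<close>

definition combination :: "('n index \<Rightarrow> 'm jet \<Rightarrow> real) \<Rightarrow> 'n index set \<Rightarrow> ('m, 'n) vfield" where
  "combination f I = (\<lambda>\<kappa>' p. \<Sum>a\<in>I. f a p *\<^sub>R E a \<kappa>' p)"

lemma combination_insert:
  "finite I \<Longrightarrow> a \<notin> I \<Longrightarrow> combination f (insert a I) = vf_add (vf_scale (f a) (E a)) (combination f I)"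
  by (simp add: combination_def vf_add_def vf_scale_def)

text \<open>The zero field is a multiple of a frame field, so the connection treats it by the rules for
  multiples.\<close>

lemma combination_empty: "combination f {} = vf_scale (\<lambda>p. 0) (E Tm)"
  by (simp add: combination_def vf_scale_def)

lemma combination_vector_field:
  assumes "\<And>a. smooth (f a)" "finite I"
  shows "vector_field A Dom (combination f I)"
  using assms(2)
proof induct
  case empty
  show ?case unfolding combination_empty by (rule vector_field_scale[OF smooth_const frame_vector_field])
next
  case (insert a I)
  then show ?case unfolding combination_insert[OF insert(1,2)]
    by (intro vector_field_add vector_field_scale assms frame_vector_field)
qed

lemma nab_combination_right:
  assumes "\<And>a. smooth (f a)" "finite I" "vector_field A Dom X" "p \<in> Dom"
  shows "nab Dom X (combination f I) \<kappa> p =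
    (\<Sum>a\<in>I. dir_deriv A \<kappa> (f a) p (X \<kappa> p) *\<^sub>R e a p + f a p *\<^sub>R nab Dom X (E a) \<kappa> p)"
  using assms(2)
proof induct
  case empty
  show ?case unfolding combination_empty nab_leibniz[OF smooth_const assms(3) frame_vector_field assms(4)]
    by (simp add: dir_deriv_def o_def)
next
  case (insert a I)
  then show ?case unfolding combination_insert[OF insert(1,2)]
    by (simp add: nab_add(2)[OF vector_field_scale[OF assms(1) frame_vector_field]
          combination_vector_field[OF assms(1) insert(1)] assms(3,4)]
        nab_leibniz[OF assms(1,3) frame_vector_field assms(4)] frame_chart assms(4))
qed

lemma nab_combination_left:
  assumes "\<And>a. smooth (f a)" "finite I" "vector_field A Dom Y" "p \<in> Dom"
  shows "nab Dom (combination f I) Y \<kappa> p = (\<Sum>a\<in>I. f a p *\<^sub>R nab Dom (E a) Y \<kappa> p)"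
  using assms(2)
proof induct
  case empty
  show ?case unfolding combination_empty nab_scale[OF smooth_const frame_vector_field assms(3,4)]
    by simp
next
  case (insert a I)
  then show ?case unfolding combination_insert[OF insert(1,2)]
    by (simp add: nab_add(1)[OF vector_field_scale[OF assms(1) frame_vector_field]
          combination_vector_field[OF assms(1) insert(1)] assms(3,4)]
        nab_scale[OF assms(1) frame_vector_field assms(3,4)])
qed

lemma combination_comp:
  assumes "p \<in> Dom"
  shows "combination (\<lambda>a q. cmp a q (X \<kappa> q)) UNIV \<kappa> p = X \<kappa> p"
  using adapted_decomposition_sum[of "X \<kappa> p" M N \<kappa> p] by (simp add: combination_def frame_chart assms)

lemma comp_nab_right:
  assumes "vector_field A Dom X" "vector_field A Dom Y" "p \<in> Dom"
  shows "cmp a p (nab Dom X Y \<kappa> p) = dir_deriv A \<kappa> (\<lambda>q. cmp a q (Y \<kappa> q)) p (X \<kappa> p)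
    + (\<Sum>b\<in>UNIV. cmp b p (Y \<kappa> p) * cmp a p (nab Dom X (E b) \<kappa> p))"
proof -
  let ?f = "\<lambda>a q. cmp a q (Y \<kappa> q)"
  have f: "smooth (?f a)" for a by (rule comp_smooth[OF vector_field_smooth[OF assms(2)]])
  have "nab Dom X Y \<kappa> p = nab Dom X (combination ?f UNIV) \<kappa> p"
    by (rule nab_cong[OF assms(1,2,1) combination_vector_field[OF f finite_index] refl _ assms(3)])
      (rule combination_comp[symmetric])
  then show ?thesis
    by (simp add: nab_combination_right[OF f finite_index assms(1,3)] adapted_comp_sum adapted_comp_linear
      adapted_comp_basis sum.distrib if_distrib[where f = "\<lambda>x. _ * x"] finite_index cong: if_cong)
qed

lemma comp_nab_left:
  assumes "vector_field A Dom X" "vector_field A Dom Y" "p \<in> Dom"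
  shows "cmp a p (nab Dom X Y \<kappa> p) = (\<Sum>b\<in>UNIV. cmp b p (X \<kappa> p) * cmp a p (nab Dom (E b) Y \<kappa> p))"
proof -
  let ?f = "\<lambda>a q. cmp a q (X \<kappa> q)"
  have f: "smooth (?f a)" for a by (rule comp_smooth[OF vector_field_smooth[OF assms(1)]])
  have "nab Dom X Y \<kappa> p = nab Dom (combination ?f UNIV) Y \<kappa> p"
    by (rule nab_cong[OF assms(1,2) combination_vector_field[OF f finite_index] assms(2) _ refl assms(3)])
      (rule combination_comp[symmetric])
  then show ?thesis
    by (simp add: nab_combination_left[OF f finite_index assms(2,3)] adapted_comp_sum adapted_comp_linear)
qed

lemma C_smooth: "smooth (C a b d)"
  unfolding conn_coef_def[abs_def]
  by (rule comp_smooth[OF vector_field_smooth[OF nab_vector_field[OF frame_vector_field frame_vector_field]]])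

text \<open>Let \<open>h\<close> be the projection that fixes \<open>e\<^sub>b\<close>. Since the connection commutes with \<open>h\<close>, the derivatives of
  \<open>e\<^sub>b\<close> are fixed by \<open>h\<close> as well and have components of the kind of \<open>b\<close> only.\<close>

lemma C_kind:
  assumes "p \<in> Dom" "a \<notin> same_kind b"
  shows "C a b d p = 0"
proof -
  have vf: "vector_field A Dom (proj_kind b (E b))"
  proof (rule vector_fieldI)
    show "smooth (proj_kind b (E b) \<kappa>)"
      by (rule smooth_cong[OF vector_field_smooth[OF frame_vector_field[of b]]])
        (simp add: proj_frame[OF chart])
    show "proj_kind b (E b) \<kappa>' q = jac A \<kappa> \<kappa>' q (proj_kind b (E b) \<kappa> q)"
      if "\<kappa>' \<in> jet_charts A" "q \<in> Dom" "q \<in> jet_dom A \<kappa>'" for \<kappa>' q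
      using proj_frame[OF that] proj_frame[OF chart that(2,2)]
        vector_field_chart[OF frame_vector_field that(2,1,3)] by simp
  qed
  have "proj_kind b \<in> {proj_hR M N, proj_hM M N, proj_v M N}" by (cases b) auto
  then have "vf_eq A Dom (nab Dom (E d) (proj_kind b (E b))) (proj_kind b (nab Dom (E d) (E b)))"
    using gamma_linear jet_open_dom[OF chart] frame_vector_field unfolding gamma_linear_connection_def by blast
  then have "nab Dom (E d) (proj_kind b (E b)) \<kappa> p = proj_kind b (nab Dom (E d) (E b)) \<kappa> p"
    by (rule vf_eqD[OF _ assms(1)])
  moreover have "nab Dom (E d) (E b) \<kappa> p = nab Dom (E d) (proj_kind b (E b)) \<kappa> p"
    by (rule nab_cong[OF frame_vector_field frame_vector_field frame_vector_field vf refl _ assms(1)])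
      (simp add: proj_frame[OF chart])
  ultimately have "C a b d p = cmp a p (proj_kind b (nab Dom (E d) (E b)) \<kappa> p)"
    by (simp add: conn_coef_def)
  also have "\<dots> = 0"
    unfolding proj_kind_sum adapted_comp_sum adapted_comp_linear adapted_comp_basis
    using assms(2) by (intro sum.neutral) auto
  finally show ?thesis .
qed

end

section \<open>Directional derivatives of functions\<close>

context jet_chart begin

lemma dir_deriv_cong:
  assumes "p \<in> Dom" "\<And>q. q \<in> Dom \<Longrightarrow> f q = g q"
  shows "dir_deriv A \<kappa> f p v = dir_deriv A \<kappa> g p v"
  unfolding dir_deriv_def
proof (rule fun_cong[OF frechet_derivative_cong_open[OF img_open coord_in_img[OF assms(1)]]])
  show "(f \<circ> jet_point A \<kappa>) z = (g \<circ> jet_point A \<kappa>) z" if "z \<in> img" for z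
    using assms(2)[OF point_in_dom[OF that]] by simp
qed

lemma dir_deriv_const: "dir_deriv A \<kappa> (\<lambda>q. c) p v = 0"
  by (simp add: dir_deriv_def o_def)

lemma dir_deriv_vanishing:
  "p \<in> Dom \<Longrightarrow> (\<And>q. q \<in> Dom \<Longrightarrow> f q = 0) \<Longrightarrow> dir_deriv A \<kappa> f p v = 0"
  using dir_deriv_cong[of p f "\<lambda>q. 0"] dir_deriv_const by metis

lemma dir_deriv_add:
  assumes "smooth f" "smooth g" "p \<in> Dom"
  shows "dir_deriv A \<kappa> (\<lambda>q. f q + g q) p v = dir_deriv A \<kappa> f p v + dir_deriv A \<kappa> g p v"
  using frechet_derivative_add[OF smooth_differentiable[OF assms(1,3)] smooth_differentiable[OF assms(2,3)]]
  by (simp add: dir_deriv_def o_def)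

lemma dir_deriv_linear_comp:
  fixes L :: "'b::euclidean_space \<Rightarrow> 'c::real_normed_vector"
  assumes "linear L" "smooth f" "p \<in> Dom"
  shows "dir_deriv A \<kappa> (\<lambda>q. L (f q)) p v = L (dir_deriv A \<kappa> f p v)"
  using frechet_derivative_bounded_linear[OF _ smooth_differentiable[OF assms(2,3)], of L] assms(1)
  by (simp add: dir_deriv_def o_def linear_conv_bounded_linear)

lemma dir_deriv_mult:
  fixes f g :: "'m jet \<Rightarrow> real"
  assumes "smooth f" "smooth g" "p \<in> Dom"
  shows "dir_deriv A \<kappa> (\<lambda>q. f q * g q) p v = f p * dir_deriv A \<kappa> g p v + dir_deriv A \<kappa> f p v * g p"
  using frechet_derivative_bilinear[OF bounded_bilinear_mult
    smooth_differentiable[OF assms(1,3)] smooth_differentiable[OF assms(2,3)]]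
  by (simp add: dir_deriv_def o_def jet_point_coord[OF chart assms(3)])

lemma dir_deriv_sum:
  assumes "\<And>i. i \<in> I \<Longrightarrow> smooth (f i)" "p \<in> Dom"
  shows "dir_deriv A \<kappa> (\<lambda>q. \<Sum>i\<in>I. f i q) p v = (\<Sum>i\<in>I. dir_deriv A \<kappa> (f i) p v)"
  using frechet_derivative_sum[of I "\<lambda>i. f i \<circ> jet_point A \<kappa>" "jet_coord \<kappa> p" v,
    OF smooth_differentiable[OF assms(1) assms(2)]]
  by (simp add: dir_deriv_def o_def)

lemma dir_deriv_vec_linear:
  assumes "smooth f" "p \<in> Dom"
  shows "dir_deriv A \<kappa> f p (u + v) = dir_deriv A \<kappa> f p u + dir_deriv A \<kappa> f p v"
    "dir_deriv A \<kappa> f p (r *\<^sub>R u) = r *\<^sub>R dir_deriv A \<kappa> f p u"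
    "dir_deriv A \<kappa> f p (u - v) = dir_deriv A \<kappa> f p u - dir_deriv A \<kappa> f p v"
    "dir_deriv A \<kappa> f p (sum h I) = (\<Sum>i\<in>I. dir_deriv A \<kappa> f p (h i))"
  unfolding dir_deriv_def frechet_derivative_apply_linear[OF smooth_differentiable[OF assms]] by (rule refl)+

text \<open>The commutator of two derivations is the derivation along the bracket; the second derivatives of
  \<open>f\<close> cancel by symmetry.\<close>

lemma dir_deriv_commutator:
  fixes f :: "'m jet \<Rightarrow> real"
  assumes "smooth f" "smooth u" "smooth v" "p \<in> Dom"
  shows "dir_deriv A \<kappa> (\<lambda>q. dir_deriv A \<kappa> f q (v q)) p (u p) - dir_deriv A \<kappa> (\<lambda>q. dir_deriv A \<kappa> f q (u q)) p (v p)
    = dir_deriv A \<kappa> f p (dir_deriv A \<kappa> v p (u p) - dir_deriv A \<kappa> u p (v p))"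
proof -
  let ?F = "f \<circ> jet_point A \<kappa>" and ?z = "jet_coord \<kappa> p"
  have F: "smooth_on img ?F" using assms(1) by (simp add: smooth_in_chart_def)
  have *: "dir_deriv A \<kappa> (\<lambda>q. dir_deriv A \<kappa> f q (w q)) p h =
      frechet_derivative (\<lambda>z. frechet_derivative ?F (at z) (w p)) (at ?z) h
      + dir_deriv A \<kappa> f p (dir_deriv A \<kappa> w p h)" if w: "smooth w" for w h
  proof -
    have "dir_deriv A \<kappa> (\<lambda>q. dir_deriv A \<kappa> f q (w q)) p h =
      frechet_derivative (\<lambda>z. frechet_derivative ?F (at z) ((w \<circ> jet_point A \<kappa>) z)) (at ?z) h"
      unfolding dir_deriv_def
      by (rule fun_cong[OF frechet_derivative_cong_open[OF img_open coord_in_img[OF assms(4)]]])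
        (simp add: coord_point)
    then show ?thesis
      using frechet_derivative_frechet_apply[OF img_open coord_in_img[OF assms(4)] F smooth_differentiable[OF w assms(4)]]
      by (simp add: dir_deriv_def jet_point_coord[OF chart assms(4)])
  qed
  show ?thesis
    unfolding *[OF assms(2)] *[OF assms(3)] dir_deriv_vec_linear[OF assms(1,4)]
    using symmetric_second_derivative[OF img_open coord_in_img[OF assms(4)] F] by simp
qed

end

section \<open>Curvature in the adapted frame\<close>

context gamma_connection_chart begin

abbreviation "bracket_coef d c r p \<equiv> cmp r p (lie_bracket A (E d) (E c) \<kappa> p)"

lemma lie_bracket_frame:
  assumes "p \<in> Dom"
  shows "lie_bracket A (E d) (E c) \<kappa> p = dir_deriv A \<kappa> (e c) p (e d p) - dir_deriv A \<kappa> (e d) p (e c p)"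
  using dir_deriv_cong[OF assms, of "E _ \<kappa>" "e _"] frame_chart
  by (simp add: lie_bracket_def frame_chart[OF assms])

lemma adapted_deriv_commutator:
  assumes "smooth f" "p \<in> Dom"
  shows "\<delta> d (\<delta> c f) p - \<delta> c (\<delta> d f) p = (\<Sum>r\<in>UNIV. bracket_coef d c r p * \<delta> r f p)"
proof -
  have "\<delta> d (\<delta> c f) p - \<delta> c (\<delta> d f) p = dir_deriv A \<kappa> f p (lie_bracket A (E d) (E c) \<kappa> p)"
    unfolding adapted_deriv_def[abs_def] lie_bracket_frame[OF assms(2)]
    by (rule dir_deriv_commutator[OF assms(1) basis_smooth basis_smooth assms(2)])
  also have "\<dots> = dir_deriv A \<kappa> f p (\<Sum>r\<in>UNIV. bracket_coef d c r p *\<^sub>R e r p)"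
    using adapted_decomposition_sum[of "lie_bracket A (E d) (E c) \<kappa> p" M N \<kappa> p] by simp
  also have "\<dots> = (\<Sum>r\<in>UNIV. bracket_coef d c r p * \<delta> r f p)"
    by (simp add: dir_deriv_vec_linear[OF assms] adapted_deriv_def)
  finally show ?thesis .
qed

text \<open>The inner derivatives in \<open>\<^bold>R(e\<^sub>d, e\<^sub>c) e\<^sub>b\<close> are expanded in the frame; the Leibniz rule then gives the
  derivatives of the coefficients, and linearity in the direction takes care of the bracket.\<close>

lemma curv_coef_formula:
  assumes p: "p \<in> Dom"
  shows "curv_coef A M N nab \<kappa> a b c d p =
    \<delta> d (C a b c) p - \<delta> c (C a b d) p
    + (\<Sum>r\<in>UNIV. C r b c p * C a r d p) - (\<Sum>r\<in>UNIV. C r b d p * C a r c p)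
    - (\<Sum>r\<in>UNIV. bracket_coef d c r p * C a b r p)"
proof -
  have 1: "cmp a p (nab Dom (E d) (nab Dom (E c) (E b)) \<kappa> p) =
      \<delta> d (C a b c) p + (\<Sum>r\<in>UNIV. C r b c p * C a r d p)" for c d
    using comp_nab_right[OF frame_vector_field[of d] nab_vector_field[OF frame_vector_field[of c] frame_vector_field[of b]] p, of a]
    by (simp add: conn_coef_def[abs_def] adapted_deriv_def frame_chart[OF p])
  have 2: "cmp a p (nab Dom (lie_bracket A (E d) (E c)) (E b) \<kappa> p) =
      (\<Sum>r\<in>UNIV. bracket_coef d c r p * C a b r p)"
    using comp_nab_left[OF vector_field_lie_bracket[OF frame_vector_field[of d] frame_vector_field[of c]] frame_vector_field[of b] p, of a]
    by (simp add: conn_coef_def)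
  show ?thesis
    unfolding curv_coef_def curvature_def vf_diff_def adapted_comp_linear 1 2 by simp
qed

lemma curv_coef_kind:
  assumes p: "p \<in> Dom" and a: "a \<notin> same_kind b"
  shows "curv_coef A M N nab \<kappa> a b c d p = 0"
proof -
  have "C r b c p * C a r d p = 0" for r c d
    using C_kind[OF p, of r b c] C_kind[OF p, of a r d] a same_kind_trans by fastforce
  then have z: "(\<Sum>r\<in>UNIV. C r b c p * C a r d p) = 0" for c d
    by (rule sum.neutral[OF ballI])
  have "\<delta> d (C a b c) p = 0" for c d
    unfolding adapted_deriv_def by (rule dir_deriv_vanishing[OF p C_kind[OF _ a]])
  then show ?thesis
    unfolding curv_coef_formula[OF p] by (simp add: z C_kind[OF p a])
qed

section \<open>Brackets of the adapted frame\<close>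

text \<open>The time and space components of the frame fields are constant.\<close>

lemma bracket_coef_horizontal:
  assumes p: "p \<in> Dom"
  shows "bracket_coef d c Tm p = 0" "bracket_coef d c (Sp i) p = 0"
proof -
  have 1: "linear (\<lambda>v :: 'n coords. fst v)" "linear (\<lambda>v :: 'n coords. fst (snd v))"
    by (auto intro!: linearI)
  have "fst (dir_deriv A \<kappa> (e c) p h) = 0" for c h
    unfolding dir_deriv_linear_comp[OF 1(1) basis_smooth p, symmetric]
    by (cases c) (simp_all add: dir_deriv_const)
  moreover have "fst (snd (dir_deriv A \<kappa> (e c) p h)) = 0" for c h
    unfolding dir_deriv_linear_comp[OF 1(2) basis_smooth p, symmetric]
    by (cases c) (simp_all add: dir_deriv_const)
  ultimately show "bracket_coef d c Tm p = 0" "bracket_coef d c (Sp i) p = 0"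
    by (simp_all add: lie_bracket_frame[OF p])
qed

text \<open>The nonconstant part of the vertical components of \<open>e\<^sub>c\<close>, up to the sign. Those of the
  \<open>\<partial>/\<partial>y\<^sub>1\<^sup>i\<close> are constant and do not contribute to derivatives, hence the value \<open>0\<close>.\<close>

fun vertical_part :: "'n index \<Rightarrow> 'n \<Rightarrow> 'm jet \<Rightarrow> real" where
  "vertical_part Tm r p = M \<kappa> p $ r"
| "vertical_part (Sp i) r p = N \<kappa> p $ r $ i"
| "vertical_part (Vt i) r p = 0"

lemma vertical_part_smooth: "smooth (vertical_part c r)"
proof (cases c)
  case Tm
  show ?thesis by (rule smooth_cong[OF M_comp_smooth[of r]]) (simp add: Tm)
next
  case (Sp i)
  show ?thesis by (rule smooth_cong[OF N_comp_smooth[of r i]]) (simp add: Sp)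
next
  case (Vt i)
  show ?thesis by (rule smooth_cong[OF smooth_const[of 0]]) (simp add: Vt)
qed

lemma bracket_coef_vertical:
  assumes p: "p \<in> Dom"
  shows "bracket_coef d c (Vt r) p = \<delta> c (vertical_part d r) p - \<delta> d (vertical_part c r) p"
proof -
  have 1: "linear (\<lambda>v :: 'n coords. snd (snd v) $ r)"
    by (auto intro!: linearI)
  have neg: "dir_deriv A \<kappa> (\<lambda>q. - f q) p h = - dir_deriv A \<kappa> f p h" if "smooth f" for f :: "'m jet \<Rightarrow> real" and h
    by (rule dir_deriv_linear_comp[OF _ that p]) (auto intro!: linearI)
  have third: "snd (snd (dir_deriv A \<kappa> (e c) p h)) $ r = - dir_deriv A \<kappa> (vertical_part c r) p h" for c h
    unfolding dir_deriv_linear_comp[OF 1 basis_smooth p, symmetric] neg[OF vertical_part_smooth, symmetric]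
  proof (cases c)
    case (Vt i)
    then show "dir_deriv A \<kappa> (\<lambda>q. snd (snd (e c q)) $ r) p h = dir_deriv A \<kappa> (\<lambda>q. - vertical_part c r q) p h"
      by (simp add: dir_deriv_const)
  qed simp_all
  have "bracket_coef d c (Vt r) p = snd (snd (lie_bracket A (E d) (E c) \<kappa> p)) $ r"
    using bracket_coef_horizontal[OF p] by simp
  then show ?thesis
    by (simp add: lie_bracket_frame[OF p] adapted_deriv_def third)
qed

section \<open>The Ricci identities\<close>

text \<open>The coefficient of \<open>e\<^sub>r\<close> in the torsion
  \<open>\<nabla>\<^bsub>d\<^esub> e\<^sub>c - \<nabla>\<^bsub>c\<^esub> e\<^sub>d - [e\<^sub>d, e\<^sub>c]\<close>.\<close>

definition torsion :: "'n index \<Rightarrow> 'n index \<Rightarrow> 'n index \<Rightarrow> 'm jet \<Rightarrow> real" where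
  "torsion r c d p = C r c d p - C r d c p - bracket_coef d c r p"

lemma torsion_horizontal:
  assumes p: "p \<in> Dom"
  shows "torsion Tm Tm (Sp k) p = tors_Tbar_1 A M N nab \<kappa> k p"
    "torsion Tm Tm (Vt k) p = C Tm Tm (Vt k) p"
    "torsion Tm (Sp j) (Sp k) p = 0" "torsion Tm (Sp j) (Vt k) p = 0" "torsion Tm (Vt j) (Vt k) p = 0"
    "torsion (Sp r) Tm (Sp k) p = tors_T_1 A M N nab \<kappa> r k p"
    "torsion (Sp r) Tm (Vt k) p = 0"
    "torsion (Sp r) (Sp j) (Sp k) p = tors_T A M N nab \<kappa> r j k p"
    "torsion (Sp r) (Sp j) (Vt k) p = C (Sp r) (Sp j) (Vt k) p"
    "torsion (Sp r) (Vt j) (Vt k) p = 0"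
  by (simp_all add: torsion_def bracket_coef_horizontal[OF p] C_kind[OF p] image_iff
      tors_Tbar_1_def tors_T_1_def tors_T_def del: adapted_comp.simps)

lemma torsion_vertical:
  assumes p: "p \<in> Dom"
  shows "torsion (Vt r) Tm (Sp k) p = tors_R_1 A M N \<kappa> r k p"
    "torsion (Vt r) Tm (Vt k) p = tors_P_1 A M N nab \<kappa> r k p"
    "torsion (Vt r) (Sp j) (Sp k) p = tors_R A M N \<kappa> r j k p"
    "torsion (Vt r) (Sp j) (Vt k) p = tors_P A M N nab \<kappa> r j k p"
    "torsion (Vt r) (Vt j) (Vt k) p = tors_S A M N nab \<kappa> r j k p"
proof -
  have v: "\<delta> d (vertical_part Tm r) p = \<delta> d (\<lambda>q. M \<kappa> q $ r) p"
    "\<delta> d (vertical_part (Sp i) r) p = \<delta> d (\<lambda>q. N \<kappa> q $ r $ i) p"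
    "\<delta> d (vertical_part (Vt i) r) p = 0" for d i
    unfolding adapted_deriv_def
    by (rule dir_deriv_cong[OF p], simp)+ (rule dir_deriv_vanishing[OF p], simp)
  show "torsion (Vt r) Tm (Sp k) p = tors_R_1 A M N \<kappa> r k p"
    "torsion (Vt r) Tm (Vt k) p = tors_P_1 A M N nab \<kappa> r k p"
    "torsion (Vt r) (Sp j) (Sp k) p = tors_R A M N \<kappa> r j k p"
    "torsion (Vt r) (Sp j) (Vt k) p = tors_P A M N nab \<kappa> r j k p"
    "torsion (Vt r) (Vt j) (Vt k) p = tors_S A M N nab \<kappa> r j k p"
    by (simp_all add: torsion_def bracket_coef_vertical[OF p] C_kind[OF p] image_iff v
        tors_R_1_def tors_R_def tors_P_1_def tors_P_def tors_S_def del: adapted_comp.simps)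
qed

text \<open>Summing over all indices instead of those of one kind adds zeros by \<open>C_kind\<close>. Without the
  restriction to kinds, the Ricci identity is the one for a linear connection in an arbitrary frame.\<close>

lemma cov_deriv_vector:
  assumes "p \<in> Dom"
  shows "cov_deriv A M N nab \<kappa> D [a] [c] p =
    \<delta> c (D [a] []) p + (\<Sum>r\<in>UNIV. D [r] [] p * C a r c p)"
proof -
  have "(\<Sum>r\<in>same_kind a. D [r] [] p * C a r c p) = (\<Sum>r\<in>UNIV. D [r] [] p * C a r c p)"
    by (rule sum_same_kind) (simp add: C_kind[OF assms] same_kind_sym)
  then show ?thesis by (simp add: cov_deriv_def)
qed

lemma cov_deriv_vector_covector:
  assumes "p \<in> Dom"
  shows "cov_deriv A M N nab \<kappa> D [a] [c, d] p =
    \<delta> d (D [a] [c]) p + (\<Sum>r\<in>UNIV. D [r] [c] p * C a r d p) - (\<Sum>r\<in>UNIV. D [a] [r] p * C r c d p)"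
proof -
  have 1: "(\<Sum>r\<in>same_kind a. D [r] [c] p * C a r d p) = (\<Sum>r\<in>UNIV. D [r] [c] p * C a r d p)"
    by (rule sum_same_kind) (simp add: C_kind[OF assms] same_kind_sym)
  have 2: "(\<Sum>r\<in>same_kind c. D [a] [r] p * C r c d p) = (\<Sum>r\<in>UNIV. D [a] [r] p * C r c d p)"
    by (rule sum_same_kind) (simp add: C_kind[OF assms])
  show ?thesis by (simp add: cov_deriv_def Let_def 1 2)
qed

text \<open>In \<open>X\<^bsup>a\<^esup>\<^bsub>;c;d\<^esub>\<close> the products of a derivative of \<open>X\<close> with a coefficient of the form \<open>C a r _\<close> are symmetric in
  \<open>c\<close> and \<open>d\<close>. The terms without derivatives of \<open>X\<close> form the curvature, up to the bracket term in
  \<open>curv_coef_formula\<close>. The latter combines with the commutator of the frame derivatives of \<open>X\<close> to the first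
  covariant derivative of \<open>X\<close> along the bracket, which is the last summand of the torsion.\<close>

lemma ricci_identity:
  assumes X: "vector_field A (jet_space A) X" and p: "p \<in> Dom"
  defines "X0 \<equiv> vf_dtensor M N \<kappa> X"
  defines "X1 \<equiv> cov_deriv A M N nab \<kappa> X0"
  defines "X2 \<equiv> cov_deriv A M N nab \<kappa> X1"
  shows "X2 [a] [c, d] p - X2 [a] [d, c] p =
    (\<Sum>b\<in>UNIV. X0 [b] [] p * curv_coef A M N nab \<kappa> a b c d p) - (\<Sum>r\<in>UNIV. X1 [a] [r] p * torsion r c d p)"
proof -
  define x where "x a q = cmp a q (X \<kappa> q)" for a q
  have "jet_space A \<inter> Dom = Dom \<inter> Dom" by (auto simp: jet_dom_def)
  moreover have "smooth_in_chart A \<kappa> (jet_space A) (X \<kappa>)"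
    using X chart unfolding vector_field_def by blast
  ultimately have sX: "smooth (X \<kappa>)" unfolding smooth_in_chart_def by simp
  have sx: "smooth (x a)" for a unfolding x_def[abs_def] by (rule comp_smooth[OF sX])
  have X0: "X0 [a] [] = x a" for a
    by (simp add: X0_def vf_dtensor_def x_def fun_eq_iff)
  have X1: "X1 [a] [c] q = \<delta> c (x a) q + (\<Sum>r\<in>UNIV. x r q * C a r c q)" if "q \<in> Dom" for a c q
    unfolding X1_def cov_deriv_vector[OF that] X0 ..
  have s\<delta>: "smooth (\<delta> c f)" if "smooth f" for c f
    unfolding adapted_deriv_def[abs_def] by (rule smooth_dir_deriv[OF that basis_smooth])
  have \<delta>X1: "\<delta> d (X1 [a] [c]) p = \<delta> d (\<delta> c (x a)) p +
      (\<Sum>r\<in>UNIV. x r p * \<delta> d (C a r c) p + \<delta> d (x r) p * C a r c p)" for a c d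
  proof -
    have "\<delta> d (X1 [a] [c]) p = dir_deriv A \<kappa> (\<lambda>q. \<delta> c (x a) q + (\<Sum>r\<in>UNIV. x r q * C a r c q)) p (e d p)"
      unfolding adapted_deriv_def by (rule dir_deriv_cong[OF p]) (simp add: X1 adapted_deriv_def)
    also have "\<dots> = \<delta> d (\<delta> c (x a)) p + (\<Sum>r\<in>UNIV. dir_deriv A \<kappa> (\<lambda>q. x r q * C a r c q) p (e d p))"
      using s\<delta>[OF sx] smooth_mult[OF sx C_smooth] p
      by (simp add: dir_deriv_add smooth_sum dir_deriv_sum adapted_deriv_def[of _ _ _ _ d])
    finally show ?thesis by (simp add: dir_deriv_mult[OF sx C_smooth p] adapted_deriv_def)
  qed
  have X2: "X2 [a] [c, d] p = \<delta> d (\<delta> c (x a)) p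
      + ((\<Sum>r\<in>UNIV. x r p * \<delta> d (C a r c) p) + (\<Sum>r\<in>UNIV. \<delta> d (x r) p * C a r c p))
      + ((\<Sum>r\<in>UNIV. \<delta> c (x r) p * C a r d p) + (\<Sum>b\<in>UNIV. x b p * (\<Sum>r\<in>UNIV. C r b c p * C a r d p)))
      - (\<Sum>r\<in>UNIV. X1 [a] [r] p * C r c d p)" for c d
  proof -
    have "(\<Sum>r\<in>UNIV. X1 [r] [c] p * C a r d p) = (\<Sum>r\<in>UNIV. \<delta> c (x r) p * C a r d p) +
        (\<Sum>r\<in>UNIV. \<Sum>b\<in>UNIV. x b p * C r b c p * C a r d p)"
      by (simp add: X1[OF p] distrib_right sum.distrib sum_distrib_right)
    also have "(\<Sum>r\<in>UNIV. \<Sum>b\<in>UNIV. x b p * C r b c p * C a r d p) =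
        (\<Sum>b\<in>UNIV. x b p * (\<Sum>r\<in>UNIV. C r b c p * C a r d p))"
      by (subst sum.swap) (simp add: sum_distrib_left mult.assoc)
    finally show ?thesis
      unfolding X2_def cov_deriv_vector_covector[OF p] \<delta>X1 by (simp add: sum.distrib)
  qed
  have R: "(\<Sum>b\<in>UNIV. x b p * curv_coef A M N nab \<kappa> a b c d p) =
      (\<Sum>b\<in>UNIV. x b p * \<delta> d (C a b c) p) - (\<Sum>b\<in>UNIV. x b p * \<delta> c (C a b d) p)
      + (\<Sum>b\<in>UNIV. x b p * (\<Sum>r\<in>UNIV. C r b c p * C a r d p))
      - (\<Sum>b\<in>UNIV. x b p * (\<Sum>r\<in>UNIV. C r b d p * C a r c p))
      - (\<Sum>b\<in>UNIV. x b p * (\<Sum>r\<in>UNIV. bracket_coef d c r p * C a b r p))"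
    by (simp add: curv_coef_formula[OF p] right_diff_distrib distrib_left sum.distrib sum_subtractf)
  have T: "(\<Sum>r\<in>UNIV. X1 [a] [r] p * torsion r c d p) =
      (\<Sum>r\<in>UNIV. X1 [a] [r] p * C r c d p) - (\<Sum>r\<in>UNIV. X1 [a] [r] p * C r d c p)
      - (\<Sum>r\<in>UNIV. bracket_coef d c r p * X1 [a] [r] p)"
    by (simp add: torsion_def right_diff_distrib sum_subtractf mult.commute)
  have "(\<Sum>r\<in>UNIV. bracket_coef d c r p * X1 [a] [r] p) = (\<Sum>r\<in>UNIV. bracket_coef d c r p * \<delta> r (x a) p)
      + (\<Sum>r\<in>UNIV. \<Sum>b\<in>UNIV. x b p * (bracket_coef d c r p * C a b r p))"
    by (simp add: X1[OF p] distrib_left sum.distrib sum_distrib_left mult.left_commute)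
  also have "(\<Sum>r\<in>UNIV. \<Sum>b\<in>UNIV. x b p * (bracket_coef d c r p * C a b r p)) =
      (\<Sum>b\<in>UNIV. x b p * (\<Sum>r\<in>UNIV. bracket_coef d c r p * C a b r p))"
    by (subst sum.swap) (simp add: sum_distrib_left)
  finally have B: "(\<Sum>r\<in>UNIV. bracket_coef d c r p * X1 [a] [r] p) = \<delta> d (\<delta> c (x a)) p - \<delta> c (\<delta> d (x a)) p
      + (\<Sum>b\<in>UNIV. x b p * (\<Sum>r\<in>UNIV. bracket_coef d c r p * C a b r p))"
    using adapted_deriv_commutator[OF sx p, of d c a] by simp
  show ?thesis unfolding X2 X0 R T B by simp
qed

lemma curvature_sum:
  assumes "p \<in> Dom"
  shows "(\<Sum>b\<in>UNIV. f b * curv_coef A M N nab \<kappa> Tm b c d p) = f Tm * curv_coef A M N nab \<kappa> Tm Tm c d p"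
    "(\<Sum>b\<in>UNIV. f b * curv_coef A M N nab \<kappa> (Sp i) b c d p) =
      (\<Sum>r\<in>UNIV. f (Sp r) * curv_coef A M N nab \<kappa> (Sp i) (Sp r) c d p)"
    "(\<Sum>b\<in>UNIV. f b * curv_coef A M N nab \<kappa> (Vt i) b c d p) =
      (\<Sum>r\<in>UNIV. f (Vt r) * curv_coef A M N nab \<kappa> (Vt i) (Vt r) c d p)"
  by (simp_all add: sum_index curv_coef_kind[OF assms] image_iff)

text \<open>Each pair of directions selects those torsion d-tensors that its Ricci identities contain.\<close>

lemma torsion_sum:
  assumes p: "p \<in> Dom"
  shows "(\<Sum>r\<in>UNIV. f r * torsion r Tm (Sp k) p) = f Tm * tors_Tbar_1 A M N nab \<kappa> k p
      + (\<Sum>r\<in>UNIV. f (Sp r) * tors_T_1 A M N nab \<kappa> r k p) + (\<Sum>r\<in>UNIV. f (Vt r) * tors_R_1 A M N \<kappa> r k p)"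
    "(\<Sum>r\<in>UNIV. f r * torsion r Tm (Vt k) p) = f Tm * C Tm Tm (Vt k) p
      + (\<Sum>r\<in>UNIV. f (Vt r) * tors_P_1 A M N nab \<kappa> r k p)"
    "(\<Sum>r\<in>UNIV. f r * torsion r (Sp j) (Sp k) p) = (\<Sum>r\<in>UNIV. f (Sp r) * tors_T A M N nab \<kappa> r j k p)
      + (\<Sum>r\<in>UNIV. f (Vt r) * tors_R A M N \<kappa> r j k p)"
    "(\<Sum>r\<in>UNIV. f r * torsion r (Sp j) (Vt k) p) = (\<Sum>r\<in>UNIV. f (Sp r) * C (Sp r) (Sp j) (Vt k) p)
      + (\<Sum>r\<in>UNIV. f (Vt r) * tors_P A M N nab \<kappa> r j k p)"
    "(\<Sum>r\<in>UNIV. f r * torsion r (Vt j) (Vt k) p) = (\<Sum>r\<in>UNIV. f (Vt r) * tors_S A M N nab \<kappa> r j k p)"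
  by (simp_all add: sum_index torsion_horizontal[OF p] torsion_vertical[OF p])

end

theorem theorem4p1:
  fixes A :: "('m::{t2_space, second_countable_topology}, real^'n) chart set"
    and M :: "('m, 'n) jet_chart \<Rightarrow> 'm jet \<Rightarrow> real^'n"
    and N :: "('m, 'n) jet_chart \<Rightarrow> 'm jet \<Rightarrow> real^'n^'n"
    and nab :: "'m jet set \<Rightarrow> ('m, 'n) vfield \<Rightarrow> ('m, 'n) vfield \<Rightarrow> ('m, 'n) vfield"
    and X :: "('m, 'n) vfield"
  assumes "smooth_atlas A"
    and "nonlinear_connection A M N"
    and "gamma_linear_connection A M N nab"
    and "vector_field A (jet_space A) X"
    and "\<kappa> \<in> jet_charts A" and "p \<in> jet_dom A \<kappa>"
  shows
    "let X0 = vf_dtensor M N \<kappa> X;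
         X1 = cov_deriv A M N nab \<kappa> X0;
         X2 = cov_deriv A M N nab \<kappa> X1;
         x = (\<lambda>a. X0 [a] [] p);
         D1 = (\<lambda>a c. X1 [a] [c] p);
         D2 = (\<lambda>a c d. X2 [a] [c, d] p);
         C = (\<lambda>a b d. conn_coef A M N nab \<kappa> a b d p);
         R = (\<lambda>a b c d. curv_coef A M N nab \<kappa> a b c d p);
         Tbar_1 = (\<lambda>k. tors_Tbar_1 A M N nab \<kappa> k p);
         T_1 = (\<lambda>r k. tors_T_1 A M N nab \<kappa> r k p);
         T = (\<lambda>r j k. tors_T A M N nab \<kappa> r j k p);
         S = (\<lambda>r j k. tors_S A M N nab \<kappa> r j k p);
         P_1 = (\<lambda>r k. tors_P_1 A M N nab \<kappa> r k p);
         P = (\<lambda>r j k. tors_P A M N nab \<kappa> r j k p);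
         RT_1 = (\<lambda>r k. tors_R_1 A M N \<kappa> r k p);
         RT = (\<lambda>r j k. tors_R A M N \<kappa> r j k p)
     in \<forall>i j k.
      D2 Tm Tm (Sp k) - D2 Tm (Sp k) Tm =
        x Tm * R Tm Tm Tm (Sp k)
        - D1 Tm Tm * Tbar_1 k
        - (\<Sum>r\<in>UNIV. D1 Tm (Sp r) * T_1 r k)
        - (\<Sum>r\<in>UNIV. D1 Tm (Vt r) * RT_1 r k) \<and>
      D2 Tm (Sp j) (Sp k) - D2 Tm (Sp k) (Sp j) =
        x Tm * R Tm Tm (Sp j) (Sp k)
        - (\<Sum>r\<in>UNIV. D1 Tm (Sp r) * T r j k)
        - (\<Sum>r\<in>UNIV. D1 Tm (Vt r) * RT r j k) \<and>
      D2 Tm Tm (Vt k) - D2 Tm (Vt k) Tm =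
        x Tm * R Tm Tm Tm (Vt k)
        - D1 Tm Tm * C Tm Tm (Vt k)
        - (\<Sum>r\<in>UNIV. D1 Tm (Vt r) * P_1 r k) \<and>
      D2 Tm (Sp j) (Vt k) - D2 Tm (Vt k) (Sp j) =
        x Tm * R Tm Tm (Sp j) (Vt k)
        - (\<Sum>r\<in>UNIV. D1 Tm (Sp r) * C (Sp r) (Sp j) (Vt k))
        - (\<Sum>r\<in>UNIV. D1 Tm (Vt r) * P r j k) \<and>
      D2 Tm (Vt j) (Vt k) - D2 Tm (Vt k) (Vt j) =
        x Tm * R Tm Tm (Vt j) (Vt k)
        - (\<Sum>r\<in>UNIV. D1 Tm (Vt r) * S r j k) \<and>
      D2 (Sp i) Tm (Sp k) - D2 (Sp i) (Sp k) Tm =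
        (\<Sum>r\<in>UNIV. x (Sp r) * R (Sp i) (Sp r) Tm (Sp k))
        - D1 (Sp i) Tm * Tbar_1 k
        - (\<Sum>r\<in>UNIV. D1 (Sp i) (Sp r) * T_1 r k)
        - (\<Sum>r\<in>UNIV. D1 (Sp i) (Vt r) * RT_1 r k) \<and>
      D2 (Sp i) (Sp j) (Sp k) - D2 (Sp i) (Sp k) (Sp j) =
        (\<Sum>r\<in>UNIV. x (Sp r) * R (Sp i) (Sp r) (Sp j) (Sp k))
        - (\<Sum>r\<in>UNIV. D1 (Sp i) (Sp r) * T r j k)
        - (\<Sum>r\<in>UNIV. D1 (Sp i) (Vt r) * RT r j k) \<and>
      D2 (Sp i) Tm (Vt k) - D2 (Sp i) (Vt k) Tm =
        (\<Sum>r\<in>UNIV. x (Sp r) * R (Sp i) (Sp r) Tm (Vt k))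
        - D1 (Sp i) Tm * C Tm Tm (Vt k)
        - (\<Sum>r\<in>UNIV. D1 (Sp i) (Vt r) * P_1 r k) \<and>
      D2 (Sp i) (Sp j) (Vt k) - D2 (Sp i) (Vt k) (Sp j) =
        (\<Sum>r\<in>UNIV. x (Sp r) * R (Sp i) (Sp r) (Sp j) (Vt k))
        - (\<Sum>r\<in>UNIV. D1 (Sp i) (Sp r) * C (Sp r) (Sp j) (Vt k))
        - (\<Sum>r\<in>UNIV. D1 (Sp i) (Vt r) * P r j k) \<and>
      D2 (Sp i) (Vt j) (Vt k) - D2 (Sp i) (Vt k) (Vt j) =
        (\<Sum>r\<in>UNIV. x (Sp r) * R (Sp i) (Sp r) (Vt j) (Vt k))
        - (\<Sum>r\<in>UNIV. D1 (Sp i) (Vt r) * S r j k) \<and>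
      D2 (Vt i) Tm (Sp k) - D2 (Vt i) (Sp k) Tm =
        (\<Sum>r\<in>UNIV. x (Vt r) * R (Vt i) (Vt r) Tm (Sp k))
        - D1 (Vt i) Tm * Tbar_1 k
        - (\<Sum>r\<in>UNIV. D1 (Vt i) (Sp r) * T_1 r k)
        - (\<Sum>r\<in>UNIV. D1 (Vt i) (Vt r) * RT_1 r k) \<and>
      D2 (Vt i) (Sp j) (Sp k) - D2 (Vt i) (Sp k) (Sp j) =
        (\<Sum>r\<in>UNIV. x (Vt r) * R (Vt i) (Vt r) (Sp j) (Sp k))
        - (\<Sum>r\<in>UNIV. D1 (Vt i) (Sp r) * T r j k)
        - (\<Sum>r\<in>UNIV. D1 (Vt i) (Vt r) * RT r j k) \<and>
      D2 (Vt i) Tm (Vt k) - D2 (Vt i) (Vt k) Tm =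
        (\<Sum>r\<in>UNIV. x (Vt r) * R (Vt i) (Vt r) Tm (Vt k))
        - D1 (Vt i) Tm * C Tm Tm (Vt k)
        - (\<Sum>r\<in>UNIV. D1 (Vt i) (Vt r) * P_1 r k) \<and>
      D2 (Vt i) (Sp j) (Vt k) - D2 (Vt i) (Vt k) (Sp j) =
        (\<Sum>r\<in>UNIV. x (Vt r) * R (Vt i) (Vt r) (Sp j) (Vt k))
        - (\<Sum>r\<in>UNIV. D1 (Vt i) (Sp r) * C (Sp r) (Sp j) (Vt k))
        - (\<Sum>r\<in>UNIV. D1 (Vt i) (Vt r) * P r j k) \<and>
      D2 (Vt i) (Vt j) (Vt k) - D2 (Vt i) (Vt k) (Vt j) =
        (\<Sum>r\<in>UNIV. x (Vt r) * R (Vt i) (Vt r) (Vt j) (Vt k))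
        - (\<Sum>r\<in>UNIV. D1 (Vt i) (Vt r) * S r j k)"
proof -
  interpret gamma_connection_chart A \<kappa> M N nab
    using assms(1-3,5) by unfold_locales
  show ?thesis
    unfolding Let_def ricci_identity[OF assms(4,6)] curvature_sum[OF assms(6)] torsion_sum[OF assms(6)]
    by (simp add: algebra_simps)
qed

end
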